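(* Let $k\ge 1$ and consider the reduced-rank prediction problem of minimizing $$E\|f_{t+\delta}-AB'f_t\|^2$$ over bounded linear operators $A=[a_1,\dots,a_k]:\mathbb{R}^k\to H$ and $B=[b_1,\dots,b_k]:\mathbb{R}^k\to H$ (with $a_i,b_i\in H$), subject to the normalizing constraints $B'\Gamma_{11}B=I_k$ and $A'A$ is a diagonal matrix with decreasing elements on the diagonal. Call this problem (RR). Then: (i) There exists a $B$ solving (RR). It consists of the eigenvectors $b_1,\dots,b_k$ of the operator pencil $\Gamma_{21}\Gamma_{12}-\lambda\Gamma_{11}$ arranged in the order of declining eigenvalues. (ii) The $A$ solving (RR) is equal to $\Gamma_{12}B$. (iii) The $i$-th component $b_i$ of $B$ can be found recursively by maximizing $b_i'\Gamma_{21}\Gamma_{12}b_i$ over $b_i\in H$ subject to $b_i'\Gamma_{11}b_j=0$ for $j<i$ and $b_i'\Gamma_{11}b_i=1$. (iv) The maximum in the problem formulated in (iii) exists, is equal to the $i$-th eigenvalue (in decreasing order) of the operator pencil $\Gamma_{21}\Gamma_{12}-\lambda\Gamma_{11}$, and is the reduction in the mean squared error of forecasting due to the $i$-th predictive factor $b_i'f_t$; that is, it equals the minimal value of (RR) with $i-1$ factors minus the minimal value of (RR) with $i$ factors (with zero factors the value being $E\|f_{t+\delta}\|^2$). (v) Assuming that the first $k$ eigenvalues of $\Gamma_{21}\Gamma_{12}-\lambda\Gamma_{11}$ are distinct positive numbers and that $\Gamma_{11}$ is positive definite, the solution $(A,B)$ of (RR) is unique up to simultaneous changes of sign $(a_i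,b_i)\mapsto(-a_i,-b_i)$.
   Context: Let $\bar T>0$ and let $H=L^2[0,\bar T]$ be the real Hilbert space of square-integrable functions, with norm $\|\cdot\|$. For $x,y\in H$ write $x'y=\int_0^{\bar T}x(T)y(T)\,dT$, and let $x'$ also denote the functional $y\mapsto x'y$; more generally, a prime denotes the adjoint of an operator, so $B':H\to\mathbb{R}^k$ is $B'y=(b_1'y,\dots,b_k'y)$. A strong $H$-white noise is a sequence of i.i.d. $H$-valued random variables with mean zero and finite, nonzero $E\|\cdot\|^2$. Let $\{f_t\}$ (with $t$ in steps of $\delta>0$) be a mean-zero, weakly stationary $H$-valued process with $E\|f_t\|^2<\infty$ satisfying $f_{t+\delta}=\rho f_t+\varepsilon_t$, where $\rho$ is a Hilbert-Schmidt integral operator on $H$, $(\rho x)(S)=\int_0^{\bar T}\rho(S,T)x(T)\,dT$ with $\iint\rho(S,T)^2\,dS\,dT<\infty$, and $\{\varepsilon_t\}$ is a strong $H$-white noise with $\varepsilon_t$ uncorrelated with $f_t$. $\Gamma_{11}$ is the covariance operator of $f_t$: $\Gamma_{11}x=E[(f_t'x)f_t]$. $\Gamma_{12}$ is the cross-covariance operator $\Gamma_{12}x=E[(f_t'x)f_{t+\delta}]$, i.e. the integral operator with kernel $\Gamma_{12}(S,T)=E\{f_{t+\delta}(S)f_t(T)\}$, so that $\Gamma_{12}=\rho\Gamma_{11}$; $\Gamma_{21}=\Gamma_{12}'$ is its adjoint. An eigenvalue $\lambda$ and eigenvector $b\ne 0$ of the operator pencil $P-\lambda Q$ are such that $(P-\lambda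 Q)b=0$; eigenvalues are counted with multiplicity and listed in decreasing order, and the eigenvectors $b_i$ of $\Gamma_{21}\Gamma_{12}-\lambda\Gamma_{11}$ are normalized so that $b_i'\Gamma_{11}b_j=\delta_{ij}$ (Kronecker delta).
   Formalization: The constraints of (RR) are assumed feasible (Γ11 has rank at least k); in (v) each of the first k eigenvalues is also assumed simple, so λ_k differs from λ_{k+1}; multiplicities of the pencil are counted modulo the kernel of Γ11. *)

theory Defs
  imports "HOL-Probability.Probability"
begin

definition sq_integrable :: "(real \<Rightarrow> real) \<Rightarrow> bool" where
  "sq_integrable f \<longleftrightarrow> f \<in> borel_measurable lborel \<and> integrable lborel (\<lambda>s. (f s)\<^sup>2)"

lemma sq_integrable_measurable: "sq_integrable f \<Longrightarrow> f \<in> borel_measurable lborel"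
  by (simp add: sq_integrable_def)

lemma sq_integrable_mult:
  assumes "sq_integrable f" "sq_integrable g"
  shows "integrable lborel (\<lambda>s. f s * g s)"
proof (rule Bochner_Integration.integrable_bound)
  show "integrable lborel (\<lambda>s. (f s)\<^sup>2 + (g s)\<^sup>2)"
    using assms by (auto simp: sq_integrable_def)
  show "(\<lambda>s. f s * g s) \<in> borel_measurable lborel"
    using assms by (auto simp: sq_integrable_def)
  have "\<bar>a * b\<bar> \<le> a\<^sup>2 + b\<^sup>2" for a b :: real
  proof -
    have "2 * \<bar>a * b\<bar> \<le> a\<^sup>2 + b\<^sup>2"
      using sum_squares_bound[of "\<bar>a\<bar>" "\<bar>b\<bar>"] by (simp add: abs_mult mult.assoc)
    then show ?thesis by linarith
  qed
  then show "AE s in lborel. norm (f s * g s) \<le> norm ((f s)\<^sup>2 + (g s)\<^sup>2)"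
    by (auto intro!: AE_I2 simp: abs_of_nonneg)
qed

lemma sq_integrable_add:
  assumes "sq_integrable f" "sq_integrable g"
  shows "sq_integrable (\<lambda>s. f s + g s)"
proof -
  have "integrable lborel (\<lambda>s. (f s)\<^sup>2 + (g s)\<^sup>2 + 2 * (f s * g s))"
    using assms sq_integrable_mult[OF assms] by (auto simp: sq_integrable_def)
  then show ?thesis
    using assms by (auto simp: sq_integrable_def power2_sum ac_simps)
qed

lemma sq_integrable_scale: "sq_integrable f \<Longrightarrow> sq_integrable (\<lambda>s. c * f s)"
  by (auto simp: sq_integrable_def power_mult_distrib)

lemma sq_integrable_zero: "sq_integrable (\<lambda>s. 0)"
  by (simp add: sq_integrable_def)

lemma sq_integrable_minus: "sq_integrable f \<Longrightarrow> sq_integrable (\<lambda>s. - f s)"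
  using sq_integrable_scale[of f "-1"] by simp

lemma sq_integrable_diff:
  "sq_integrable f \<Longrightarrow> sq_integrable g \<Longrightarrow> sq_integrable (\<lambda>s. f s - g s)"
  using sq_integrable_add[of f "\<lambda>s. - g s"] sq_integrable_minus[of g] by simp

text \<open>
  The type \<open>L2\<close> is the Hilbert space of square-integrable functions on the whole real line,
  modulo equality almost everywhere; the space of functions on \<open>[0, T]\<close> is embedded in it
  (extension by zero) as the closed subspace \<open>L2_on T\<close> below.  A HOL type cannot depend on the
  real number \<open>T\<close>, so the interval has to be a parameter of a set instead.
\<close>

definition L2_rel :: "(real \<Rightarrow> real) \<Rightarrow> (real \<Rightarrow> real) \<Rightarrow> bool" where
  "L2_rel f g \<longleftrightarrow> sq_integrable f \<and> sq_integrable g \<and> (AE s in lborel. f s = g s)"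

quotient_type L2 = "real \<Rightarrow> real" / partial: L2_rel
proof (rule part_equivpI)
  show "\<exists>x. L2_rel x x"
    by (rule exI[of _ "\<lambda>_. 0"]) (simp add: L2_rel_def sq_integrable_zero)
  show "symp L2_rel"
    by (rule sympI) (auto simp: L2_rel_def elim: eventually_mono)
  show "transp L2_rel"
    by (rule transpI) (auto simp: L2_rel_def elim: eventually_elim2)
qed

lemma L2_abs_cases:
  obtains f where "sq_integrable f" "x = abs_L2 f"
  by (metis L2_rel_def Quotient3_L2 Quotient3_abs_rep Quotient3_rep_reflp)

lemma sq_integrable_rep: "sq_integrable (rep_L2 x)"
  by (metis L2_rel_def Quotient3_L2 Quotient3_rep_reflp)

lemma abs_rep_L2: "abs_L2 (rep_L2 x) = x"
  by (metis Quotient3_L2 Quotient3_abs_rep)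

lemma abs_L2_eq_iff:
  "sq_integrable f \<Longrightarrow> sq_integrable g \<Longrightarrow>
    abs_L2 f = abs_L2 g \<longleftrightarrow> (AE s in lborel. f s = g s)"
  using Quotient3_rel[OF Quotient3_L2, of f g] by (auto simp: L2_rel_def)

lemma rep_abs_L2: "sq_integrable f \<Longrightarrow> AE s in lborel. rep_L2 (abs_L2 f) s = f s"
  using abs_L2_eq_iff[of "rep_L2 (abs_L2 f)" f] by (simp add: sq_integrable_rep abs_rep_L2)

instantiation L2 :: real_inner
begin

lift_definition zero_L2 :: L2 is "\<lambda>s. 0"
  by (simp add: L2_rel_def sq_integrable_zero)

lift_definition plus_L2 :: "L2 \<Rightarrow> L2 \<Rightarrow> L2" is "\<lambda>f g s. f s + g s"
  by (auto simp: L2_rel_def intro: sq_integrable_add elim: eventually_elim2)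

lift_definition minus_L2 :: "L2 \<Rightarrow> L2 \<Rightarrow> L2" is "\<lambda>f g s. f s - g s"
  by (auto simp: L2_rel_def intro: sq_integrable_diff elim: eventually_elim2)

lift_definition uminus_L2 :: "L2 \<Rightarrow> L2" is "\<lambda>f s. - f s"
  by (auto simp: L2_rel_def intro: sq_integrable_minus)

lift_definition scaleR_L2 :: "real \<Rightarrow> L2 \<Rightarrow> L2" is "\<lambda>c f s. c * f s"
  by (auto simp: L2_rel_def intro: sq_integrable_scale)

lift_definition inner_L2 :: "L2 \<Rightarrow> L2 \<Rightarrow> real" is "\<lambda>f g. \<integral>s. f s * g s \<partial>lborel"
  by (rule integral_cong_AE) (auto simp: L2_rel_def sq_integrable_def)

definition norm_L2 :: "L2 \<Rightarrow> real" where
  "norm_L2 x = sqrt (inner x x)"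

definition sgn_L2 :: "L2 \<Rightarrow> L2" where
  "sgn_L2 x = scaleR (inverse (norm x)) x"

definition dist_L2 :: "L2 \<Rightarrow> L2 \<Rightarrow> real" where
  "dist_L2 x y = norm (x - y)"

definition uniformity_L2 :: "(L2 \<times> L2) filter" where
  "uniformity_L2 = (INF e\<in>{0<..}. principal {(x, y). dist x y < e})"

definition open_L2 :: "L2 set \<Rightarrow> bool" where
  "open_L2 U \<longleftrightarrow> (\<forall>x\<in>U. \<forall>\<^sub>F (x', y) in uniformity. x' = x \<longrightarrow> y \<in> U)"

instance
proof
  fix x y z :: L2 and a b :: real and U :: "L2 set"
  show "x + y + z = x + (y + z)"
    by transfer (auto simp: L2_rel_def ac_simps intro!: sq_integrable_add)
  show "x + y = y + x"
    by transfer (auto simp: L2_rel_def ac_simps intro!: sq_integrable_add)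
  show "0 + x = x"
    by transfer (auto simp: L2_rel_def)
  show "- x + x = 0"
    by transfer (auto simp: L2_rel_def sq_integrable_zero)
  show "x - y = x + - y"
    by transfer (auto simp: L2_rel_def intro: sq_integrable_diff)
  show "a *\<^sub>R (x + y) = a *\<^sub>R x + a *\<^sub>R y"
    by transfer (auto simp: L2_rel_def algebra_simps intro!: sq_integrable_add sq_integrable_scale)
  show "(a + b) *\<^sub>R x = a *\<^sub>R x + b *\<^sub>R x"
    by transfer (auto simp: L2_rel_def algebra_simps intro!: sq_integrable_add sq_integrable_scale)
  show "a *\<^sub>R b *\<^sub>R x = (a * b) *\<^sub>R x"
    by transfer (auto simp: L2_rel_def algebra_simps intro!: sq_integrable_scale)
  show "1 *\<^sub>R x = x"
    by transfer (auto simp: L2_rel_def)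
  show "dist x y = norm (x - y)"
    by (rule dist_L2_def)
  show "sgn x = scaleR (inverse (norm x)) x"
    by (rule sgn_L2_def)
  show "(uniformity :: (L2 \<times> L2) filter) = (INF e\<in>{0<..}. principal {(x, y). dist x y < e})"
    by (rule uniformity_L2_def)
  show "open U \<longleftrightarrow> (\<forall>x\<in>U. \<forall>\<^sub>F (x', y) in uniformity. x' = x \<longrightarrow> y \<in> U)"
    by (rule open_L2_def)
  show "inner x y = inner y x"
    by transfer (simp add: mult.commute)
  show "inner (x + y) z = inner x z + inner y z"
    by transfer (simp add: L2_rel_def distrib_right sq_integrable_mult)
  show "inner (a *\<^sub>R x) y = a * inner x y"
    by transfer (simp add: mult.assoc)
  show "0 \<le> inner x x"
    by transfer (simp add: integral_nonneg_AE)
  show "inner x x = 0 \<longleftrightarrow> x = 0"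
  proof transfer
    fix f assume "L2_rel f f"
    then have f: "sq_integrable f" by (simp add: L2_rel_def)
    then have "(\<integral>s. f s * f s \<partial>lborel) = 0 \<longleftrightarrow> (AE s in lborel. f s * f s = 0)"
      by (intro integral_nonneg_eq_0_iff_AE) (auto simp: sq_integrable_mult)
    then show "(\<integral>s. f s * f s \<partial>lborel) = 0 \<longleftrightarrow> L2_rel f (\<lambda>s. 0)"
      using f by (simp add: L2_rel_def sq_integrable_zero)
  qed
  show "norm x = sqrt (inner x x)"
    by (rule norm_L2_def)
qed

end

lemma abs_L2_add: "sq_integrable f \<Longrightarrow> sq_integrable g \<Longrightarrow> abs_L2 f + abs_L2 g = abs_L2 (\<lambda>s. f s + g s)"
  by (rule plus_L2.abs_eq) (auto simp: L2_rel_def)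

lemma abs_L2_diff: "sq_integrable f \<Longrightarrow> sq_integrable g \<Longrightarrow> abs_L2 f - abs_L2 g = abs_L2 (\<lambda>s. f s - g s)"
  by (rule minus_L2.abs_eq) (auto simp: L2_rel_def)

lemma abs_L2_scaleR: "sq_integrable f \<Longrightarrow> c *\<^sub>R abs_L2 f = abs_L2 (\<lambda>s. c * f s)"
  by (rule scaleR_L2.abs_eq) (auto simp: L2_rel_def)

lemma abs_L2_zero: "abs_L2 (\<lambda>s. 0) = 0"
  by (simp add: zero_L2_def)

lemma inner_abs_L2: "sq_integrable f \<Longrightarrow> sq_integrable g \<Longrightarrow> inner (abs_L2 f) (abs_L2 g) = (\<integral>s. f s * g s \<partial>lborel)"
  by (rule inner_L2.abs_eq) (auto simp: L2_rel_def)

lemma norm_abs_L2_sq: "sq_integrable f \<Longrightarrow> (norm (abs_L2 f))\<^sup>2 = (\<integral>s. (f s)\<^sup>2 \<partial>lborel)"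
  unfolding power2_norm_eq_inner by (simp add: inner_abs_L2 power2_eq_square)

lemma nn_integral_abs_L2:
  "sq_integrable f \<Longrightarrow> (\<integral>\<^sup>+s. ennreal ((f s)\<^sup>2) \<partial>lborel) = ennreal ((norm (abs_L2 f))\<^sup>2)"
  by (subst norm_abs_L2_sq) (auto simp: sq_integrable_def intro!: nn_integral_eq_integral)

lemma sq_integrable_iff_nn_integral:
  "sq_integrable f \<longleftrightarrow> f \<in> borel_measurable lborel \<and> (\<integral>\<^sup>+s. ennreal ((f s)\<^sup>2) \<partial>lborel) < \<infinity>"
  by (auto simp: sq_integrable_def integrable_iff_bounded)

lemma L2_dominated_convergence:
  assumes f: "\<And>n. f n \<in> borel_measurable lborel" and g: "sq_integrable g"
    and bnd: "\<And>n s. \<bar>f n s\<bar> \<le> \<bar>g s\<bar>" and lim: "\<And>s. (\<lambda>n. f n s) \<longlonglongrightarrow> h s"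
  shows "sq_integrable (f n)" "sq_integrable h" "(\<lambda>n. abs_L2 (f n)) \<longlonglongrightarrow> abs_L2 h"
proof -
  have bounded: "sq_integrable u" if "u \<in> borel_measurable lborel" "\<And>s. \<bar>u s\<bar> \<le> \<bar>g s\<bar>" for u
  proof -
    have "integrable lborel (\<lambda>s. (g s)\<^sup>2)" using g by (simp add: sq_integrable_def)
    then have "integrable lborel (\<lambda>s. (u s)\<^sup>2)"
      by (rule Bochner_Integration.integrable_bound) (use that in \<open>auto intro!: AE_I2 simp: abs_le_square_iff\<close>)
    then show ?thesis using that by (simp add: sq_integrable_def)
  qed
  show fn: "sq_integrable (f n)" for n using f bnd by (rule bounded)
  have hm: "h \<in> borel_measurable lborel"
    by (rule borel_measurable_LIMSEQ_real[of _ f]) (use lim f in auto)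
  have hb: "\<bar>h s\<bar> \<le> \<bar>g s\<bar>" for s
    by (rule LIMSEQ_le_const2[OF tendsto_rabs[OF lim]]) (auto simp: bnd)
  show h: "sq_integrable h" using hm hb by (rule bounded)
  have "(\<lambda>n. \<integral>s. (f n s - h s)\<^sup>2 \<partial>lborel) \<longlonglongrightarrow> (\<integral>s. 0 \<partial>(lborel::real measure))"
  proof (rule integral_dominated_convergence[where w = "\<lambda>s. 4 * (g s)\<^sup>2"])
    show "integrable lborel (\<lambda>s. 4 * (g s)\<^sup>2)" using g by (simp add: sq_integrable_def)
    show "AE s in lborel. (\<lambda>n. (f n s - h s)\<^sup>2) \<longlonglongrightarrow> 0"
      by (intro AE_I2) (rule tendsto_eq_intros lim refl | simp)+
    show "AE s in lborel. norm ((f n s - h s)\<^sup>2) \<le> 4 * (g s)\<^sup>2" for n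
    proof (intro AE_I2)
      fix s
      have "\<bar>f n s - h s\<bar> \<le> \<bar>2 * g s\<bar>" using bnd[of n s] hb[of s] by linarith
      then have "(f n s - h s)\<^sup>2 \<le> (2 * g s)\<^sup>2" by (simp only: abs_le_square_iff)
      then show "norm ((f n s - h s)\<^sup>2) \<le> 4 * (g s)\<^sup>2" by (simp add: power_mult_distrib)
    qed
  qed (use f hm in auto)
  then have "(\<lambda>n. (norm (abs_L2 (f n) - abs_L2 h))\<^sup>2) \<longlonglongrightarrow> 0"
    by (simp add: abs_L2_diff fn h norm_abs_L2_sq sq_integrable_diff)
  then have "(\<lambda>n. sqrt ((norm (abs_L2 (f n) - abs_L2 h))\<^sup>2)) \<longlonglongrightarrow> sqrt 0"
    by (rule tendsto_real_sqrt)
  then show "(\<lambda>n. abs_L2 (f n)) \<longlonglongrightarrow> abs_L2 h"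
    by (simp add: LIM_zero_iff tendsto_norm_zero_iff)
qed


lemma L2_nonneg_series_bounded:
  assumes d: "\<And>n. sq_integrable (d n)" and d0: "\<And>n s. 0 \<le> d n s"
    and bnd: "\<And>n. norm (abs_L2 (d n)) \<le> (1/2) ^ n"
  shows "AE s in lborel. summable (\<lambda>n. d n s)"
proof -
  have S: "sq_integrable (\<lambda>s. \<Sum>n<N. d n s) \<and> norm (abs_L2 (\<lambda>s. \<Sum>n<N. d n s)) \<le> (\<Sum>n<N. (1/2) ^ n)" for N
  proof (induction N)
    case (Suc N)
    then have "norm (abs_L2 (\<lambda>s. \<Sum>n<N. d n s) + abs_L2 (d N)) \<le> (\<Sum>n<N. (1/2) ^ n) + (1/2) ^ N"
      using bnd[of N] by (intro norm_triangle_le add_mono) auto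
    then show ?case using Suc d[of N] by (simp add: sq_integrable_add abs_L2_add)
  qed (simp add: sq_integrable_zero abs_L2_zero)
  have le2: "(\<Sum>n<N. (1/2::real) ^ n) \<le> 2" for N
    by (simp add: geometric_sum)
  let ?S = "\<lambda>N s. ennreal ((\<Sum>n<N. d n s)\<^sup>2)"
  have [measurable]: "d n \<in> borel_measurable lborel" for n
    using d by (rule sq_integrable_measurable)
  have inc: "incseq ?S"
    by (intro incseq_SucI le_funI ennreal_leI power_mono) (auto intro: sum_nonneg d0)
  have "(\<integral>\<^sup>+s. (SUP N. ?S N s) \<partial>lborel) = (SUP N. \<integral>\<^sup>+s. ?S N s \<partial>lborel)"
    using inc by (rule nn_integral_monotone_convergence_SUP) simp
  also have "\<dots> \<le> ennreal 4"
  proof (rule SUP_least)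
    fix N
    have "(norm (abs_L2 (\<lambda>s. \<Sum>n<N. d n s)))\<^sup>2 \<le> 2\<^sup>2"
      by (rule power_mono) (use S[of N] le2[of N] in auto)
    then show "(\<integral>\<^sup>+s. ?S N s \<partial>lborel) \<le> ennreal 4"
      using ennreal_leI S[of N] by (fastforce simp: nn_integral_abs_L2)
  qed
  finally have "(\<integral>\<^sup>+s. (SUP N. ?S N s) \<partial>lborel) \<noteq> \<infinity>"
    by (auto simp: top_unique)
  then have "AE s in lborel. (SUP N. ?S N s) \<noteq> \<infinity>"
    by (intro nn_integral_noteq_infinite) simp_all
  then show ?thesis
  proof (rule AE_mp, intro AE_I2 impI)
    fix s assume "(SUP N. ?S N s) \<noteq> \<infinity>"
    then obtain c where c: "(SUP N. ?S N s) = ennreal c" "0 \<le> c"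
      by (cases "SUP N. ?S N s") auto
    have "(\<Sum>n<N. d n s) \<le> sqrt c" for N
    proof -
      have "?S N s \<le> ennreal c" unfolding c(1)[symmetric] by (rule SUP_upper) simp
      then have "(\<Sum>n<N. d n s)\<^sup>2 \<le> c" using c(2) by simp
      then show ?thesis by (rule real_le_rsqrt)
    qed
    then show "summable (\<lambda>n. d n s)"
      using d0 by (intro summableI_nonneg_bounded)
  qed
qed

lemma L2_fast_Cauchy_convergent:
  fixes X :: "nat \<Rightarrow> L2"
  assumes fast: "\<And>n. norm (X (Suc n) - X n) \<le> (1/2) ^ n"
  shows "convergent X"
proof -
  define g where "g n = rep_L2 (X n)" for n
  have g: "sq_integrable (g n)" and Xg: "X n = abs_L2 (g n)" for n
    by (simp_all add: g_def sq_integrable_rep abs_rep_L2)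
  have [measurable]: "g n \<in> borel_measurable lborel" for n
    using g by (rule sq_integrable_measurable)
  define d where "d n s = \<bar>g (Suc n) s - g n s\<bar>" for n s
  have dsq: "(d n s)\<^sup>2 = (g (Suc n) s - g n s)\<^sup>2" for n s
    by (simp add: d_def)
  have [measurable]: "d n \<in> borel_measurable lborel" for n
    unfolding d_def[abs_def] by measurable
  have d: "sq_integrable (d n)" for n
    using sq_integrable_diff[OF g g, of "Suc n" n] by (simp add: sq_integrable_def dsq)
  have "(norm (abs_L2 (d n)))\<^sup>2 = (norm (X (Suc n) - X n))\<^sup>2" for n
    by (simp add: norm_abs_L2_sq d dsq Xg abs_L2_diff g sq_integrable_diff)
  then have dn: "norm (abs_L2 (d n)) = norm (X (Suc n) - X n)" for n
    by (metis norm_ge_zero power2_eq_imp_eq)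
  have "AE s in lborel. summable (\<lambda>n. d n s)"
  proof (rule L2_nonneg_series_bounded[OF d])
    show "0 \<le> d n s" for n s by (simp add: d_def)
    show "norm (abs_L2 (d n)) \<le> (1/2) ^ n" for n using dn fast by simp
  qed
  then have conv: "AE s in lborel. convergent (\<lambda>n. g n s)"
  proof (rule AE_mp, intro AE_I2 impI)
    fix s assume "summable (\<lambda>n. d n s)"
    then have "summable (\<lambda>n. \<bar>g (Suc n) s - g n s\<bar>)"
      by (simp add: d_def)
    then have "summable (\<lambda>n. g (Suc n) s - g n s)"
      by (rule summable_rabs_cancel)
    then have "convergent (\<lambda>n. \<Sum>i<n. g (Suc i) s - g i s)"
      by (simp add: summable_iff_convergent)
    then have "convergent (\<lambda>n. (g n s - g 0 s) + g 0 s)"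
      by (intro convergent_add convergent_const) (simp add: sum_lessThan_telescope[of "\<lambda>i. g i s"])
    then show "convergent (\<lambda>n. g n s)" by simp
  qed
  define h where "h s = lim (\<lambda>n. g n s)" for s
  have [measurable]: "h \<in> borel_measurable lborel"
    unfolding h_def by measurable
  have lim: "AE s in lborel. (\<lambda>n. g n s) \<longlonglongrightarrow> h s"
    using conv by eventually_elim (simp add: h_def convergent_LIMSEQ_iff)
  have tele: "norm (X (m + n) - X m) \<le> 2 * (1/2) ^ m" for m n
  proof -
    have "norm (X (m + n) - X m) \<le> (\<Sum>i<n. (1/2) ^ (m + i))"
    proof (induction n)
      case (Suc n)
      have "norm ((X (m + n) - X m) + (X (Suc (m + n)) - X (m + n))) \<le> (\<Sum>i<n. (1/2) ^ (m + i)) + (1/2) ^ (m + n)"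
        using Suc fast by (intro norm_triangle_le add_mono)
      then show ?case by simp
    qed simp
    also have "\<dots> = (1/2) ^ m * (\<Sum>i<n. (1/2) ^ i)"
      by (simp add: power_add sum_distrib_left)
    also have "\<dots> \<le> (1/2) ^ m * 2"
      by (intro mult_left_mono) (auto simp: geometric_sum)
    finally show ?thesis by simp
  qed
  have fatou: "(\<integral>\<^sup>+s. ennreal ((h s - g m s)\<^sup>2) \<partial>lborel) \<le> ennreal ((2 * (1/2) ^ m)\<^sup>2)" for m
  proof -
    have "(\<integral>\<^sup>+s. ennreal ((h s - g m s)\<^sup>2) \<partial>lborel)
        = (\<integral>\<^sup>+s. liminf (\<lambda>n. ennreal ((g (m + n) s - g m s)\<^sup>2)) \<partial>lborel)"
    proof (rule nn_integral_cong_AE)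
      show "AE s in lborel. ennreal ((h s - g m s)\<^sup>2) = liminf (\<lambda>n. ennreal ((g (m + n) s - g m s)\<^sup>2))"
        using lim
      proof eventually_elim
        fix s assume "(\<lambda>n. g n s) \<longlonglongrightarrow> h s"
        then have "(\<lambda>n. g (m + n) s) \<longlonglongrightarrow> h s"
          using LIMSEQ_ignore_initial_segment[of "\<lambda>n. g n s" "h s" m] by (simp add: add.commute)
        then have "(\<lambda>n. ennreal ((g (m + n) s - g m s)\<^sup>2)) \<longlonglongrightarrow> ennreal ((h s - g m s)\<^sup>2)"
          by (intro tendsto_ennrealI tendsto_intros)
        then show "ennreal ((h s - g m s)\<^sup>2) = liminf (\<lambda>n. ennreal ((g (m + n) s - g m s)\<^sup>2))"
          by (intro lim_imp_Liminf[symmetric]) auto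
      qed
    qed
    also have "\<dots> \<le> liminf (\<lambda>n. \<integral>\<^sup>+s. ennreal ((g (m + n) s - g m s)\<^sup>2) \<partial>lborel)"
      by (rule nn_integral_liminf) simp
    also have "\<dots> \<le> ennreal ((2 * (1/2) ^ m)\<^sup>2)"
    proof -
      have "(\<integral>\<^sup>+s. ennreal ((g (m + n) s - g m s)\<^sup>2) \<partial>lborel) \<le> ennreal ((2 * (1/2) ^ m)\<^sup>2)" for n
      proof -
        have "(\<integral>\<^sup>+s. ennreal ((g (m + n) s - g m s)\<^sup>2) \<partial>lborel) = ennreal ((norm (X (m + n) - X m))\<^sup>2)"
          by (simp only: Xg abs_L2_diff[OF g g] nn_integral_abs_L2[OF sq_integrable_diff[OF g g]])
        also have "\<dots> \<le> ennreal ((2 * (1/2) ^ m)\<^sup>2)"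
          by (intro ennreal_leI power_mono tele) simp
        finally show ?thesis .
      qed
      then show ?thesis
        by (intro order_trans[OF Liminf_le_Limsup] Limsup_bounded) auto
    qed
    finally show ?thesis .
  qed
  have hg: "sq_integrable (\<lambda>s. h s - g m s)" for m
    unfolding sq_integrable_iff_nn_integral using le_less_trans[OF fatou] by auto
  have h: "sq_integrable h"
    using sq_integrable_add[OF hg[of 0] g[of 0]] by simp
  have le: "norm (X m - abs_L2 h) \<le> 2 * (1/2) ^ m" for m
  proof -
    have "ennreal ((norm (abs_L2 h - X m))\<^sup>2) \<le> ennreal ((2 * (1/2) ^ m)\<^sup>2)"
      using fatou[of m] by (simp only: Xg abs_L2_diff[OF h g] nn_integral_abs_L2[OF hg])
    then have "(norm (abs_L2 h - X m))\<^sup>2 \<le> (2 * (1/2) ^ m)\<^sup>2"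
      by (subst (asm) ennreal_le_iff) auto
    then have "norm (abs_L2 h - X m) \<le> 2 * (1/2) ^ m"
      by (rule power2_le_imp_le) simp
    then show ?thesis by (simp add: norm_minus_commute)
  qed
  have lim0: "(\<lambda>m. 2 * (1/2::real) ^ m) \<longlonglongrightarrow> 0"
    by (rule tendsto_eq_intros LIMSEQ_power_zero refl | simp)+
  have "\<forall>\<^sub>F m in sequentially. norm (X m - abs_L2 h) \<le> 2 * (1/2) ^ m"
    using le by (intro always_eventually) simp
  then have "(\<lambda>m. X m - abs_L2 h) \<longlonglongrightarrow> 0"
    using lim0 by (rule Lim_null_comparison)
  then show ?thesis
    by (auto simp: convergent_def LIM_zero_iff)
qed

instance L2 :: banach
proof
  fix X :: "nat \<Rightarrow> L2"
  assume C: "Cauchy X"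
  have "\<exists>M. \<forall>m\<ge>M. \<forall>n\<ge>M. norm (X m - X n) < (1/2) ^ k" for k
    using CauchyD[OF C, of "(1/2) ^ k"] by simp
  then obtain M where M: "\<And>k m n. M k \<le> m \<Longrightarrow> M k \<le> n \<Longrightarrow> norm (X m - X n) < (1/2) ^ k"
    by metis
  define r where "r k = (\<Sum>j\<le>k. Suc (M j))" for k
  have r: "strict_mono r"
    by (rule strict_monoI_Suc) (simp add: r_def)
  have rM: "M k \<le> r k" for k
    unfolding r_def by (cases k) auto
  have "convergent (X \<circ> r)"
  proof (rule L2_fast_Cauchy_convergent)
    fix k
    have "M k \<le> r (Suc k)" using rM[of k] by (simp add: r_def)
    then show "norm ((X \<circ> r) (Suc k) - (X \<circ> r) k) \<le> (1/2) ^ k"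
      using M[OF _ rM] by (simp add: less_imp_le)
  qed
  then obtain l where l: "(X \<circ> r) \<longlonglongrightarrow> l" by (auto simp: convergent_def)
  then show "convergent X"
    using Cauchy_converges_subseq[OF C r l] by (auto simp: convergent_def)
qed


lemma subspace_closure_normed:
  fixes V :: "'a::real_normed_vector set"
  assumes "subspace V"
  shows "subspace (closure V)"
proof (rule subspaceI)
  show "0 \<in> closure V"
    using subspace_0[OF assms] closure_subset by blast
  fix x y :: 'a and c :: real
  assume x: "x \<in> closure V"
  then obtain u where u: "\<And>n. u n \<in> V" "u \<longlonglongrightarrow> x"
    unfolding closure_sequential by blast
  show "c *\<^sub>R x \<in> closure V"
    unfolding closure_sequential
    by (rule exI[of _ "\<lambda>n. c *\<^sub>R u n"]) (intro conjI allI subspace_scale assms u tendsto_intros)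
  assume "y \<in> closure V"
  then obtain w where w: "\<And>n. w n \<in> V" "w \<longlonglongrightarrow> y"
    unfolding closure_sequential by blast
  show "x + y \<in> closure V"
    unfolding closure_sequential
    by (rule exI[of _ "\<lambda>n. u n + w n"]) (intro conjI allI subspace_add assms u w tendsto_add)
qed

lemma countable_dense_if_closure_span:
  fixes S :: "'a::real_normed_vector set"
  assumes S: "countable S" and dense: "closure (span S) = UNIV"
  shows "\<exists>D::'a set. countable D \<and> closure D = UNIV"
proof -
  define D where "D = (\<lambda>l. \<Sum>(q, v)\<leftarrow>l. real_of_rat q *\<^sub>R v) ` lists (UNIV \<times> S)"
  have "countable D"
    unfolding D_def using S by (intro countable_image countable_lists countable_SIGMA) auto
  have zero: "0 \<in> D"
    unfolding D_def by (rule image_eqI[of _ _ "[]"]) auto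
  have addD: "x + y \<in> D" if "x \<in> D" "y \<in> D" for x y
  proof -
    from that obtain l m where "l \<in> lists (UNIV \<times> S)" "m \<in> lists (UNIV \<times> S)"
      "x = (\<Sum>(q, v)\<leftarrow>l. real_of_rat q *\<^sub>R v)" "y = (\<Sum>(q, v)\<leftarrow>m. real_of_rat q *\<^sub>R v)"
      unfolding D_def by blast
    then show ?thesis unfolding D_def by (intro image_eqI[of _ _ "l @ m"]) auto
  qed
  have ratS: "real_of_rat q *\<^sub>R v \<in> D" if "v \<in> S" for q v
    unfolding D_def by (rule image_eqI[of _ _ "[(q, v)]"]) (use that in auto)
  have realS: "c *\<^sub>R v \<in> closure D" if "v \<in> S" for c v
  proof -
    have "\<exists>q. \<bar>real_of_rat q - c\<bar> < e" if e: "0 < e" for e :: real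
    proof -
      obtain q where "c < real_of_rat q" "real_of_rat q < c + e"
        using of_rat_dense[of c "c + e"] e by auto
      then show ?thesis by (intro exI[of _ q]) auto
    qed
    then have "\<exists>q. \<forall>n. \<bar>real_of_rat (q n) - c\<bar> < 1 / real (Suc n)"
      by (intro choice allI) simp
    then obtain q where q: "\<And>n. \<bar>real_of_rat (q n) - c\<bar> < 1 / real (Suc n)" by blast
    have "(\<lambda>n. real_of_rat (q n) - c) \<longlonglongrightarrow> 0"
      using q by (intro Lim_null_comparison[OF _ LIMSEQ_inverse_real_of_nat])
        (auto intro!: always_eventually simp: inverse_eq_divide less_imp_le)
    then have "(\<lambda>n. real_of_rat (q n)) \<longlonglongrightarrow> c" by (simp add: LIM_zero_iff)
    then have "(\<lambda>n. real_of_rat (q n) *\<^sub>R v) \<longlonglongrightarrow> c *\<^sub>R v" by (intro tendsto_intros)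
    then show ?thesis
      unfolding closure_sequential
      by (intro exI[of _ "\<lambda>n. real_of_rat (q n) *\<^sub>R v"] conjI allI ratS that)
  qed
  have addC: "x + y \<in> closure D" if xy: "x \<in> closure D" "y \<in> closure D" for x y
  proof -
    from xy obtain u w where "\<And>n. u n \<in> D" "u \<longlonglongrightarrow> x" "\<And>n. w n \<in> D" "w \<longlonglongrightarrow> y"
      unfolding closure_sequential by blast
    then show ?thesis
      unfolding closure_sequential
      by (intro exI[of _ "\<lambda>n. u n + w n"] conjI allI addD tendsto_add)
  qed
  have "span S \<subseteq> closure D"
  proof
    fix x assume "x \<in> span S"
    then show "x \<in> closure D"
    proof (induction rule: span_induct_alt)
      case base show ?case using zero closure_subset by blast
    next
      case (step c v y) then show ?case by (intro addC realS)
    qed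
  qed
  then have "closure D = UNIV"
    using closure_mono[of "span S" "closure D"] dense by auto
  with \<open>countable D\<close> show ?thesis by blast
qed

lemma countable_subbasis_if_dense:
  fixes D :: "'a::metric_space set"
  assumes D: "countable D" and dense: "closure D = UNIV"
  shows "\<exists>B::'a set set. countable B \<and> open = generate_topology B"
proof -
  define B where "B = (\<lambda>(x::'a, q). ball x (real_of_rat q)) ` (D \<times> UNIV)"
  have "countable B" unfolding B_def using D by (intro countable_image countable_SIGMA) auto
  moreover have "topological_basis B"
  proof (rule topological_basisI)
    fix U :: "'a set" and x assume U: "open U" "x \<in> U"
    then obtain e where e: "0 < e" "ball x e \<subseteq> U" by (meson open_contains_ball)
    have "x \<in> closure D" using dense by simp
    then obtain y where y: "y \<in> D" "dist y x < e / 2"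
      using e(1) by (meson closure_approachable half_gt_zero)
    obtain q where q: "dist y x < real_of_rat q" "real_of_rat q < e / 2"
      using of_rat_dense[OF y(2)] by blast
    have "ball y (real_of_rat q) \<subseteq> ball x e"
    proof
      fix z assume "z \<in> ball y (real_of_rat q)"
      then show "z \<in> ball x e"
        using y(2) q(2) dist_triangle[of x z y] by (simp add: dist_commute)
    qed
    then show "\<exists>b\<in>B. x \<in> b \<and> b \<subseteq> U"
      using y q e unfolding B_def by (intro bexI[of _ "ball y (real_of_rat q)"]) auto
  qed (auto simp: B_def)
  ultimately show ?thesis
    using topological_basis_imp_subbasis by blast
qed

lemma L2_eq_closed_span:
  "\<exists>S::L2 set. countable S \<and> closure (span S) = UNIV"
proof -
  obtain B :: "real set set" where B: "countable B" "topological_basis B"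
    using ex_countable_basis by blast
  define G where "G = Inter ` {F. finite F \<and> F \<subseteq> B}"
  define J where "J m = {- real m<..real m}" for m :: nat
  define S where "S = (\<lambda>(A, m). abs_L2 (indicator (A \<inter> J m))) ` (G \<times> UNIV)"
  define V where "V = closure (span S)"
  have "countable G"
    unfolding G_def by (intro countable_image countable_Collect_finite_subset B)
  then have "countable S"
    unfolding S_def by (intro countable_image countable_SIGMA) auto
  have G_open: "open A" if "A \<in> G" for A
    using that B(2) topological_basis_open unfolding G_def by blast
  have G_Int: "Int_stable G"
  proof (rule Int_stableI)
    fix a b assume "a \<in> G" "b \<in> G"
    then obtain F F' where "finite F" "F \<subseteq> B" "a = \<Inter>F" "finite F'" "F' \<subseteq> B" "b = \<Inter>F'"
      unfolding G_def by blast
    then show "a \<inter> b \<in> G"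
      unfolding G_def by (intro image_eqI[of _ _ "F \<union> F'"]) auto
  qed
  have G_UNIV: "UNIV \<in> G"
    unfolding G_def by (rule image_eqI[of _ _ "{}"]) auto
  have G_sigma: "sets borel = sigma_sets UNIV G"
  proof
    have "B \<subseteq> G"
      unfolding G_def by (auto intro!: image_eqI[of _ _ "{b}" for b])
    then have "sigma_sets UNIV B \<subseteq> sigma_sets UNIV G" by (rule sigma_sets_mono')
    then show "sets borel \<subseteq> sigma_sets UNIV G"
      by (subst borel_eq_countable_basis[OF B]) simp
    show "sigma_sets UNIV G \<subseteq> sets borel"
      using G_open by (intro sets.sigma_sets_subset[of G borel, simplified]) auto
  qed
  have V_sub: "subspace V" unfolding V_def by (intro subspace_closure_normed subspace_span)
  have V_lim: "x \<in> V" if "u \<longlonglongrightarrow> x" "\<And>n. u n \<in> V" for u x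
    using closed_sequentially[of V u x] that unfolding V_def by auto
  have J_meas [measurable]: "J m \<in> sets borel" for m by (simp add: J_def)
  have ind: "sq_integrable (indicator (A \<inter> J m))" if [measurable]: "A \<in> sets borel" for A m
  proof -
    have "(\<lambda>s. (indicator (A \<inter> J m) s :: real)\<^sup>2) = indicator (A \<inter> J m)"
      by (auto simp: indicator_def)
    moreover have "emeasure lborel (A \<inter> J m) \<le> emeasure lborel (J m)"
      by (rule emeasure_mono) auto
    then have "emeasure lborel (A \<inter> J m) < \<infinity>"
      by (rule le_less_trans) (simp add: J_def)
    ultimately show ?thesis
      unfolding sq_integrable_def by simp
  qed
  have V_ind: "abs_L2 (indicator (A \<inter> J m)) \<in> V" if "A \<in> sets borel" for A m
  proof -
    have UB: "UNIV \<in> sets (borel :: real measure)" by simp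
    have basic: "abs_L2 (indicator (A \<inter> J m)) \<in> V" if "A \<in> G" for A
    proof -
      have "abs_L2 (indicator (A \<inter> J m)) \<in> S"
        unfolding S_def using that by (intro image_eqI[of _ _ "(A, m)"]) auto
      then show ?thesis unfolding V_def by (meson closure_subset span_base subsetD)
    qed
    have "G \<subseteq> Pow UNIV" "A \<in> sigma_sets UNIV G" using that by (simp_all add: G_sigma)
    from G_Int this show ?thesis
    proof (induction rule: sigma_sets_induct_disjoint)
      case (basic A) then show ?case by fact
    next
      case empty
      have "indicator ({} \<inter> J m) = (\<lambda>s. 0::real)" by (auto simp: indicator_def)
      then show ?case using subspace_0[OF V_sub] by (simp only: abs_L2_zero)
    next
      case (compl A)
      then have A: "A \<in> sets borel" by (simp add: G_sigma)
      have eq: "(\<lambda>s. indicator (UNIV \<inter> J m) s - indicator (A \<inter> J m) s) = (indicator ((UNIV - A) \<inter> J m) :: real \<Rightarrow> real)"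
        by (auto simp: indicator_def)
      have "abs_L2 (indicator (UNIV \<inter> J m)) - abs_L2 (indicator (A \<inter> J m)) \<in> V"
        using compl basic[OF G_UNIV] by (intro subspace_diff[OF V_sub])
      then show ?case by (simp only: abs_L2_diff[OF ind[OF UB] ind[OF A]] eq)
    next
      case (union A)
      then have A [measurable]: "A i \<in> sets borel" for i by (auto simp: G_sigma)
      have step: "abs_L2 (indicator ((\<Union>i<n. A i) \<inter> J m)) \<in> V" for n
      proof (induction n)
        case 0
        have "indicator ((\<Union>i<0::nat. A i) \<inter> J m) = (\<lambda>s. 0::real)" by (auto simp: indicator_def)
        then show ?case using subspace_0[OF V_sub] by (simp only: abs_L2_zero)
      next
        case (Suc n)
        have U: "(\<Union>i<n. A i) \<in> sets borel" by measurable
        have "A i \<inter> A n = {}" if "i < n" for i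
          using union(1) that by (auto simp: disjoint_family_on_def)
        then have eq: "(\<lambda>s. indicator ((\<Union>i<n. A i) \<inter> J m) s + indicator (A n \<inter> J m) s) = (indicator ((\<Union>i<Suc n. A i) \<inter> J m) :: real \<Rightarrow> real)"
          by (fastforce simp: indicator_def lessThan_Suc)
        have "abs_L2 (indicator ((\<Union>i<n. A i) \<inter> J m)) + abs_L2 (indicator (A n \<inter> J m)) \<in> V"
          using Suc union(3) by (intro subspace_add[OF V_sub])
        then show ?case by (simp only: abs_L2_add[OF ind[OF U] ind[OF A]] eq)
      qed
      show ?case
      proof (rule V_lim[OF L2_dominated_convergence(3)[where g = "indicator (UNIV \<inter> J m)"] step])
        show "sq_integrable (indicator (UNIV \<inter> J m))" by (rule ind) simp
        show "(\<lambda>n. indicator ((\<Union>i<n. A i) \<inter> J m) s :: real) \<longlonglongrightarrow> indicator ((\<Union>i. A i) \<inter> J m) s" for s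
        proof (cases "s \<in> (\<Union>i. A i) \<inter> J m")
          case True
          then obtain i where i: "s \<in> A i" "s \<in> J m" by blast
          have "\<forall>\<^sub>F n in sequentially. indicator ((\<Union>i. A i) \<inter> J m) s = (indicator ((\<Union>i<n. A i) \<inter> J m) s :: real)"
            using eventually_gt_at_top[of i] by eventually_elim (use i in \<open>auto simp: indicator_def\<close>)
          then show ?thesis by (rule Lim_transform_eventually[OF tendsto_const])
        qed (auto simp: indicator_def)
      qed (auto simp: indicator_def)
    qed
  qed
  have "x \<in> V" for x
  proof -
    obtain f where f: "sq_integrable f" "x = abs_L2 f" by (rule L2_abs_cases)
    have [measurable]: "f \<in> borel_measurable borel" using f(1) by (simp add: sq_integrable_def)
    obtain F where F: "\<And>i. simple_function borel (F i)" "\<And>s. (\<lambda>i. F i s) \<longlonglongrightarrow> f s"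
      "\<And>i s. dist (F i s) 0 \<le> 2 * dist (f s) 0"
      using borel_measurable_implies_sequence_metric[of f borel 0] by auto
    have [measurable]: "F i \<in> borel_measurable borel" for i
      using F(1) by (rule borel_measurable_simple_function)
    define u where "u n s = indicator (J n) s * F n s" for n s
    define e where "e n y s = y * indicator ((F n -` {y}) \<inter> J n) s" for n y s
    have fin: "finite (range (F n))" for n
      using F(1)[of n] by (simp add: simple_function_def)
    have u_e: "u n = (\<lambda>s. \<Sum>y\<in>range (F n). e n y s)" for n
    proof
      fix s
      have "(\<Sum>y\<in>range (F n). e n y s) = (\<Sum>y\<in>range (F n). if y = F n s then indicator (J n) s * F n s else 0)"
        by (rule sum.cong) (auto simp: e_def indicator_def)
      then show "u n s = (\<Sum>y\<in>range (F n). e n y s)"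
        using fin by (simp add: u_def)
    qed
    have e_sq: "sq_integrable (e n y)" and e_V: "abs_L2 (e n y) \<in> V" for n y
    proof -
      have m: "F n -` {y} \<in> sets borel"
        using measurable_sets[of "F n" borel borel "{y}"] by simp
      show "sq_integrable (e n y)"
        unfolding e_def[abs_def] by (intro sq_integrable_scale ind m)
      show "abs_L2 (e n y) \<in> V"
        unfolding e_def[abs_def] abs_L2_scaleR[OF ind[OF m], symmetric]
        by (intro subspace_scale[OF V_sub] V_ind m)
    qed
    have "sq_integrable (\<lambda>s. \<Sum>y\<in>Y. e n y s) \<and> abs_L2 (\<lambda>s. \<Sum>y\<in>Y. e n y s) \<in> V" if "finite Y" for Y n
      using that
    proof (induction Y)
      case empty
      then show ?case using subspace_0[OF V_sub] by (simp add: sq_integrable_zero abs_L2_zero)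
    next
      case (insert y Y)
      then have "abs_L2 (e n y) + abs_L2 (\<lambda>s. \<Sum>y\<in>Y. e n y s) \<in> V"
        by (intro subspace_add[OF V_sub] e_V) auto
      then show ?case
        using insert e_sq by (simp add: abs_L2_add sq_integrable_add)
    qed
    then have un: "abs_L2 (u n) \<in> V" for n
      using fin by (simp add: u_e)
    show ?thesis unfolding f(2)
    proof (rule V_lim[OF L2_dominated_convergence(3)[where g = "\<lambda>s. 2 * f s"] un])
      show "u n \<in> borel_measurable lborel" for n unfolding u_def[abs_def] by measurable
      show "sq_integrable (\<lambda>s. 2 * f s)" by (rule sq_integrable_scale) fact
      show "\<bar>u n s\<bar> \<le> \<bar>2 * f s\<bar>" for n s
        using F(3)[of n s] by (auto simp: u_def indicator_def dist_real_def)
      show "(\<lambda>n. u n s) \<longlonglongrightarrow> f s" for s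
      proof (rule Lim_transform_eventually[OF F(2)])
        obtain n0 :: nat where n0: "\<bar>s\<bar> < real n0" using reals_Archimedean2 by blast
        show "\<forall>\<^sub>F n in sequentially. F n s = u n s"
          using eventually_ge_at_top[of n0]
          by eventually_elim (use n0 in \<open>auto simp: u_def J_def indicator_def\<close>)
      qed
    qed
  qed
  then have "closure (span S) = UNIV" by (auto simp: V_def)
  with \<open>countable S\<close> show ?thesis by blast
qed

instance L2 :: second_countable_topology
proof
  obtain S :: "L2 set" where S: "countable S" "closure (span S) = UNIV"
    using L2_eq_closed_span by blast
  show "\<exists>B::L2 set set. countable B \<and> open = generate_topology B"
    using countable_dense_if_closure_span[OF S] countable_subbasis_if_dense by blast
qed

definition L2_on :: "real \<Rightarrow> L2 set" where
  "L2_on T = {x. AE s in lborel. s \<notin> {0..T} \<longrightarrow> rep_L2 x s = 0}"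

definition hilbert_schmidt_kernel :: "real \<Rightarrow> (real \<Rightarrow> real \<Rightarrow> real) \<Rightarrow> bool" where
  "hilbert_schmidt_kernel T \<kappa> \<longleftrightarrow>
     set_borel_measurable (lborel \<Otimes>\<^sub>M lborel) ({0..T} \<times> {0..T}) (\<lambda>(s, u). \<kappa> s u) \<and>
     set_integrable (lborel \<Otimes>\<^sub>M lborel) ({0..T} \<times> {0..T}) (\<lambda>(s, u). (\<kappa> s u)\<^sup>2)"

definition integral_operator :: "real \<Rightarrow> (real \<Rightarrow> real \<Rightarrow> real) \<Rightarrow> L2 \<Rightarrow> L2" where
  "integral_operator T \<kappa> x =
     abs_L2 (\<lambda>s. indicator {0..T} s * (LINT u:{0..T}|lborel. \<kappa> s u * rep_L2 x u))"

definition time_grid :: "real \<Rightarrow> real set" where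
  "time_grid \<delta> = range (\<lambda>n::int. of_int n * \<delta>)"

definition second_order :: "'w measure \<Rightarrow> real \<Rightarrow> ('w \<Rightarrow> L2) \<Rightarrow> bool" where
  "second_order M T X \<longleftrightarrow> X \<in> borel_measurable M \<and> (\<forall>\<omega>\<in>space M. X \<omega> \<in> L2_on T) \<and>
     integrable M (\<lambda>\<omega>. (norm (X \<omega>))\<^sup>2)"

text \<open>
  The operator \<open>x \<mapsto> E[(X'x) Y]\<close>, a Bochner expectation.  Only centred variables are considered, so no
  means are subtracted.
\<close>

definition cross_cov :: "'w measure \<Rightarrow> ('w \<Rightarrow> L2) \<Rightarrow> ('w \<Rightarrow> L2) \<Rightarrow> L2 \<Rightarrow> L2" where
  "cross_cov M X Y x = (\<integral>\<omega>. (X \<omega> \<bullet> x) *\<^sub>R Y \<omega> \<partial>M)"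

definition centred_weakly_stationary :: "'w measure \<Rightarrow> real \<Rightarrow> real \<Rightarrow> (real \<Rightarrow> 'w \<Rightarrow> L2) \<Rightarrow> bool" where
  "centred_weakly_stationary M T \<delta> f \<longleftrightarrow>
     (\<forall>t\<in>time_grid \<delta>. second_order M T (f t) \<and> (\<integral>\<omega>. f t \<omega> \<partial>M) = 0) \<and>
     (\<forall>s\<in>time_grid \<delta>. \<forall>t\<in>time_grid \<delta>. \<forall>h\<in>time_grid \<delta>.
        cross_cov M (f (s + h)) (f (t + h)) = cross_cov M (f s) (f t))"

definition strong_white_noise :: "'w measure \<Rightarrow> real \<Rightarrow> real \<Rightarrow> (real \<Rightarrow> 'w \<Rightarrow> L2) \<Rightarrow> bool" where
  "strong_white_noise M T \<delta> \<epsilon> \<longleftrightarrow>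
     prob_space.indep_vars M (\<lambda>_. borel) \<epsilon> (time_grid \<delta>) \<and>
     (\<forall>s\<in>time_grid \<delta>. \<forall>t\<in>time_grid \<delta>. distr M borel (\<epsilon> s) = distr M borel (\<epsilon> t)) \<and>
     (\<forall>t\<in>time_grid \<delta>. second_order M T (\<epsilon> t) \<and> (\<integral>\<omega>. \<epsilon> t \<omega> \<partial>M) = 0 \<and>
        (\<integral>\<omega>. (norm (\<epsilon> t \<omega>))\<^sup>2 \<partial>M) \<noteq> 0)"

definition functional_AR1 ::
  "'w measure \<Rightarrow> real \<Rightarrow> real \<Rightarrow> (real \<Rightarrow> real \<Rightarrow> real) \<Rightarrow> (real \<Rightarrow> 'w \<Rightarrow> L2) \<Rightarrow> (real \<Rightarrow> 'w \<Rightarrow> L2) \<Rightarrow> bool"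
where
  "functional_AR1 M T \<delta> \<rho> f \<epsilon> \<longleftrightarrow>
     hilbert_schmidt_kernel T \<rho> \<and> centred_weakly_stationary M T \<delta> f \<and> strong_white_noise M T \<delta> \<epsilon> \<and>
     (\<forall>t\<in>time_grid \<delta>. AE \<omega> in M. f (t + \<delta>) \<omega> = integral_operator T \<rho> (f t \<omega>) + \<epsilon> t \<omega>) \<and>
     (\<forall>t\<in>time_grid \<delta>. \<forall>x. cross_cov M (f t) (\<epsilon> t) x = 0)"

definition pencil_eigenvector :: "'a::real_vector set \<Rightarrow> ('a \<Rightarrow> 'a) \<Rightarrow> ('a \<Rightarrow> 'a) \<Rightarrow> real \<Rightarrow> 'a \<Rightarrow> bool" where
  "pencil_eigenvector H P Q \<mu> b \<longleftrightarrow> b \<in> H \<and> b \<noteq> 0 \<and> P b - \<mu> *\<^sub>R Q b = 0"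

text \<open>
  The dimension of the eigenspace modulo the kernel of \<open>Q\<close>; it is the dimension of the eigenspace if \<open>Q\<close>
  is injective on \<open>H\<close>.  Vectors annihilated by both \<open>P\<close> and \<open>Q\<close> are eigenvectors for every real number
  but cannot be normalised by \<open>b'Qb = 1\<close>; they must not be counted.
\<close>

definition pencil_multiplicity :: "'a::real_vector set \<Rightarrow> ('a \<Rightarrow> 'a) \<Rightarrow> ('a \<Rightarrow> 'a) \<Rightarrow> real \<Rightarrow> enat" where
  "pencil_multiplicity H P Q \<mu> =
     Sup {enat (card S) |S. finite S \<and> independent S \<and> S \<subseteq> Q ` {b. pencil_eigenvector H P Q \<mu> b}}"

text \<open>
  \<open>lam 1 \<ge> \<dots> \<ge> lam k\<close> is the beginning of the list of eigenvalues in decreasing order, each repeated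
  according to its multiplicity.  This determines \<open>lam\<close> on \<open>{1..k}\<close>.
\<close>

definition leading_eigenvalues ::
  "'a::real_vector set \<Rightarrow> ('a \<Rightarrow> 'a) \<Rightarrow> ('a \<Rightarrow> 'a) \<Rightarrow> nat \<Rightarrow> (nat \<Rightarrow> real) \<Rightarrow> bool"
where
  "leading_eigenvalues H P Q k lam \<longleftrightarrow>
     antimono_on {1..k} lam \<and>
     (\<forall>\<mu>. enat (card {i\<in>{1..k}. lam i = \<mu>}) \<le> pencil_multiplicity H P Q \<mu>) \<and>
     (\<forall>\<mu>. (\<exists>i\<in>{1..k}. lam i < \<mu>) \<longrightarrow> enat (card {i\<in>{1..k}. lam i = \<mu>}) = pencil_multiplicity H P Q \<mu>)"

definition orthonormal_wrt :: "('a::real_inner \<Rightarrow> 'a) \<Rightarrow> nat \<Rightarrow> (nat \<Rightarrow> 'a) \<Rightarrow> bool" where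
  "orthonormal_wrt Q k b \<longleftrightarrow> (\<forall>i\<in>{1..k}. \<forall>j\<in>{1..k}. b i \<bullet> Q (b j) = (if i = j then 1 else 0))"

text \<open>
  In the reduced-rank problem of predicting \<open>Y\<close> from \<open>X\<close>, the operators \<open>A = [a 1, \<dots>, a k]\<close> and
  \<open>B = [b 1, \<dots>, b k]\<close> are given by their columns, so that \<open>A B' x = (\<Sum>i = 1..k. (b i \<bullet> x) a i)\<close>; the values
  of \<open>a\<close> and \<open>b\<close> outside \<open>{1..k}\<close> are irrelevant.
\<close>

definition rr_mse :: "'w measure \<Rightarrow> ('w \<Rightarrow> L2) \<Rightarrow> ('w \<Rightarrow> L2) \<Rightarrow> nat \<Rightarrow> (nat \<Rightarrow> L2) \<Rightarrow> (nat \<Rightarrow> L2) \<Rightarrow> real" where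
  "rr_mse M X Y k a b = (\<integral>\<omega>. (norm (Y \<omega> - (\<Sum>i = 1..k. (b i \<bullet> X \<omega>) *\<^sub>R a i)))\<^sup>2 \<partial>M)"

definition rr_feasible ::
  "'w measure \<Rightarrow> L2 set \<Rightarrow> ('w \<Rightarrow> L2) \<Rightarrow> nat \<Rightarrow> (nat \<Rightarrow> L2) \<Rightarrow> (nat \<Rightarrow> L2) \<Rightarrow> bool"
where
  "rr_feasible M H X k a b \<longleftrightarrow>
     (\<forall>i\<in>{1..k}. a i \<in> H \<and> b i \<in> H) \<and>
     orthonormal_wrt (cross_cov M X X) k b \<and>
     (\<forall>i\<in>{1..k}. \<forall>j\<in>{1..k}. i \<noteq> j \<longrightarrow> a i \<bullet> a j = 0) \<and>
     antimono_on {1..k} (\<lambda>i. a i \<bullet> a i)"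

definition rr_solution ::
  "'w measure \<Rightarrow> L2 set \<Rightarrow> ('w \<Rightarrow> L2) \<Rightarrow> ('w \<Rightarrow> L2) \<Rightarrow> nat \<Rightarrow> (nat \<Rightarrow> L2) \<Rightarrow> (nat \<Rightarrow> L2) \<Rightarrow> bool"
where
  "rr_solution M H X Y k a b \<longleftrightarrow>
     is_arg_min (\<lambda>(a, b). rr_mse M X Y k a b) (\<lambda>(a, b). rr_feasible M H X k a b) (a, b)"

text \<open>For \<open>k = 0\<close> this is \<open>E\<parallel>Y\<parallel>\<^sup>2\<close>; the infimum is a minimum whenever \<open>rr_solution\<close> has a solution.\<close>

definition rr_min :: "'w measure \<Rightarrow> L2 set \<Rightarrow> ('w \<Rightarrow> L2) \<Rightarrow> ('w \<Rightarrow> L2) \<Rightarrow> nat \<Rightarrow> real" where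
  "rr_min M H X Y k = Inf {rr_mse M X Y k a b |a b. rr_feasible M H X k a b}"

lemma rr_min_0: "rr_min M H X Y 0 = (\<integral>\<omega>. (norm (Y \<omega>))\<^sup>2 \<partial>M)"
  by (simp add: rr_min_def rr_mse_def rr_feasible_def orthonormal_wrt_def monotone_on_def)

definition recursive_maximizer ::
  "'a::real_inner set \<Rightarrow> ('a \<Rightarrow> 'a) \<Rightarrow> ('a \<Rightarrow> 'a) \<Rightarrow> (nat \<Rightarrow> 'a) \<Rightarrow> nat \<Rightarrow> 'a \<Rightarrow> bool"
where
  "recursive_maximizer H P Q b i x \<longleftrightarrow>
     is_arg_max (\<lambda>x. x \<bullet> P x) (\<lambda>x. x \<in> H \<and> (\<forall>j\<in>{1..<i}. x \<bullet> Q (b j) = 0) \<and> x \<bullet> Q x = 1) x"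

end

theory Submission
  imports Defs
begin

text \<open>
  Write \<open>X\<close> for the predictor, \<open>Y\<close> for the next curve, \<open>Q\<close> for the covariance operator of \<open>X\<close>, \<open>C\<close>
  for the cross-covariance operator from \<open>X\<close> to \<open>Y\<close> and \<open>C'\<close> for its adjoint.  If \<open>B\<close> is
  normalised by \<open>B'QB = I\<close>, then expanding the square gives

  \<open>E\<parallel>Y - AB'X\<parallel>\<^sup>2 = E\<parallel>Y\<parallel>\<^sup>2 + (\<Sum>i. \<parallel>a i - C (b i)\<parallel>\<^sup>2) - (\<Sum>i. \<parallel>C (b i)\<parallel>\<^sup>2)\<close>

  (\<open>rr_mse_orthonormal\<close>), so \<open>A = CB\<close> is forced and what remains is to maximise
  \<open>\<Sum>i. b i \<bullet> C'C (b i)\<close> over systems that are orthonormal for the semi-inner product \<open>x \<bullet> Q y\<close>: a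
  problem about the largest eigenvalues of the pencil \<open>(C'C, Q)\<close>.

  The operator \<open>Q\<close> is compact and may have a kernel, so a maximiser might only exist in the
  completion of \<open>H\<close> for that semi-inner product.  The autoregression excludes this.  Let \<open>R\<close> be the
  adjoint of the regression operator \<open>\<rho>\<close>.  Up to uncorrelated noise \<open>Y\<close> is \<open>\<rho>X\<close>, and therefore \<open>C' = QR\<close>
  and \<open>CR\<close> is the covariance operator of \<open>\<rho>X\<close>, which is compact.  Hence every limit of a maximising
  sequence that is computed in the range of \<open>C\<close> can be pulled back to \<open>H\<close> by \<open>R\<close>
  (\<open>maximizer_exists\<close>).  One inequality, \<open>residual_bound\<close>, serves both for this existence proof and
  for showing that every maximiser is an eigenvector (\<open>maximizer_is_eigenvector\<close>).

  Maximising repeatedly, each time orthogonally to the vectors found before, yields eigenvalues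
  \<open>lam 1 \<ge> \<dots> \<ge> lam k\<close>.  Ky Fan's inequality (\<open>Ky_Fan\<close>) bounds \<open>\<Sum>i. \<parallel>C (b i)\<parallel>\<^sup>2\<close> by \<open>\<Sum>i. lam i\<close> for every
  orthonormal system, which gives the minimal value of the prediction error.  Applied to a system of
  eigenvectors and one more vector it also shows that the successive maxima are the same numbers
  \<open>lam i\<close>, whatever maximisers were chosen before (\<open>eigensystem_bound\<close>,
  \<open>eigensystem_max_attained\<close>).  Finally, in an optimal pair the columns of \<open>A = CB\<close> are orthogonal
  with decreasing norms, so \<open>B\<close> diagonalises \<open>C'C\<close>; the Courant-Fischer bound
  \<open>\<parallel>C (b i)\<parallel>\<^sup>2 \<le> lam i\<close> (\<open>Courant_Fischer\<close>) together with equality of the sums forces equality for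
  each \<open>i\<close>, and \<open>B\<close> is recognised, one vector after the other, as a system of successive maximisers.
\<close>

section \<open>Underdetermined homogeneous systems\<close>

text \<open>
  Gaussian elimination: an equation with a nonzero coefficient is solved for one unknown, which is
  then removed from the other equations.  Arbitrary finite index sets make it possible to drop the
  pivot without renumbering the remaining unknowns.
\<close>

lemma underdetermined_homogeneous_system:
  fixes \<phi> :: "'l \<Rightarrow> 'j \<Rightarrow> real"
  assumes "finite L" "finite J" "card L < card J"
  shows "\<exists>c. (\<exists>j\<in>J. c j \<noteq> 0) \<and> (\<forall>l\<in>L. (\<Sum>j\<in>J. c j * \<phi> l j) = 0)"
  using assms
proof (induction L arbitrary: J \<phi> rule: finite_induct)
  case empty
  then have "J \<noteq> {}" by auto
  then show ?case by (intro exI[of _ "\<lambda>_. 1"]) auto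
next
  case (insert l L)
  show ?case
  proof (cases "\<forall>j\<in>J. \<phi> l j = 0")
    case True
    have "card L < card J" using insert by simp
    from insert.IH[OF insert.prems(1) this, of \<phi>] show ?thesis using True by auto
  next
    case False
    then obtain j0 where j0: "j0 \<in> J" "\<phi> l j0 \<noteq> 0" by auto
    define J' where "J' = J - {j0}"
    have "finite J'" "card L < card J'"
      using insert j0 by (auto simp: J'_def)
    from insert.IH[OF this, of "\<lambda>m j. \<phi> m j - \<phi> m j0 * \<phi> l j / \<phi> l j0"]
    obtain c where c: "\<exists>j\<in>J'. c j \<noteq> 0"
      "\<And>m. m \<in> L \<Longrightarrow> (\<Sum>j\<in>J'. c j * (\<phi> m j - \<phi> m j0 * \<phi> l j / \<phi> l j0)) = 0" by blast
    define s where "s = (\<Sum>j\<in>J'. c j * \<phi> l j)"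
    define d where "d = c(j0 := - s / \<phi> l j0)"
    have split: "(\<Sum>j\<in>J. d j * \<phi> m j) = - s / \<phi> l j0 * \<phi> m j0 + (\<Sum>j\<in>J'. c j * \<phi> m j)" for m
    proof -
      have "(\<Sum>j\<in>J. d j * \<phi> m j) = d j0 * \<phi> m j0 + (\<Sum>j\<in>J'. d j * \<phi> m j)"
        unfolding J'_def using insert.prems(1) j0(1) by (rule sum.remove)
      also have "(\<Sum>j\<in>J'. d j * \<phi> m j) = (\<Sum>j\<in>J'. c j * \<phi> m j)"
        by (rule sum.cong) (auto simp: d_def J'_def)
      finally show ?thesis by (simp add: d_def)
    qed
    have "(\<Sum>j\<in>J. d j * \<phi> m j) = 0" if "m \<in> L" for m
    proof -
      have "0 = (\<Sum>j\<in>J'. c j * \<phi> m j) - (\<Sum>j\<in>J'. \<phi> m j0 / \<phi> l j0 * (c j * \<phi> l j))"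
        unfolding sum_subtractf[symmetric] c(2)[OF that, symmetric]
        by (rule sum.cong) (auto simp: algebra_simps)
      also have "(\<Sum>j\<in>J'. \<phi> m j0 / \<phi> l j0 * (c j * \<phi> l j)) = \<phi> m j0 / \<phi> l j0 * s"
        by (simp add: s_def sum_distrib_left)
      finally show ?thesis by (simp add: split mult.commute)
    qed
    moreover have "(\<Sum>j\<in>J. d j * \<phi> l j) = 0"
      using j0 by (simp add: split s_def[symmetric])
    moreover have "\<exists>j\<in>J. d j \<noteq> 0"
      using c(1) by (auto simp: d_def J'_def)
    ultimately show ?thesis by (intro exI[of _ d]) auto
  qed
qed

section \<open>Pencils with a factorisation of the adjoint\<close>

text \<open>
  The properties of the covariance operators on which the eigenvalue theory rests.  The crucial one is
  that \<open>C'\<close> factors through \<open>Q\<close>: it turns \<open>C'C x\<close> into \<open>Q\<close> applied to the vector \<open>R (C x)\<close> of \<open>H\<close>, so that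
  equations modulo the kernel of \<open>Q\<close> can be lifted to equations between elements of \<open>H\<close>.  Compactness is
  stated for sequences and only for \<open>CR\<close>, the operator whose eigenvectors are the images under \<open>C\<close> of
  the eigenvectors of the pencil for nonzero eigenvalues.
\<close>

locale factored_pencil =
  fixes H :: "'a::real_inner set" and Q C C' R :: "'a \<Rightarrow> 'a"
  assumes subspace_H: "subspace H"
    and linear_Q: "linear Q" and Q_sym: "x \<bullet> Q y = y \<bullet> Q x" and Q_nonneg: "0 \<le> x \<bullet> Q x"
    and linear_C: "linear C" and C_adjoint: "C x \<bullet> y = x \<bullet> C' y"
    and C'_factors: "C' y = Q (R y)" and R_in_H: "R y \<in> H"
    and bounded_CR: "bounded_linear (\<lambda>x. C (R x))"
    and compact_CR: "bounded (range u) \<Longrightarrow> \<exists>l r. strict_mono (r :: nat \<Rightarrow> nat) \<and> (\<lambda>n. C (R (u (r n)))) \<longlonglongrightarrow> l"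
begin

text \<open>
  If \<open>Q\<close> is the covariance operator of \<open>X\<close>, this is the covariance of the random variables \<open>x'X\<close> and
  \<open>y'X\<close>.  It is only a semi-inner product, because \<open>Q\<close> may have a kernel.
\<close>

definition q :: "'a \<Rightarrow> 'a \<Rightarrow> real" where "q x y = x \<bullet> Q y"

lemma q_commute: "q x y = q y x"
  by (simp add: q_def Q_sym)

lemma q_nonneg: "0 \<le> q x x"
  by (simp add: q_def Q_nonneg)

lemma q_simps:
  "q (x + y) z = q x z + q y z" "q z (x + y) = q z x + q z y"
  "q (x - y) z = q x z - q y z" "q z (x - y) = q z x - q z y"
  "q (c *\<^sub>R x) z = c * q x z" "q z (c *\<^sub>R x) = c * q z x"
  "q 0 z = 0" "q z 0 = 0"
  by (simp_all add: q_def inner_simps linear_add[OF linear_Q] linear_diff[OF linear_Q]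
      linear_cmul[OF linear_Q] linear_0[OF linear_Q])

lemma q_sum: "q (\<Sum>i\<in>I. g i) z = (\<Sum>i\<in>I. q (g i) z)" "q z (\<Sum>i\<in>I. g i) = (\<Sum>i\<in>I. q z (g i))"
  by (simp_all add: q_def inner_sum_left inner_sum_right linear_sum[OF linear_Q])

lemma q_Cauchy_Schwarz: "(q x y)\<^sup>2 \<le> q x x * q y y"
proof (cases "q y y = 0")
  case False
  have "0 \<le> q (x - (q x y / q y y) *\<^sub>R y) (x - (q x y / q y y) *\<^sub>R y)" by (rule q_nonneg)
  also have "\<dots> = q x x - (q x y)\<^sup>2 / q y y"
    using False by (simp add: q_simps q_commute[of y x] power2_eq_square field_simps)
  finally show ?thesis using False q_nonneg[of y] by (simp add: field_simps)
next
  case True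
  have "q x y = 0"
  proof (rule ccontr)
    assume "q x y \<noteq> 0"
    (* for y of norm 0, q (x - c y) (x - c y) is affine in c, and -1 for this choice of c *)
    define c where "c = (q x x + 1) / (2 * q x y)"
    have "0 \<le> q (x - c *\<^sub>R y) (x - c *\<^sub>R y)" by (rule q_nonneg)
    also have "\<dots> = q x x - 2 * c * q x y"
      by (simp add: q_simps q_commute[of y x] True algebra_simps)
    finally show False using \<open>q x y \<noteq> 0\<close> by (simp add: c_def field_simps)
  qed
  then show ?thesis using True by simp
qed

lemma Q_eq_0_iff: "Q x = 0 \<longleftrightarrow> q x x = 0"
proof
  assume "q x x = 0"
  then have "(q (Q x) x)\<^sup>2 \<le> 0" using q_Cauchy_Schwarz[of "Q x" x] by simp
  then show "Q x = 0" by (simp add: q_def)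
qed (simp add: q_def)

lemma inner_C: "C x \<bullet> C y = q x (R (C y))"
  by (simp add: q_def C_adjoint C'_factors)

lemma inner_C_eq: "C x \<bullet> C y = x \<bullet> C' (C y)"
  by (simp add: C_adjoint)

text \<open>
  The operator \<open>C\<close> is bounded for the seminorm of \<open>q\<close>.  Indeed \<open>\<parallel>C x\<parallel>\<^sup>2 = q x w\<close> for \<open>w = R (C x)\<close>, and
  \<open>q w w = C w \<bullet> C x\<close> is at most the norm of \<open>CR\<close> times \<open>\<parallel>C x\<parallel>\<^sup>2\<close>; the claim follows by the
  Cauchy-Schwarz inequality.
\<close>

lemma norm_C_bound: "\<exists>K\<ge>0. \<forall>x. (norm (C x))\<^sup>2 \<le> K * q x x"
proof -
  obtain K where K: "\<And>x. norm (C (R x)) \<le> norm x * K" and K0: "K \<ge> 0"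
    using bounded_linear.nonneg_bounded[OF bounded_CR] by auto
  have "(norm (C x))\<^sup>2 \<le> K * q x x" for x
  proof (cases "C x = 0")
    case False
    let ?w = "R (C x)"
    have "q ?w ?w = C ?w \<bullet> C x"
      by (simp add: inner_C)
    also have "\<dots> \<le> norm (C ?w) * norm (C x)" by (rule norm_cauchy_schwarz)
    also have "\<dots> \<le> K * (norm (C x))\<^sup>2"
      using mult_right_mono[OF K[of "C x"], of "norm (C x)"] by (simp add: power2_eq_square ac_simps)
    finally have w: "q ?w ?w \<le> K * (norm (C x))\<^sup>2" .
    have "((norm (C x))\<^sup>2)\<^sup>2 = (q x ?w)\<^sup>2" by (simp add: power2_norm_eq_inner inner_C)
    also have "\<dots> \<le> q x x * q ?w ?w" by (rule q_Cauchy_Schwarz)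
    also have "\<dots> \<le> q x x * (K * (norm (C x))\<^sup>2)" using w by (rule mult_left_mono) (rule q_nonneg)
    finally have "(norm (C x))\<^sup>2 * (norm (C x))\<^sup>2 \<le> (K * q x x) * (norm (C x))\<^sup>2"
      by (simp add: power2_eq_square ac_simps)
    then show ?thesis by (rule mult_right_le_imp_le) (use False in simp)
  qed (use K0 q_nonneg in simp)
  then show ?thesis using K0 by blast
qed

text \<open>
  If \<open>w = R (C x)\<close>, then \<open>Q (w - s x) = C'C x - s Q x\<close> is the residual of \<open>x\<close> as an eigenvector for \<open>s\<close>.
  Since \<open>q x w = \<parallel>C x\<parallel>\<^sup>2\<close> and \<open>q w w \<le> s \<parallel>C x\<parallel>\<^sup>2\<close>, its size is controlled by how far \<open>\<parallel>C x\<parallel>\<^sup>2\<close> is below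
  \<open>s\<close>.  Thus exact maximisers are eigenvectors and approximate maximisers are approximate
  eigenvectors.
\<close>

lemma residual_bound:
  assumes s: "(norm (C (R (C x))))\<^sup>2 \<le> s * q (R (C x)) (R (C x))" "0 \<le> s" and x: "q x x = 1"
  shows "q (R (C x) - s *\<^sub>R x) (R (C x) - s *\<^sub>R x) \<le> s * (s - (norm (C x))\<^sup>2)"
proof -
  let ?w = "R (C x)"
  have xw: "q x ?w = (norm (C x))\<^sup>2" by (simp add: power2_norm_eq_inner inner_C)
  have ww: "q ?w ?w = C ?w \<bullet> C x" by (simp add: inner_C)
  have "(q ?w ?w)\<^sup>2 \<le> (norm (C ?w))\<^sup>2 * (norm (C x))\<^sup>2"
    unfolding ww using Cauchy_Schwarz_ineq[of "C ?w" "C x"] by (simp add: power2_norm_eq_inner)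
  also have "\<dots> \<le> s * q ?w ?w * (norm (C x))\<^sup>2" using s(1) by (rule mult_right_mono) simp
  finally have "q ?w ?w * q ?w ?w \<le> (s * (norm (C x))\<^sup>2) * q ?w ?w"
    by (simp add: power2_eq_square ac_simps)
  then have "q ?w ?w \<le> s * (norm (C x))\<^sup>2"
    using q_nonneg[of ?w] s(2) by (cases "q ?w ?w = 0") (auto simp: mult_le_cancel_right)
  then show ?thesis
    by (simp add: q_simps q_commute[of ?w x] xw x power2_eq_square algebra_simps)
qed

definition eigensystem :: "nat \<Rightarrow> (nat \<Rightarrow> real) \<Rightarrow> (nat \<Rightarrow> 'a) \<Rightarrow> bool" where
  "eigensystem n lam b \<longleftrightarrow>
     (\<forall>i\<in>{1..n}. pencil_eigenvector H (C' \<circ> C) Q (lam i) (b i)) \<and> orthonormal_wrt Q n b"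

lemma orthonormal_wrt_q: "orthonormal_wrt Q n b \<longleftrightarrow> (\<forall>i\<in>{1..n}. \<forall>j\<in>{1..n}. q (b i) (b j) = (if i = j then 1 else 0))"
  by (simp add: orthonormal_wrt_def q_def)

lemma eigensystem_iff:
  "eigensystem n lam b \<longleftrightarrow> (\<forall>i\<in>{1..n}. b i \<in> H \<and> C' (C (b i)) = lam i *\<^sub>R Q (b i)) \<and> orthonormal_wrt Q n b"
proof -
  have "b i \<noteq> 0" if "orthonormal_wrt Q n b" "i \<in> {1..n}" for i
  proof -
    have "b i \<bullet> Q (b i) = 1" using that by (simp add: orthonormal_wrt_def)
    then show ?thesis by auto
  qed
  then show ?thesis by (auto simp: eigensystem_def pencil_eigenvector_def)
qed

lemma eigensystem_C:
  assumes "eigensystem n lam b" "i \<in> {1..n}"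
  shows "C x \<bullet> C (b i) = lam i * q x (b i)" "C (b i) \<bullet> C x = lam i * q x (b i)"
proof -
  show "C x \<bullet> C (b i) = lam i * q x (b i)"
    using assms by (simp add: eigensystem_iff inner_C_eq q_def)
  then show "C (b i) \<bullet> C x = lam i * q x (b i)" by (simp add: inner_commute)
qed

text \<open>
  The constraints of the maximisation are invariant under \<open>RC\<close>, so the bound by the supremum applies
  to the vector \<open>w\<close> of \<open>residual_bound\<close>.
\<close>

lemma R_C_orthogonal:
  assumes "eigensystem n lam b" "\<forall>j\<in>{1..n}. q x (b j) = 0" "j \<in> {1..n}"
  shows "q (R (C x)) (b j) = 0"
proof -
  have "q (R (C x)) (b j) = C (b j) \<bullet> C x" by (simp add: q_commute[of _ "b j"] inner_C)
  also have "\<dots> = lam j * q x (b j)" by (rule eigensystem_C(2)[OF assms(1,3)])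
  finally show ?thesis using assms(2,3) by simp
qed

text \<open>
  Vectors of seminorm 0 cannot be normalised; they satisfy the bound because \<open>C\<close> annihilates them, by
  \<open>norm_C_bound\<close>.
\<close>

lemma scaled_bound:
  assumes B: "\<And>y. y \<in> H \<Longrightarrow> \<forall>j\<in>J. q y (b j) = 0 \<Longrightarrow> q y y = 1 \<Longrightarrow> (norm (C y))\<^sup>2 \<le> s"
    and y: "y \<in> H" "\<forall>j\<in>J. q y (b j) = 0"
  shows "(norm (C y))\<^sup>2 \<le> s * q y y"
proof (cases "q y y = 0")
  case True
  then show ?thesis using norm_C_bound by (metis mult_zero_right)
next
  case False
  then have pos: "0 < q y y" using q_nonneg[of y] by simp
  define z where "z = (1 / sqrt (q y y)) *\<^sub>R y"
  have "(norm (C z))\<^sup>2 \<le> s"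
    by (rule B) (use y pos in \<open>auto simp: z_def q_simps subspace_scale[OF subspace_H]\<close>)
  moreover have "(norm (C z))\<^sup>2 = (norm (C y))\<^sup>2 / q y y"
    using pos by (simp add: z_def linear_cmul[OF linear_C] power_divide)
  ultimately show ?thesis using pos by (simp add: field_simps)
qed

lemma maximizer_is_eigenvector:
  assumes b: "eigensystem n lam b" and x: "x \<in> H" "\<forall>j\<in>{1..n}. q x (b j) = 0" "q x x = 1"
    and max: "\<And>y. y \<in> H \<Longrightarrow> \<forall>j\<in>{1..n}. q y (b j) = 0 \<Longrightarrow> q y y = 1 \<Longrightarrow> (norm (C y))\<^sup>2 \<le> (norm (C x))\<^sup>2"
  shows "C' (C x) = (norm (C x))\<^sup>2 *\<^sub>R Q x"
proof -
  let ?s = "(norm (C x))\<^sup>2" and ?w = "R (C x)"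
  have "(norm (C ?w))\<^sup>2 \<le> ?s * q ?w ?w"
    using max R_in_H R_C_orthogonal[OF b x(2)] by (intro scaled_bound[of "{1..n}" b]) auto
  from residual_bound[OF this _ x(3)] have "q (?w - ?s *\<^sub>R x) (?w - ?s *\<^sub>R x) \<le> 0" by simp
  then have "Q (?w - ?s *\<^sub>R x) = 0" using q_nonneg[of "?w - ?s *\<^sub>R x"] by (simp add: Q_eq_0_iff)
  then show ?thesis by (simp add: C'_factors linear_diff[OF linear_Q] linear_cmul[OF linear_Q])
qed

text \<open>
  Let \<open>x m\<close> be a maximising sequence with supremum \<open>s > 0\<close>.  By \<open>residual_bound\<close> the vectors \<open>C (x m)\<close> are
  approximate eigenvectors of the compact operator \<open>CR\<close> for \<open>s\<close>, so a subsequence converges to an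
  eigenvector \<open>u\<close>, and \<open>R u\<close> divided by \<open>s\<close> is an admissible vector with image \<open>u\<close>.  The sequence \<open>x m\<close>
  itself need not converge.  If \<open>s = 0\<close>, every admissible vector is a maximiser.
\<close>

lemma maximizer_exists:
  assumes b: "eigensystem n lam b" and feas: "\<exists>x\<in>H. (\<forall>j\<in>{1..n}. q x (b j) = 0) \<and> q x x = 1"
  shows "\<exists>x\<in>H. (\<forall>j\<in>{1..n}. q x (b j) = 0) \<and> q x x = 1 \<and>
    (\<forall>y\<in>H. (\<forall>j\<in>{1..n}. q y (b j) = 0) \<longrightarrow> (norm (C y))\<^sup>2 \<le> (norm (C x))\<^sup>2 * q y y)"
proof -
  define F where "F = {x\<in>H. (\<forall>j\<in>{1..n}. q x (b j) = 0) \<and> q x x = 1}"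
  define s where "s = (SUP x\<in>F. (norm (C x))\<^sup>2)"
  obtain K where K: "0 \<le> K" "\<And>x. (norm (C x))\<^sup>2 \<le> K * q x x" using norm_C_bound by auto
  have F: "F \<noteq> {}" using feas by (auto simp: F_def)
  have bdd: "bdd_above ((\<lambda>x. (norm (C x))\<^sup>2) ` F)"
  proof (rule bdd_aboveI2)
    fix x assume "x \<in> F" then show "(norm (C x))\<^sup>2 \<le> K" using K(2)[of x] by (simp add: F_def)
  qed
  have s_ub: "(norm (C y))\<^sup>2 \<le> s" if "y \<in> F" for y
    unfolding s_def using bdd that by (rule cSUP_upper2) simp
  have s_bound: "(norm (C y))\<^sup>2 \<le> s * q y y" if "y \<in> H" "\<forall>j\<in>{1..n}. q y (b j) = 0" for y
    using s_ub that by (intro scaled_bound[of "{1..n}" b]) (auto simp: F_def)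
  have s0: "0 \<le> s" using F s_ub by (meson ex_in_conv order_trans zero_le_power2)
  have "\<exists>x\<in>F. (norm (C x))\<^sup>2 = s"
  proof (cases "s = 0")
    case True
    then show ?thesis using F s_ub by (metis ex_in_conv antisym zero_le_power2)
  next
    case False
    then have pos: "0 < s" using s0 by simp
    have "\<exists>x\<in>F. s - 1 / real (Suc m) < (norm (C x))\<^sup>2" for m
      using less_cSUP_iff[OF F bdd, of "s - 1 / real (Suc m)"] unfolding s_def by simp
    then obtain x where x: "\<And>m. x m \<in> F" "\<And>m. s - 1 / real (Suc m) < (norm (C (x m)))\<^sup>2" by metis
    have lim_s: "(\<lambda>m. (norm (C (x m)))\<^sup>2) \<longlonglongrightarrow> s"
    proof (rule tendsto_sandwich[OF _ _ _ tendsto_const])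
      show "\<forall>\<^sub>F m in sequentially. s - 1 / real (Suc m) \<le> (norm (C (x m)))\<^sup>2"
        using x(2) by (simp add: less_imp_le)
      show "\<forall>\<^sub>F m in sequentially. (norm (C (x m)))\<^sup>2 \<le> s" using s_ub x(1) by simp
      show "(\<lambda>m. s - 1 / real (Suc m)) \<longlonglongrightarrow> s"
        using tendsto_diff[OF tendsto_const[of s] LIMSEQ_inverse_real_of_nat]
        by (simp add: inverse_eq_divide)
    qed
    (* the residuals, which tend to 0 in the seminorm of q and therefore under C *)
    define v where "v m = R (C (x m)) - s *\<^sub>R x m" for m
    have Cv: "(norm (C (v m)))\<^sup>2 \<le> K * (s * (s - (norm (C (x m)))\<^sup>2))" for m
    proof -
      have xm: "q (x m) (x m) = 1" "\<forall>j\<in>{1..n}. q (x m) (b j) = 0" using x(1)[of m] by (auto simp: F_def)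
      have "q (v m) (v m) \<le> s * (s - (norm (C (x m)))\<^sup>2)"
        unfolding v_def using s_bound R_in_H R_C_orthogonal[OF b xm(2)] s0 xm(1)
        by (intro residual_bound) auto
      then show ?thesis using K(2)[of "v m"] mult_left_mono[OF _ K(1)] by (meson order_trans)
    qed
    have "(\<lambda>m. (norm (C (v m)))\<^sup>2) \<longlonglongrightarrow> 0"
    proof (rule tendsto_sandwich[OF _ _ tendsto_const])
      show "\<forall>\<^sub>F m in sequentially. (norm (C (v m)))\<^sup>2 \<le> K * (s * (s - (norm (C (x m)))\<^sup>2))"
        using Cv by simp
      show "(\<lambda>m. K * (s * (s - (norm (C (x m)))\<^sup>2))) \<longlonglongrightarrow> 0"
        by (rule tendsto_eq_intros lim_s refl | simp)+
    qed simp
    then have "(\<lambda>m. norm (C (v m))) \<longlonglongrightarrow> 0"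
      using tendsto_real_sqrt[of "\<lambda>m. (norm (C (v m)))\<^sup>2" 0] by simp
    then have res: "(\<lambda>m. C (R (C (x m))) - s *\<^sub>R C (x m)) \<longlonglongrightarrow> 0"
      by (simp add: tendsto_norm_zero_iff v_def linear_diff[OF linear_C] linear_cmul[OF linear_C])
    have "norm (C (x m)) \<le> sqrt s" for m
      using s_ub[OF x(1)[of m]] by (simp add: real_le_rsqrt)
    then have "bounded (range (\<lambda>m. C (x m)))" by (auto simp: bounded_iff)
    from compact_CR[OF this] obtain l and r :: "nat \<Rightarrow> nat" where
      r: "strict_mono r" and l: "(\<lambda>m. C (R (C (x (r m))))) \<longlonglongrightarrow> l" by blast
    have sub: "(\<lambda>m. g (r m)) \<longlonglongrightarrow> c" if "g \<longlonglongrightarrow> c" for g :: "nat \<Rightarrow> 'b::topological_space" and c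
      using LIMSEQ_subseq_LIMSEQ[OF that r] by (simp add: o_def)
    (* C (R (C (x m))) and s C (x m) have the same limit along r, hence C (x m) converges *)
    define u where "u = (1 / s) *\<^sub>R l"
    have "(\<lambda>m. (1 / s) *\<^sub>R (C (R (C (x (r m)))) - (C (R (C (x (r m)))) - s *\<^sub>R C (x (r m))))) \<longlonglongrightarrow> (1 / s) *\<^sub>R (l - 0)"
      by (intro tendsto_intros l sub[OF res])
    then have u: "(\<lambda>m. C (x (r m))) \<longlonglongrightarrow> u" using pos by (simp add: u_def)
    have "(\<lambda>m. (norm (C (x (r m))))\<^sup>2) \<longlonglongrightarrow> (norm u)\<^sup>2" by (intro tendsto_intros u)
    then have norm_u: "(norm u)\<^sup>2 = s" using sub[OF lim_s] LIMSEQ_unique by blast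
    have "(\<lambda>m. C (R (C (x (r m))))) \<longlonglongrightarrow> C (R u)"
      using bounded_linear.tendsto[OF bounded_CR u] .
    then have "C (R u) = l" using l LIMSEQ_unique by blast
    then have Gu: "C (R u) = s *\<^sub>R u" using pos by (simp add: u_def)
    define z where "z = (1 / s) *\<^sub>R R u"
    have Cz: "C z = u" using pos by (simp add: z_def linear_cmul[OF linear_C] Gu)
    have qz: "q y z = (1 / s) * (C y \<bullet> u)" for y
      by (simp add: z_def q_def linear_cmul[OF linear_Q] C_adjoint C'_factors)
    have "q z z = 1" using pos norm_u by (simp add: qz Cz power2_norm_eq_inner)
    moreover have "q z (b j) = 0" if j: "j \<in> {1..n}" for j
    proof -
      have "(\<lambda>m. C (b j) \<bullet> C (x (r m))) \<longlonglongrightarrow> C (b j) \<bullet> u" by (intro tendsto_intros u)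
      moreover have "C (b j) \<bullet> C (x (r m)) = 0" for m
        using x(1)[of "r m"] j by (simp add: eigensystem_C(2)[OF b j] F_def)
      ultimately have "C (b j) \<bullet> u = 0" by (simp add: LIMSEQ_const_iff)
      then show ?thesis by (simp add: q_commute[of z] qz)
    qed
    moreover have "z \<in> H" by (simp add: z_def subspace_scale[OF subspace_H] R_in_H)
    ultimately have "z \<in> F" by (simp add: F_def)
    then show ?thesis using Cz norm_u by auto
  qed
  then obtain x where "x \<in> F" "(norm (C x))\<^sup>2 = s" by blast
  with s_bound show ?thesis by (intro bexI[of _ x]) (auto simp: F_def)
qed

lemma Bessel_q:
  assumes "orthonormal_wrt Q n b"
  shows "(\<Sum>i=1..n. (q x (b i))\<^sup>2) \<le> q x x"
    and "\<forall>j\<in>{1..n}. q (x - (\<Sum>i=1..n. q x (b i) *\<^sub>R b i)) (b j) = 0"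
    and "q (x - (\<Sum>i=1..n. q x (b i) *\<^sub>R b i)) (x - (\<Sum>i=1..n. q x (b i) *\<^sub>R b i)) = q x x - (\<Sum>i=1..n. (q x (b i))\<^sup>2)"
proof -
  define r where "r = x - (\<Sum>i=1..n. q x (b i) *\<^sub>R b i)"
  have bb: "q (b i) (b j) = (if i = j then 1 else 0)" if "i \<in> {1..n}" "j \<in> {1..n}" for i j
    using assms that by (auto simp: orthonormal_wrt_q)
  have rb: "q r (b j) = 0" if "j \<in> {1..n}" for j
  proof -
    have "(\<Sum>i=1..n. q x (b i) * q (b i) (b j)) = (\<Sum>i=1..n. if i = j then q x (b i) else 0)"
      by (rule sum.cong) (use that bb in auto)
    then show ?thesis using that by (simp add: r_def q_simps q_sum)
  qed
  then show "\<forall>j\<in>{1..n}. q (x - (\<Sum>i=1..n. q x (b i) *\<^sub>R b i)) (b j) = 0" by (simp add: r_def)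
  have "q r r = q r x - (\<Sum>i=1..n. q x (b i) * q r (b i))"
    by (subst (2) r_def) (simp add: q_simps q_sum)
  also have "\<dots> = q r x" using rb by simp
  also have "\<dots> = q x x - (\<Sum>i=1..n. (q x (b i))\<^sup>2)"
    by (simp add: r_def q_simps q_sum q_commute[of "b _" x] power2_eq_square)
  finally have rr: "q r r = q x x - (\<Sum>i=1..n. (q x (b i))\<^sup>2)" .
  then show "q (x - (\<Sum>i=1..n. q x (b i) *\<^sub>R b i)) (x - (\<Sum>i=1..n. q x (b i) *\<^sub>R b i)) = q x x - (\<Sum>i=1..n. (q x (b i))\<^sup>2)"
    by (simp add: r_def)
  show "(\<Sum>i=1..n. (q x (b i))\<^sup>2) \<le> q x x" using rr q_nonneg[of r] by simp
qed

section \<open>Leading eigenvalues and variational principles\<close>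

text \<open>
  Each \<open>e i\<close> maximises \<open>\<parallel>C x\<parallel>\<^sup>2\<close> among the normalised vectors orthogonal to its predecessors.  The bound
  is stated homogeneously so that it covers vectors of seminorm 0.
\<close>

definition leading_eigensystem :: "nat \<Rightarrow> (nat \<Rightarrow> real) \<Rightarrow> (nat \<Rightarrow> 'a) \<Rightarrow> bool" where
  "leading_eigensystem n lam e \<longleftrightarrow> eigensystem n lam e \<and>
     (\<forall>i\<in>{1..n}. \<forall>x\<in>H. (\<forall>j\<in>{1..<i}. q x (e j) = 0) \<longrightarrow> (norm (C x))\<^sup>2 \<le> lam i * q x x)"

lemma eigensystem_mono: "eigensystem n lam e \<Longrightarrow> m \<le> n \<Longrightarrow> eigensystem m lam e"
  by (auto simp: eigensystem_iff orthonormal_wrt_def)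

lemma leading_mono: "leading_eigensystem n lam e \<Longrightarrow> m \<le> n \<Longrightarrow> leading_eigensystem m lam e"
  using eigensystem_mono[of n lam e m] unfolding leading_eigensystem_def by auto

lemma eigensystem_norm_C: "eigensystem n lam e \<Longrightarrow> i \<in> {1..n} \<Longrightarrow> (norm (C (e i)))\<^sup>2 = lam i"
  using eigensystem_C[of n lam e i "e i"] by (simp add: power2_norm_eq_inner eigensystem_iff orthonormal_wrt_q)

lemma leading_antimono: "leading_eigensystem n lam e \<Longrightarrow> antimono_on {1..n} lam"
proof (rule monotone_onI)
  fix i j assume e: "leading_eigensystem n lam e" and ij: "i \<in> {1..n}" "j \<in> {1..n}" "i \<le> j"
  have es: "eigensystem n lam e" using e by (simp add: leading_eigensystem_def)
  have "e j \<in> H" "\<forall>l\<in>{1..<i}. q (e j) (e l) = 0"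
    using es ij by (auto simp: eigensystem_iff orthonormal_wrt_q)
  then have "(norm (C (e j)))\<^sup>2 \<le> lam i * q (e j) (e j)"
    using e ij unfolding leading_eigensystem_def by blast
  then show "lam j \<le> lam i"
    using ij eigensystem_norm_C[OF es, of j] es by (simp add: eigensystem_iff orthonormal_wrt_q)
qed

text \<open>
  Expand \<open>b i\<close> in the vectors \<open>e j\<close> with a remainder orthogonal to all of them.  The remainder
  contributes at most \<open>lam n\<close> times its squared seminorm, so \<open>\<parallel>C (b i)\<parallel>\<^sup>2\<close> exceeds \<open>lam n\<close> by at most the
  weights \<open>q (b i) (e j)\<^sup>2\<close> times \<open>lam j - lam n\<close>.  By Bessel's inequality, now for the expansion of \<open>e j\<close> in
  the vectors \<open>b i\<close>, these weights sum to at most 1 for each \<open>j\<close>.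
\<close>

lemma Ky_Fan:
  assumes e: "leading_eigensystem n lam e" and b: "orthonormal_wrt Q n b" and bH: "\<And>i. i \<in> {1..n} \<Longrightarrow> b i \<in> H"
  shows "(\<Sum>i=1..n. (norm (C (b i)))\<^sup>2) \<le> (\<Sum>i=1..n. lam i)"
proof (cases "n = 0")
  case False
  have es: "eigensystem n lam e" and eH: "\<And>i. i \<in> {1..n} \<Longrightarrow> e i \<in> H"
    and eo: "orthonormal_wrt Q n e" using e by (auto simp: leading_eigensystem_def eigensystem_iff)
  have n: "n \<in> {1..n}" using False by simp
  define c where "c i j = (q (b i) (e j))\<^sup>2" for i j
  have one: "(norm (C (b i)))\<^sup>2 \<le> lam n + (\<Sum>j=1..n. c i j * (lam j - lam n))" if i: "i \<in> {1..n}" for i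
  proof -
    define p where "p = (\<Sum>j=1..n. q (b i) (e j) *\<^sub>R e j)"
    define r where "r = b i - p"
    have rH: "r \<in> H" unfolding r_def p_def
      by (intro subspace_diff[OF subspace_H] subspace_sum[OF subspace_H] subspace_scale[OF subspace_H] bH i eH) simp
    have re: "\<forall>j\<in>{1..n}. q r (e j) = 0" unfolding r_def p_def by (rule Bessel_q(2)[OF eo])
    have rr: "q r r = 1 - (\<Sum>j=1..n. c i j)"
      using Bessel_q(3)[OF eo, of "b i"] b i by (simp add: r_def p_def c_def orthonormal_wrt_q)
    have Cp: "C y \<bullet> C p = (\<Sum>j=1..n. lam j * (q (b i) (e j) * q y (e j)))" for y
      by (simp add: p_def linear_sum[OF linear_C] linear_cmul[OF linear_C] inner_sum_right
          eigensystem_C[OF es] ac_simps)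
    have "(norm (C (b i)))\<^sup>2 = C r \<bullet> C r + C r \<bullet> C p + C (b i) \<bullet> C p"
      by (simp add: r_def power2_norm_eq_inner linear_diff[OF linear_C] inner_simps inner_commute)
    also have "C r \<bullet> C p = 0" using re by (simp add: Cp)
    also have "C (b i) \<bullet> C p = (\<Sum>j=1..n. c i j * lam j)"
      by (simp add: Cp c_def power2_eq_square ac_simps)
    also have "C r \<bullet> C r \<le> lam n * q r r"
      using e n rH re unfolding leading_eigensystem_def power2_norm_eq_inner[symmetric] by auto
    finally show ?thesis by (simp add: rr right_diff_distrib sum_subtractf sum_distrib_left mult.commute)
  qed
  have "(\<Sum>i=1..n. (norm (C (b i)))\<^sup>2) \<le> (\<Sum>i=1..n. lam n + (\<Sum>j=1..n. c i j * (lam j - lam n)))"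
    by (rule sum_mono) (use one in auto)
  also have "\<dots> = n * lam n + (\<Sum>j=1..n. (\<Sum>i=1..n. c i j) * (lam j - lam n))"
    by (simp add: sum.distrib sum_distrib_right) (rule sum.swap)
  also have "\<dots> \<le> n * lam n + (\<Sum>j=1..n. 1 * (lam j - lam n))"
  proof (intro add_left_mono sum_mono mult_right_mono)
    fix j assume j: "j \<in> {1..n}"
    have "(\<Sum>i=1..n. (q (e j) (b i))\<^sup>2) \<le> 1"
      using Bessel_q(1)[OF b, of "e j"] eo j by (simp add: orthonormal_wrt_q)
    then show "(\<Sum>i=1..n. c i j) \<le> 1" by (simp add: c_def q_commute)
    show "0 \<le> lam j - lam n" using leading_antimono[OF e] j n by (auto simp: monotone_on_def)
  qed
  also have "\<dots> = (\<Sum>i=1..n. lam i)" by (simp add: sum_subtractf)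
  finally show ?thesis .
qed simp

text \<open>
  Orthogonality to \<open>m\<close> vectors imposes \<open>m\<close> homogeneous linear equations on the \<open>n\<close> coefficients.
\<close>

lemma orthogonal_combination:
  assumes b: "orthonormal_wrt Q n b" and bH: "\<And>i. i \<in> {1..n} \<Longrightarrow> b i \<in> H" and m: "m < n"
  shows "\<exists>c. (\<Sum>i=1..n. (c i)\<^sup>2) = 1 \<and> (\<forall>j\<in>{1..m}. q (\<Sum>i=1..n. c i *\<^sub>R b i) (g j) = 0) \<and>
    (\<Sum>i=1..n. c i *\<^sub>R b i) \<in> H \<and> q (\<Sum>i=1..n. c i *\<^sub>R b i) (\<Sum>i=1..n. c i *\<^sub>R b i) = 1"
proof -
  have "card {1..m} < card {1..n}" using m by simp
  from underdetermined_homogeneous_system[OF _ _ this, of "\<lambda>j i. q (b i) (g j)"]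
  obtain d where d: "\<exists>i\<in>{1..n}. d i \<noteq> 0" "\<And>j. j \<in> {1..m} \<Longrightarrow> (\<Sum>i=1..n. d i * q (b i) (g j)) = 0"
    by blast
  define s where "s = (\<Sum>i=1..n. (d i)\<^sup>2)"
  obtain i where i: "i \<in> {1..n}" "d i \<noteq> 0" using d(1) by blast
  then have s: "0 < s" unfolding s_def by (intro sum_pos2[of _ i]) auto
  define c where "c i = d i / sqrt s" for i
  have c1: "(\<Sum>i=1..n. (c i)\<^sup>2) = 1"
  proof -
    have "(\<Sum>i=1..n. (c i)\<^sup>2) = (\<Sum>i=1..n. (d i)\<^sup>2) / s"
      using s by (simp add: c_def power_divide sum_divide_distrib)
    then show ?thesis using s by (simp add: s_def)
  qed
  have qc: "q (\<Sum>i=1..n. c i *\<^sub>R b i) y = (\<Sum>i=1..n. c i * q (b i) y)" for y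
    by (simp add: q_sum q_simps)
  have "q (\<Sum>i=1..n. c i *\<^sub>R b i) (g j) = 0" if "j \<in> {1..m}" for j
  proof -
    have "q (\<Sum>i=1..n. c i *\<^sub>R b i) (g j) = (\<Sum>i=1..n. d i * q (b i) (g j)) / sqrt s"
      unfolding qc by (simp add: c_def sum_divide_distrib)
    then show ?thesis using d(2)[OF that] by simp
  qed
  moreover have "(\<Sum>i=1..n. c i *\<^sub>R b i) \<in> H"
    by (intro subspace_sum[OF subspace_H] subspace_scale[OF subspace_H] bH)
  moreover have "q (\<Sum>i=1..n. c i *\<^sub>R b i) (\<Sum>i=1..n. c i *\<^sub>R b i) = (\<Sum>i=1..n. (c i)\<^sup>2)"
  proof -
    have "q (b i) (\<Sum>j=1..n. c j *\<^sub>R b j) = c i" if "i \<in> {1..n}" for i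
    proof -
      have "(\<Sum>j=1..n. c j * q (b i) (b j)) = (\<Sum>j=1..n. if j = i then c j else 0)"
        by (rule sum.cong) (use b that in \<open>auto simp: orthonormal_wrt_q\<close>)
      then show ?thesis using that by (simp add: q_sum q_simps)
    qed
    then show ?thesis unfolding qc power2_eq_square by (intro sum.cong) auto
  qed
  ultimately show ?thesis using c1 by (intro exI[of _ c]) auto
qed

text \<open>
  The span of \<open>b 1, \<dots>, b i\<close> contains a normalised vector \<open>v\<close> orthogonal to \<open>e 1, \<dots>, e (i - 1)\<close>.  Then
  \<open>\<parallel>C v\<parallel>\<^sup>2 \<le> lam i\<close>, whereas \<open>\<parallel>C v\<parallel>\<^sup>2\<close> is a weighted mean of the numbers \<open>\<parallel>C (b l)\<parallel>\<^sup>2\<close> for \<open>l \<le> i\<close>, all of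
  which are at least \<open>\<parallel>C (b i)\<parallel>\<^sup>2\<close>.
\<close>

lemma Courant_Fischer:
  assumes e: "leading_eigensystem n lam e" and b: "orthonormal_wrt Q n b" and bH: "\<And>i. i \<in> {1..n} \<Longrightarrow> b i \<in> H"
    and diag: "\<And>i j. i \<in> {1..n} \<Longrightarrow> j \<in> {1..n} \<Longrightarrow> i \<noteq> j \<Longrightarrow> C (b i) \<bullet> C (b j) = 0"
    and anti: "antimono_on {1..n} (\<lambda>i. (norm (C (b i)))\<^sup>2)" and i: "i \<in> {1..n}"
  shows "(norm (C (b i)))\<^sup>2 \<le> lam i"
proof -
  have "orthonormal_wrt Q i b" using b i by (auto simp: orthonormal_wrt_def)
  from orthogonal_combination[OF this, of "i - 1" e] obtain c where c: "(\<Sum>l=1..i. (c l)\<^sup>2) = 1"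
    "\<forall>j\<in>{1..i-1}. q (\<Sum>l=1..i. c l *\<^sub>R b l) (e j) = 0" "(\<Sum>l=1..i. c l *\<^sub>R b l) \<in> H"
    "q (\<Sum>l=1..i. c l *\<^sub>R b l) (\<Sum>l=1..i. c l *\<^sub>R b l) = 1"
    using i bH by auto
  define v where "v = (\<Sum>l=1..i. c l *\<^sub>R b l)"
  have "\<forall>j\<in>{1..<i}. q v (e j) = 0" using c(2) by (auto simp: v_def)
  then have "(norm (C v))\<^sup>2 \<le> lam i * q v v"
    using e i c(3) unfolding leading_eigensystem_def v_def by auto
  then have v1: "(norm (C v))\<^sup>2 \<le> lam i" using c(4) by (simp add: v_def)
  have Cb: "C (b l) \<bullet> C v = c l * (norm (C (b l)))\<^sup>2" if l: "l \<in> {1..i}" for l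
  proof -
    have "C (b l) \<bullet> C v = (\<Sum>j=1..i. c j * (C (b l) \<bullet> C (b j)))"
      by (simp add: v_def linear_sum[OF linear_C] linear_cmul[OF linear_C] inner_sum_right)
    also have "\<dots> = (\<Sum>j=1..i. if j = l then c l * (norm (C (b l)))\<^sup>2 else 0)"
      by (rule sum.cong) (use l i diag in \<open>auto simp: power2_norm_eq_inner\<close>)
    finally show ?thesis using l by simp
  qed
  have "(norm (C (b i)))\<^sup>2 = (\<Sum>l=1..i. (c l)\<^sup>2 * (norm (C (b i)))\<^sup>2)"
    using c(1) by (simp add: sum_distrib_right[symmetric])
  also have "\<dots> \<le> (\<Sum>l=1..i. (c l)\<^sup>2 * (norm (C (b l)))\<^sup>2)"
    using anti i by (intro sum_mono mult_left_mono) (auto simp: monotone_on_def)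
  also have "\<dots> = (\<Sum>l=1..i. c l * (C (b l) \<bullet> C v))"
    by (rule sum.cong) (auto simp: Cb power2_eq_square)
  also have "\<dots> = (\<Sum>l=1..i. c l *\<^sub>R C (b l)) \<bullet> C v" by (simp add: inner_sum_left)
  also have "(\<Sum>l=1..i. c l *\<^sub>R C (b l)) = C v"
    by (simp add: v_def linear_sum[OF linear_C] linear_cmul[OF linear_C])
  also have "C v \<bullet> C v = (norm (C v))\<^sup>2" by (simp add: power2_norm_eq_inner)
  finally show ?thesis using v1 by linarith
qed

lemma orthonormal_extend:
  assumes "orthonormal_wrt Q n b" "\<forall>j\<in>{1..n}. q x (b j) = 0" "q x x = 1"
  shows "orthonormal_wrt Q (Suc n) (b(Suc n := x))"
  using assms by (auto simp: orthonormal_wrt_q q_commute[of "b _" x] le_Suc_eq)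

lemma eigensystem_extend:
  assumes "eigensystem n lam b" "x \<in> H" "\<forall>j\<in>{1..n}. q x (b j) = 0" "q x x = 1" "C' (C x) = s *\<^sub>R Q x"
  shows "eigensystem (Suc n) (lam(Suc n := s)) (b(Suc n := x))"
  using assms orthonormal_extend[of n b x] by (auto simp: eigensystem_iff le_Suc_eq)

lemma leading_extend:
  assumes b: "leading_eigensystem n lam b" and x: "x \<in> H" "\<forall>j\<in>{1..n}. q x (b j) = 0" "q x x = 1"
    and max: "\<And>y. y \<in> H \<Longrightarrow> \<forall>j\<in>{1..n}. q y (b j) = 0 \<Longrightarrow> (norm (C y))\<^sup>2 \<le> (norm (C x))\<^sup>2 * q y y"
  shows "leading_eigensystem (Suc n) (lam(Suc n := (norm (C x))\<^sup>2)) (b(Suc n := x))"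
proof -
  have es: "eigensystem n lam b" using b by (simp add: leading_eigensystem_def)
  have "C' (C x) = (norm (C x))\<^sup>2 *\<^sub>R Q x"
    using max by (intro maximizer_is_eigenvector[OF es x]) fastforce
  from eigensystem_extend[OF es x this]
  have E: "eigensystem (Suc n) (lam(Suc n := (norm (C x))\<^sup>2)) (b(Suc n := x))" .
  have "(norm (C y))\<^sup>2 \<le> (lam(Suc n := (norm (C x))\<^sup>2)) i * q y y"
    if "i \<in> {1..Suc n}" "y \<in> H" "\<forall>j\<in>{1..<i}. q y ((b(Suc n := x)) j) = 0" for i y
  proof (cases "i = Suc n")
    case True
    then show ?thesis using that max[of y] by auto
  next
    case False
    then have "i \<in> {1..n}" using that by auto
    then show ?thesis using that b unfolding leading_eigensystem_def by auto
  qed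
  with E show ?thesis unfolding leading_eigensystem_def by blast
qed

text \<open>
  The system \<open>b\<close> only shows that the rank of \<open>Q\<close> on \<open>H\<close> is at least \<open>k\<close>: as long as fewer than \<open>k\<close>
  vectors have been found, some combination of the \<open>b i\<close> is orthogonal to them, so the next
  maximisation has admissible vectors.
\<close>

lemma leading_eigensystem_exists:
  assumes "orthonormal_wrt Q k b" and bH: "\<And>i. i \<in> {1..k} \<Longrightarrow> b i \<in> H"
  shows "\<exists>lam e. leading_eigensystem k lam e"
proof -
  have "\<exists>lam e. leading_eigensystem n lam e" if "n \<le> k" for n
    using that
  proof (induction n)
    case 0
    then show ?case by (simp add: leading_eigensystem_def eigensystem_def orthonormal_wrt_def)
  next
    case (Suc n)
    then obtain lam e where e: "leading_eigensystem n lam e" by auto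
    then have es: "eigensystem n lam e" by (simp add: leading_eigensystem_def)
    have "n < k" using Suc by simp
    from orthogonal_combination[OF assms(1) bH this, of e]
    obtain x where "x \<in> H" "\<forall>j\<in>{1..n}. q x (e j) = 0" "q x x = 1" by blast
    then have "\<exists>x\<in>H. (\<forall>j\<in>{1..n}. q x (e j) = 0) \<and> q x x = 1" by blast
    from maximizer_exists[OF es this] obtain x where "x \<in> H" "\<forall>j\<in>{1..n}. q x (e j) = 0" "q x x = 1"
      "\<And>y. y \<in> H \<Longrightarrow> \<forall>j\<in>{1..n}. q y (e j) = 0 \<Longrightarrow> (norm (C y))\<^sup>2 \<le> (norm (C x))\<^sup>2 * q y y" by blast
    from leading_extend[OF e this] show ?case by blast
  qed
  then show ?thesis by blast
qed

text \<open>
  The eigenvectors \<open>b\<close> need not be the vectors \<open>e\<close>, not even up to sign, if an eigenvalue is repeated.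
  Ky Fan's inequality for \<open>b 1, \<dots>, b m\<close> and a further vector \<open>y\<close> reads
  \<open>lam 1 + \<dots> + lam m + \<parallel>C y\<parallel>\<^sup>2 \<le> lam 1 + \<dots> + lam (m + 1)\<close>, and the common terms cancel.
\<close>

lemma eigensystem_bound:
  assumes e: "leading_eigensystem n lam e" and i: "Suc m \<le> n" and b: "eigensystem m lam b"
    and x: "x \<in> H" "\<forall>j\<in>{1..m}. q x (b j) = 0"
  shows "(norm (C x))\<^sup>2 \<le> lam (Suc m) * q x x"
proof (rule scaled_bound[of "{1..m}" b, OF _ x])
  fix y assume y: "y \<in> H" "\<forall>j\<in>{1..m}. q y (b j) = 0" "q y y = 1"
  have bo: "orthonormal_wrt Q m b" and bH: "\<And>j. j \<in> {1..m} \<Longrightarrow> b j \<in> H"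
    using b by (auto simp: eigensystem_iff)
  have "(\<Sum>j=1..Suc m. (norm (C ((b(Suc m := y)) j)))\<^sup>2) \<le> (\<Sum>j=1..Suc m. lam j)"
    using bH y(1) by (intro Ky_Fan[OF leading_mono[OF e i] orthonormal_extend[OF bo y(2,3)]]) auto
  moreover have "(\<Sum>j=1..m. (norm (C ((b(Suc m := y)) j)))\<^sup>2) = (\<Sum>j=1..m. lam j)"
    by (rule sum.cong) (auto simp: eigensystem_norm_C[OF b])
  ultimately show "(norm (C y))\<^sup>2 \<le> lam (Suc m)" by simp
qed

lemma eigensystem_leading:
  assumes e: "leading_eigensystem n lam e" and m: "m \<le> n" and b: "eigensystem m lam b"
  shows "leading_eigensystem m lam b"
proof -
  have "(norm (C x))\<^sup>2 \<le> lam i * q x x" if "i \<in> {1..m}" "x \<in> H" "\<forall>j\<in>{1..<i}. q x (b j) = 0" for i x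
  proof -
    have "i = Suc (i - 1)" using that by auto
    moreover have "eigensystem (i - 1) lam b" using b by (rule eigensystem_mono) (use that in auto)
    moreover have "\<forall>j\<in>{1..i-1}. q x (b j) = 0" using that by auto
    ultimately show ?thesis using eigensystem_bound[OF e, of "i - 1" b x] that m by auto
  qed
  then show ?thesis using b by (auto simp: leading_eigensystem_def)
qed

text \<open>
  The converse of the previous cancellation: \<open>b\<close> and the next maximiser form a leading eigensystem,
  and Ky Fan's inequality for this system and the vectors \<open>e\<close> shows that the maximum is at least
  \<open>lam (m + 1)\<close>.
\<close>

lemma eigensystem_max_attained:
  assumes e: "leading_eigensystem n lam e" and i: "Suc m \<le> n" and b: "eigensystem m lam b"
  shows "\<exists>x\<in>H. (\<forall>j\<in>{1..m}. q x (b j) = 0) \<and> q x x = 1 \<and> (norm (C x))\<^sup>2 = lam (Suc m)"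
proof -
  have eo: "orthonormal_wrt Q (Suc m) e" and eH: "\<And>j. j \<in> {1..Suc m} \<Longrightarrow> e j \<in> H"
    and es: "eigensystem (Suc m) lam e"
    using leading_mono[OF e i] by (auto simp: leading_eigensystem_def eigensystem_iff)
  from orthogonal_combination[OF eo eH lessI, of b]
  have "\<exists>x\<in>H. (\<forall>j\<in>{1..m}. q x (b j) = 0) \<and> q x x = 1" by blast
  from maximizer_exists[OF b this] obtain x where x: "x \<in> H" "\<forall>j\<in>{1..m}. q x (b j) = 0" "q x x = 1"
    "\<And>y. y \<in> H \<Longrightarrow> \<forall>j\<in>{1..m}. q y (b j) = 0 \<Longrightarrow> (norm (C y))\<^sup>2 \<le> (norm (C x))\<^sup>2 * q y y" by blast
  have "leading_eigensystem m lam b" using i by (intro eigensystem_leading[OF e _ b]) simp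
  from Ky_Fan[OF leading_extend[OF this x] eo eH]
  have "(\<Sum>j=1..Suc m. (norm (C (e j)))\<^sup>2) \<le> (\<Sum>j=1..Suc m. (lam(Suc m := (norm (C x))\<^sup>2)) j)" by simp
  moreover have "(\<Sum>j=1..Suc m. (norm (C (e j)))\<^sup>2) = (\<Sum>j=1..Suc m. lam j)"
    by (rule sum.cong) (auto intro: eigensystem_norm_C[OF es])
  moreover have "(\<Sum>j=1..m. (lam(Suc m := (norm (C x))\<^sup>2)) j) = (\<Sum>j=1..m. lam j)"
    by (rule sum.cong) auto
  ultimately have "lam (Suc m) \<le> (norm (C x))\<^sup>2" by simp
  moreover have "(norm (C x))\<^sup>2 \<le> lam (Suc m)"
    using eigensystem_bound[OF e i b x(1,2)] x(3) by simp
  ultimately show ?thesis using x by (intro bexI[of _ x]) auto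
qed

section \<open>Successive maximisation, multiplicities and optimality\<close>

text \<open>
  An eigensystem can be built one vector at a time by checking only the value \<open>\<parallel>C x\<parallel>\<^sup>2\<close>: a vector that
  attains the maximum satisfies the eigenvalue equation.
\<close>

lemma eigensystem_Suc_iff:
  assumes e: "leading_eigensystem n lam e" and m: "Suc m \<le> n"
  shows "eigensystem (Suc m) lam b \<longleftrightarrow> eigensystem m lam b \<and> b (Suc m) \<in> H \<and>
    (\<forall>j\<in>{1..m}. q (b (Suc m)) (b j) = 0) \<and> q (b (Suc m)) (b (Suc m)) = 1 \<and> (norm (C (b (Suc m))))\<^sup>2 = lam (Suc m)"
    (is "?L \<longleftrightarrow> ?R")
proof
  assume L: ?L
  have bo: "orthonormal_wrt Q (Suc m) b" using L unfolding eigensystem_iff by blast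
  have "b (Suc m) \<in> H" using L unfolding eigensystem_iff by simp
  moreover have "q (b (Suc m)) (b j) = (if Suc m = j then 1 else 0)" if "j \<in> {1..Suc m}" for j
    using bo that unfolding orthonormal_wrt_q by auto
  moreover have "eigensystem m lam b" using L by (rule eigensystem_mono) simp
  moreover have "(norm (C (b (Suc m))))\<^sup>2 = lam (Suc m)" using L by (rule eigensystem_norm_C) simp
  ultimately show ?R by auto
next
  assume R: ?R
  then have es: "eigensystem m lam b" and x: "b (Suc m) \<in> H" "\<forall>j\<in>{1..m}. q (b (Suc m)) (b j) = 0"
    "q (b (Suc m)) (b (Suc m)) = 1" and val: "(norm (C (b (Suc m))))\<^sup>2 = lam (Suc m)" by auto
  have "(norm (C y))\<^sup>2 \<le> (norm (C (b (Suc m))))\<^sup>2"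
    if "y \<in> H" "\<forall>j\<in>{1..m}. q y (b j) = 0" "q y y = 1" for y
    using eigensystem_bound[OF e m es that(1,2)] that(3) val by simp
  then have "C' (C (b (Suc m))) = (norm (C (b (Suc m))))\<^sup>2 *\<^sub>R Q (b (Suc m))"
    by (intro maximizer_is_eigenvector[OF es x])
  then have "C' (C (b (Suc m))) = lam (Suc m) *\<^sub>R Q (b (Suc m))" unfolding val .
  from eigensystem_extend[OF es x this] show ?L unfolding fun_upd_triv .
qed

lemma recursive_maximizer_iff:
  assumes e: "leading_eigensystem n lam e" and m: "Suc m \<le> n" and b: "eigensystem m lam b"
  shows "recursive_maximizer H (C' \<circ> C) Q b (Suc m) x \<longleftrightarrow>
    x \<in> H \<and> (\<forall>j\<in>{1..m}. q x (b j) = 0) \<and> q x x = 1 \<and> (norm (C x))\<^sup>2 = lam (Suc m)"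
proof -
  let ?P = "\<lambda>x. x \<in> H \<and> (\<forall>j\<in>{1..m}. q x (b j) = 0) \<and> q x x = 1"
  have eq: "recursive_maximizer H (C' \<circ> C) Q b (Suc m) x \<longleftrightarrow>
    ?P x \<and> (\<forall>y. ?P y \<longrightarrow> (norm (C y))\<^sup>2 \<le> (norm (C x))\<^sup>2)"
    by (auto simp: recursive_maximizer_def is_arg_max_def q_def atLeastLessThanSuc_atLeastAtMost
        inner_C_eq[symmetric] power2_norm_eq_inner not_less)
  have ub: "(norm (C y))\<^sup>2 \<le> lam (Suc m)" if "?P y" for y
    using eigensystem_bound[OF e m b, of y] that by simp
  obtain z where z: "?P z" "(norm (C z))\<^sup>2 = lam (Suc m)"
    using eigensystem_max_attained[OF e m b] by blast
  show ?thesis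
  proof
    assume "recursive_maximizer H (C' \<circ> C) Q b (Suc m) x"
    then have x: "?P x" "(norm (C z))\<^sup>2 \<le> (norm (C x))\<^sup>2" unfolding eq using z(1) by blast+
    then show "x \<in> H \<and> (\<forall>j\<in>{1..m}. q x (b j) = 0) \<and> q x x = 1 \<and> (norm (C x))\<^sup>2 = lam (Suc m)"
      using ub[OF x(1)] z(2) by linarith
  next
    assume x: "x \<in> H \<and> (\<forall>j\<in>{1..m}. q x (b j) = 0) \<and> q x x = 1 \<and> (norm (C x))\<^sup>2 = lam (Suc m)"
    then have "(norm (C y))\<^sup>2 \<le> (norm (C x))\<^sup>2" if "?P y" for y using ub[OF that] by linarith
    with x show "recursive_maximizer H (C' \<circ> C) Q b (Suc m) x" unfolding eq by blast
  qed
qed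

lemma recursive_maximizers_iff_eigensystem:
  assumes e: "leading_eigensystem n lam e" and m: "m \<le> n"
  shows "(\<forall>i\<in>{1..m}. recursive_maximizer H (C' \<circ> C) Q b i (b i)) \<longleftrightarrow> eigensystem m lam b"
  using m
proof (induction m)
  case 0
  then show ?case by (simp add: eigensystem_iff orthonormal_wrt_def)
next
  case (Suc m)
  have IH: "(\<forall>i\<in>{1..m}. recursive_maximizer H (C' \<circ> C) Q b i (b i)) \<longleftrightarrow> eigensystem m lam b"
    using Suc.prems by (intro Suc.IH) simp
  have split: "(\<forall>i\<in>{1..Suc m}. W i) \<longleftrightarrow> (\<forall>i\<in>{1..m}. W i) \<and> W (Suc m)" for W
  proof -
    have "{1..Suc m} = insert (Suc m) {1..m}" by auto
    then show ?thesis by (simp only: Set.ball_simps(7) conj_commute)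
  qed
  show ?case
  proof (cases "eigensystem m lam b")
    case True
    then show ?thesis
      unfolding split IH recursive_maximizer_iff[OF e Suc.prems True] eigensystem_Suc_iff[OF e Suc.prems]
      by blast
  next
    case False
    then show ?thesis
      unfolding split IH eigensystem_Suc_iff[OF e Suc.prems] by blast
  qed
qed

text \<open>
  The images \<open>Q (e i)\<close> are independent, because the vectors \<open>e i\<close> are dual to them; this bounds the
  multiplicities from below.  Conversely, let \<open>b\<close> be an eigenvector for some \<open>\<mu>\<close> that is larger than
  some \<open>lam i\<close>.  Its component orthogonal to all \<open>e j\<close> has Rayleigh quotient \<open>\<mu>\<close>, which the bound by
  \<open>lam i\<close> allows only if \<open>Q\<close> annihilates it.  Hence \<open>Q b\<close> is in the span of the \<open>Q (e j)\<close> with \<open>lam j = \<mu>\<close>.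
\<close>

lemma leading_eigenvalues_if_leading_eigensystem:
  assumes e: "leading_eigensystem n lam e"
  shows "leading_eigenvalues H (C' \<circ> C) Q n lam"
proof -
  have es: "eigensystem n lam e" using e by (simp add: leading_eigensystem_def)
  have eH: "\<And>i. i \<in> {1..n} \<Longrightarrow> e i \<in> H" and eo: "orthonormal_wrt Q n e"
    using es by (auto simp: eigensystem_iff)
  have dual: "e j \<bullet> Q (e i) = (if j = i then 1 else 0)" if "i \<in> {1..n}" "j \<in> {1..n}" for i j
    using eo that by (simp add: orthonormal_wrt_def)
  define I where "I \<mu> = {i\<in>{1..n}. lam i = \<mu>}" for \<mu>
  have I: "finite (I \<mu>)" "I \<mu> \<subseteq> {1..n}" for \<mu> by (auto simp: I_def)
  have inj: "inj_on (\<lambda>i. Q (e i)) (I \<mu>)" for \<mu>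
  proof (rule inj_onI)
    fix i j assume "i \<in> I \<mu>" "j \<in> I \<mu>" "Q (e i) = Q (e j)"
    then show "i = j" using dual[of i i] dual[of j i] I(2) by (metis subsetD zero_neq_one)
  qed
  have card_T: "card ((\<lambda>i. Q (e i)) ` I \<mu>) = card (I \<mu>)" for \<mu>
    using inj by (rule card_image)
  have indep: "independent ((\<lambda>i. Q (e i)) ` I \<mu>)" for \<mu>
  proof
    assume "dependent ((\<lambda>i. Q (e i)) ` I \<mu>)"
    then obtain u v where u: "v \<in> (\<lambda>i. Q (e i)) ` I \<mu>" "u v \<noteq> 0" "(\<Sum>v\<in>(\<lambda>i. Q (e i)) ` I \<mu>. u v *\<^sub>R v) = 0"
      using I(1) by (subst (asm) dependent_finite) auto
    then obtain j where j: "j \<in> I \<mu>" "v = Q (e j)" by blast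
    have "0 = e j \<bullet> (\<Sum>i\<in>I \<mu>. u (Q (e i)) *\<^sub>R Q (e i))"
      using u(3) by (simp add: sum.reindex[OF inj])
    also have "\<dots> = (\<Sum>i\<in>I \<mu>. if i = j then u v else 0)"
      unfolding inner_sum_right
    proof (rule sum.cong[OF refl])
      fix i assume i: "i \<in> I \<mu>"
      have "e j \<bullet> Q (e i) = (if j = i then 1 else 0)" using dual i j(1) I(2) by blast
      then show "e j \<bullet> u (Q (e i)) *\<^sub>R Q (e i) = (if i = j then u v else 0)" using j(2) by simp
    qed
    also have "\<dots> = u v" using j I(1) by simp
    finally show False using u(2) by simp
  qed
  have lower: "enat (card (I \<mu>)) \<le> pencil_multiplicity H (C' \<circ> C) Q \<mu>" for \<mu>
  proof -
    have "(\<lambda>i. Q (e i)) ` I \<mu> \<subseteq> Q ` {b. pencil_eigenvector H (C' \<circ> C) Q \<mu> b}"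
      using es by (auto simp: I_def eigensystem_def)
    then show ?thesis
      unfolding pencil_multiplicity_def using indep[of \<mu>] I(1)[of \<mu>]
      by (intro Sup_upper CollectI exI[of _ "(\<lambda>i. Q (e i)) ` I \<mu>"]) (simp add: card_T)
  qed
  have upper: "pencil_multiplicity H (C' \<circ> C) Q \<mu> \<le> enat (card (I \<mu>))" if i: "i \<in> {1..n}" "lam i < \<mu>" for i \<mu>
  proof -
    have in_span: "Q b \<in> span ((\<lambda>i. Q (e i)) ` I \<mu>)" if b: "pencil_eigenvector H (C' \<circ> C) Q \<mu> b" for b
    proof -
      have bH: "b \<in> H" and eig: "C' (C b) = \<mu> *\<^sub>R Q b"
        using b by (auto simp: pencil_eigenvector_def)
      have Cb: "C x \<bullet> C b = \<mu> * q x b" for x by (simp add: inner_C_eq eig q_def)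
      have off: "q b (e j) = 0" if "j \<in> {1..n}" "lam j \<noteq> \<mu>" for j
        using Cb[of "e j"] eigensystem_C(2)[OF es that(1), of b] that(2) by (simp add: q_commute[of "e j"])
      (* C r is orthogonal to every C (e j), so it has the same inner product with C b as with
         itself *)
      define r where "r = b - (\<Sum>j=1..n. q b (e j) *\<^sub>R e j)"
      have rH: "r \<in> H" unfolding r_def
        by (intro subspace_diff[OF subspace_H] subspace_sum[OF subspace_H] subspace_scale[OF subspace_H] bH eH)
      have re: "\<forall>j\<in>{1..n}. q r (e j) = 0" unfolding r_def by (rule Bessel_q(2)[OF eo])
      have "C r \<bullet> C r = C r \<bullet> C b - (\<Sum>j=1..n. q b (e j) * (C r \<bullet> C (e j)))"
        by (subst (2) r_def) (simp add: linear_diff[OF linear_C] linear_sum[OF linear_C]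
            linear_cmul[OF linear_C] inner_diff_right inner_sum_right)
      also have "\<dots> = \<mu> * q r b" using re eigensystem_C(1)[OF es] by (simp add: Cb)
      also have "q r b = q r r + (\<Sum>j=1..n. q b (e j) * q r (e j))"
        by (subst (3) r_def) (simp add: q_simps q_sum)
      also have "\<dots> = q r r" using re by simp
      finally have "\<mu> * q r r = (norm (C r))\<^sup>2" by (simp add: power2_norm_eq_inner)
      also have "\<dots> \<le> lam i * q r r"
        using e i(1) rH re unfolding leading_eigensystem_def by auto
      finally have "(\<mu> - lam i) * q r r \<le> 0" by (simp add: left_diff_distrib)
      then have "q r r = 0" using i(2) q_nonneg[of r] by (simp add: mult_le_0_iff)
      then have "Q r = 0" by (simp add: Q_eq_0_iff)
      then have "Q b = (\<Sum>j=1..n. q b (e j) *\<^sub>R Q (e j))"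
        by (simp add: r_def linear_diff[OF linear_Q] linear_sum[OF linear_Q] linear_cmul[OF linear_Q])
      also have "\<dots> = (\<Sum>j\<in>I \<mu>. q b (e j) *\<^sub>R Q (e j))"
        by (rule sum.mono_neutral_right) (auto simp: I_def off)
      also have "\<dots> \<in> span ((\<lambda>i. Q (e i)) ` I \<mu>)"
        by (intro span_sum span_scale span_base) simp
      finally show ?thesis .
    qed
    show ?thesis unfolding pencil_multiplicity_def
    proof (rule Sup_least, clarify)
      fix S assume S: "finite S" "independent S" "S \<subseteq> Q ` {b. pencil_eigenvector H (C' \<circ> C) Q \<mu> b}"
      then have "S \<subseteq> span ((\<lambda>i. Q (e i)) ` I \<mu>)" using in_span by blast
      with I(1) S(2) have "card S \<le> card ((\<lambda>i. Q (e i)) ` I \<mu>)"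
        using independent_span_bound[of "(\<lambda>i. Q (e i)) ` I \<mu>" S] by blast
      then show "enat (card S) \<le> enat (card (I \<mu>))" by (simp add: card_T)
    qed
  qed
  show ?thesis
    unfolding leading_eigenvalues_def I_def[symmetric]
    using leading_antimono[OF e] lower upper by (auto intro: antisym)
qed

text \<open>
  Up to a constant, the expression is the mean squared error.  If it attains the lower bound given by
  Ky Fan's inequality, then \<open>a = C b\<close>, so the constraints on \<open>a\<close> say that \<open>b\<close> diagonalises \<open>C'C\<close> with
  decreasing diagonal.  This rules out rotations of \<open>b\<close> within its span, which leave the sum of the
  \<open>\<parallel>C (b i)\<parallel>\<^sup>2\<close> unchanged, and makes the Courant-Fischer bound applicable to each \<open>b i\<close>.
\<close>

lemma reduced_rank_optimum:
  assumes e: "leading_eigensystem n lam e"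
    and b: "orthonormal_wrt Q n b" and bH: "\<And>i. i \<in> {1..n} \<Longrightarrow> b i \<in> H"
  shows "- (\<Sum>i=1..n. lam i) \<le> (\<Sum>i=1..n. (norm (a i - C (b i)))\<^sup>2) - (\<Sum>i=1..n. (norm (C (b i)))\<^sup>2)" (is ?bound)
    and "(\<Sum>i=1..n. (norm (a i - C (b i)))\<^sup>2) - (\<Sum>i=1..n. (norm (C (b i)))\<^sup>2) \<le> - (\<Sum>i=1..n. lam i) \<Longrightarrow>
      (\<And>i j. i \<in> {1..n} \<Longrightarrow> j \<in> {1..n} \<Longrightarrow> i \<noteq> j \<Longrightarrow> a i \<bullet> a j = 0) \<Longrightarrow> antimono_on {1..n} (\<lambda>i. a i \<bullet> a i) \<Longrightarrow>
      (\<forall>i\<in>{1..n}. a i = C (b i)) \<and> eigensystem n lam b"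
proof -
  note KF = Ky_Fan[OF e b bH]
  have sq: "0 \<le> (\<Sum>i=1..n. (norm (a i - C (b i)))\<^sup>2)" by (rule sum_nonneg) simp
  with KF show ?bound by linarith
  assume le: "(\<Sum>i=1..n. (norm (a i - C (b i)))\<^sup>2) - (\<Sum>i=1..n. (norm (C (b i)))\<^sup>2) \<le> - (\<Sum>i=1..n. lam i)"
    and orth: "\<And>i j. i \<in> {1..n} \<Longrightarrow> j \<in> {1..n} \<Longrightarrow> i \<noteq> j \<Longrightarrow> a i \<bullet> a j = 0"
    and anti: "antimono_on {1..n} (\<lambda>i. a i \<bullet> a i)"
  have "(\<Sum>i=1..n. (norm (a i - C (b i)))\<^sup>2) = 0" and total: "(\<Sum>i=1..n. (norm (C (b i)))\<^sup>2) = (\<Sum>i=1..n. lam i)"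
    using le KF sq by linarith+
  then have a: "\<forall>i\<in>{1..n}. a i = C (b i)" by (simp add: sum_nonneg_eq_0_iff)
  have diag: "C (b i) \<bullet> C (b j) = 0" if "i \<in> {1..n}" "j \<in> {1..n}" "i \<noteq> j" for i j
    using orth[OF that] a that by simp
  have anti': "antimono_on {1..n} (\<lambda>i. (norm (C (b i)))\<^sup>2)"
    using anti a by (auto simp: monotone_on_def power2_norm_eq_inner)
  have each: "lam i - (norm (C (b i)))\<^sup>2 = 0" if "i \<in> {1..n}" for i
  proof -
    have "(\<Sum>i=1..n. lam i - (norm (C (b i)))\<^sup>2) = 0" using total by (simp add: sum_subtractf)
    then show ?thesis
      using Courant_Fischer[OF e b bH diag anti'] that by (subst (asm) sum_nonneg_eq_0_iff) auto
  qed
  have "eigensystem m lam b" if "m \<le> n" for m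
    using that
  proof (induction m)
    case 0
    then show ?case by (simp add: eigensystem_iff orthonormal_wrt_def)
  next
    case (Suc m)
    then show ?case
      unfolding eigensystem_Suc_iff[OF e Suc.prems] using b bH each[of "Suc m"]
      by (auto simp: orthonormal_wrt_q)
  qed
  with a show "(\<forall>i\<in>{1..n}. a i = C (b i)) \<and> eigensystem n lam b" by blast
qed

end

section \<open>The reduced-rank prediction problem\<close>

text \<open>
  The formula for the mean squared error turns the prediction problem into an extremal problem for the
  pencil; it holds for the centred variables of a functional autoregression (\<open>rr_mse_orthonormal\<close>).
\<close>

locale reduced_rank_prediction = factored_pencil H Q C C' R
  for H :: "L2 set" and Q C C' R +
  fixes M :: "'w measure" and X Y :: "'w \<Rightarrow> L2"
  assumes Q_cov: "Q = cross_cov M X X"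
    and C_in_H: "C x \<in> H"
    and mse: "orthonormal_wrt Q n b \<Longrightarrow> rr_mse M X Y n a b =
      (\<integral>\<omega>. (norm (Y \<omega>))\<^sup>2 \<partial>M) + ((\<Sum>i=1..n. (norm (a i - C (b i)))\<^sup>2) - (\<Sum>i=1..n. (norm (C (b i)))\<^sup>2))"
begin

lemma eigensystem_feasible:
  assumes e: "leading_eigensystem n lam e" and b: "eigensystem n lam b" and a: "\<forall>i\<in>{1..n}. a i = C (b i)"
  shows "rr_feasible M H X n a b"
    and "rr_mse M X Y n a b = (\<integral>\<omega>. (norm (Y \<omega>))\<^sup>2 \<partial>M) - (\<Sum>i=1..n. lam i)"
proof -
  have bo: "orthonormal_wrt Q n b" and bH: "\<forall>i\<in>{1..n}. b i \<in> H"
    using b by (auto simp: eigensystem_iff)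
  have aa: "a i \<bullet> a j = (if i = j then lam i else 0)" if "i \<in> {1..n}" "j \<in> {1..n}" for i j
    using a that bo eigensystem_C(1)[OF b that(2), of "b i"] by (auto simp: orthonormal_wrt_q)
  have "antimono_on {1..n} (\<lambda>i. a i \<bullet> a i)"
    using leading_antimono[OF e] by (auto simp: monotone_on_def aa)
  then show "rr_feasible M H X n a b"
    using bo bH a C_in_H aa by (auto simp: rr_feasible_def Q_cov)
  have "(\<Sum>i=1..n. (norm (C (b i)))\<^sup>2) = (\<Sum>i=1..n. lam i)"
    by (rule sum.cong) (auto intro: eigensystem_norm_C[OF b])
  moreover have "(\<Sum>i=1..n. (norm (a i - C (b i)))\<^sup>2) = 0" using a by simp
  ultimately show "rr_mse M X Y n a b = (\<integral>\<omega>. (norm (Y \<omega>))\<^sup>2 \<partial>M) - (\<Sum>i=1..n. lam i)"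
    by (simp add: mse[OF bo])
qed

lemma mse_lower_bound:
  assumes e: "leading_eigensystem n lam e" and f: "rr_feasible M H X n a b"
  shows "(\<integral>\<omega>. (norm (Y \<omega>))\<^sup>2 \<partial>M) - (\<Sum>i=1..n. lam i) \<le> rr_mse M X Y n a b"
proof -
  have "orthonormal_wrt Q n b" "\<And>i. i \<in> {1..n} \<Longrightarrow> b i \<in> H"
    using f by (auto simp: rr_feasible_def Q_cov)
  from mse[OF this(1), of a] reduced_rank_optimum(1)[OF e this, of a] show ?thesis by linarith
qed

lemma rr_solution_iff:
  assumes e: "leading_eigensystem n lam e"
  shows "rr_solution M H X Y n a b \<longleftrightarrow> (\<forall>i\<in>{1..n}. a i = C (b i)) \<and> eigensystem n lam b"
proof
  assume *: "(\<forall>i\<in>{1..n}. a i = C (b i)) \<and> eigensystem n lam b"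
  then show "rr_solution M H X Y n a b"
    using eigensystem_feasible[OF e, of b a] mse_lower_bound[OF e]
    by (auto simp: rr_solution_def is_arg_min_def not_less)
next
  assume s: "rr_solution M H X Y n a b"
  then have f: "rr_feasible M H X n a b" by (simp add: rr_solution_def is_arg_min_def)
  have es: "eigensystem n lam e" using e by (simp add: leading_eigensystem_def)
  have "rr_feasible M H X n (\<lambda>i. C (e i)) e"
    "rr_mse M X Y n (\<lambda>i. C (e i)) e = (\<integral>\<omega>. (norm (Y \<omega>))\<^sup>2 \<partial>M) - (\<Sum>i=1..n. lam i)"
    using eigensystem_feasible[OF e es] by auto
  then have le: "rr_mse M X Y n a b \<le> (\<integral>\<omega>. (norm (Y \<omega>))\<^sup>2 \<partial>M) - (\<Sum>i=1..n. lam i)"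
    using s by (fastforce simp: rr_solution_def is_arg_min_def not_less)
  have b: "orthonormal_wrt Q n b" "\<And>i. i \<in> {1..n} \<Longrightarrow> b i \<in> H"
    using f by (auto simp: rr_feasible_def Q_cov)
  show "(\<forall>i\<in>{1..n}. a i = C (b i)) \<and> eigensystem n lam b"
  proof (rule reduced_rank_optimum(2)[OF e b])
    show "(\<Sum>i=1..n. (norm (a i - C (b i)))\<^sup>2) - (\<Sum>i=1..n. (norm (C (b i)))\<^sup>2) \<le> - (\<Sum>i=1..n. lam i)"
      using le mse[OF b(1), of a] by linarith
  qed (use f in \<open>auto simp: rr_feasible_def\<close>)
qed

lemma rr_min_eq:
  assumes e: "leading_eigensystem n lam e"
  shows "rr_min M H X Y n = (\<integral>\<omega>. (norm (Y \<omega>))\<^sup>2 \<partial>M) - (\<Sum>i=1..n. lam i)"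
  unfolding rr_min_def
proof (rule cInf_eq_minimum)
  have "eigensystem n lam e" using e by (simp add: leading_eigensystem_def)
  from eigensystem_feasible[OF e this, of "\<lambda>i. C (e i)"]
  show "(\<integral>\<omega>. (norm (Y \<omega>))\<^sup>2 \<partial>M) - (\<Sum>i=1..n. lam i) \<in> {rr_mse M X Y n a b |a b. rr_feasible M H X n a b}"
    by force
qed (use mse_lower_bound[OF e] in blast)

text \<open>
  The multiplicity counts independent vectors of the form \<open>Q b\<close>, so a simple eigenvalue makes \<open>Q y\<close> a
  multiple of \<open>Q x\<close>.  Definiteness of \<open>Q\<close> on \<open>H\<close> carries this over to \<open>y\<close> and \<open>x\<close>, and the normalisation
  leaves only the sign.
\<close>

lemma simple_eigenvectors_unique:
  assumes mult: "pencil_multiplicity H (C' \<circ> C) Q \<mu> = 1"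
    and inj: "\<And>x. x \<in> H \<Longrightarrow> x \<noteq> 0 \<Longrightarrow> 0 < x \<bullet> Q x"
    and x: "pencil_eigenvector H (C' \<circ> C) Q \<mu> x" "q x x = 1"
    and y: "pencil_eigenvector H (C' \<circ> C) Q \<mu> y" "q y y = 1"
  shows "y = x \<or> y = - x"
proof -
  have "Q x \<noteq> 0" "Q y \<noteq> 0" using x(2) y(2) by (auto simp: q_def)
  have "\<exists>c. Q y = c *\<^sub>R Q x"
  proof (rule ccontr)
    assume no: "\<nexists>c. Q y = c *\<^sub>R Q x"
    then have ne: "Q y \<noteq> Q x" by (metis scaleR_one)
    have "independent {Q y, Q x}"
      using no \<open>Q x \<noteq> 0\<close> ne by (auto simp: independent_insert span_singleton)
    then have "enat (card {Q y, Q x}) \<le> pencil_multiplicity H (C' \<circ> C) Q \<mu>"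
      unfolding pencil_multiplicity_def using x(1) y(1) by (intro Sup_upper) blast
    then show False using ne mult by (simp add: one_enat_def)
  qed
  then obtain c where c: "Q y = c *\<^sub>R Q x" by blast
  have H: "x \<in> H" "y \<in> H" using x y by (auto simp: pencil_eigenvector_def)
  have "Q (y - c *\<^sub>R x) = 0" by (simp add: linear_diff[OF linear_Q] linear_cmul[OF linear_Q] c)
  moreover have "y - c *\<^sub>R x \<in> H" by (intro subspace_diff[OF subspace_H] subspace_scale[OF subspace_H] H)
  ultimately have yc: "y = c *\<^sub>R x" using inj[of "y - c *\<^sub>R x"] by force
  then have "c\<^sup>2 = 1" using x(2) y(2) by (simp add: q_simps power2_eq_square)
  then have "c = 1 \<or> c = -1" by (rule power2_eq_1_iff[THEN iffD1])
  then show ?thesis using yc by auto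
qed

end

section \<open>Square-integrable functions on an interval\<close>

lemma rep_L2_measurable [measurable]: "rep_L2 x \<in> borel_measurable borel"
  using sq_integrable_measurable[OF sq_integrable_rep[of x]] by simp

text \<open>
  The restriction of \<open>x\<close> to the complement of the interval is orthogonal to \<open>L2_on T\<close>, and its inner
  product with \<open>x\<close> is its squared norm.  Describing \<open>L2_on T\<close> by inner products makes it evident that
  it is a subspace and closed under Bochner integration.
\<close>

lemma L2_on_bipolar: "x \<in> L2_on T \<longleftrightarrow> (\<forall>y. (\<forall>z\<in>L2_on T. z \<bullet> y = 0) \<longrightarrow> x \<bullet> y = 0)"
proof (intro iffI allI impI)
  assume *: "\<forall>y. (\<forall>z\<in>L2_on T. z \<bullet> y = 0) \<longrightarrow> x \<bullet> y = 0"
  let ?out = "\<lambda>s. indicator (- {0..T}) s * rep_L2 x s"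
  have sq: "sq_integrable ?out"
  proof -
    have "integrable lborel (\<lambda>s. indicator (- {0..T}) s *\<^sub>R (rep_L2 x s)\<^sup>2)"
      by (rule integrable_mult_indicator) (use sq_integrable_rep[of x] in \<open>auto simp: sq_integrable_def\<close>)
    moreover have "(\<lambda>s. indicator (- {0..T}) s *\<^sub>R (rep_L2 x s)\<^sup>2) = (\<lambda>s. (?out s)\<^sup>2)"
      by (auto simp: indicator_def)
    ultimately show ?thesis by (simp add: sq_integrable_def)
  qed
  have inner_out: "z \<bullet> abs_L2 ?out = (\<integral>s. rep_L2 z s * ?out s \<partial>lborel)" for z
    using inner_abs_L2[OF sq_integrable_rep[of z] sq] by (simp add: abs_rep_L2)
  have "z \<bullet> abs_L2 ?out = 0" if "z \<in> L2_on T" for z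
  proof -
    have "AE s in lborel. rep_L2 z s * ?out s = 0"
      using that unfolding L2_on_def by (auto elim!: eventually_mono simp: indicator_def)
    then show ?thesis unfolding inner_out by (rule integral_eq_zero_AE)
  qed
  with * have "x \<bullet> abs_L2 ?out = 0" by blast
  then have "(\<integral>s. (?out s)\<^sup>2 \<partial>lborel) = 0"
    unfolding inner_out by (rule trans[rotated]) (auto intro!: Bochner_Integration.integral_cong simp: indicator_def power2_eq_square)
  then have "AE s in lborel. (?out s)\<^sup>2 = 0"
    using sq by (subst (asm) integral_nonneg_eq_0_iff_AE) (auto simp: sq_integrable_def)
  then show "x \<in> L2_on T"
    unfolding L2_on_def by (auto elim!: eventually_mono simp: indicator_def split: if_splits)
qed blast

lemma subspace_L2_on: "subspace (L2_on T)"
proof -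
  have *: "L2_on T = (\<Inter>y\<in>{y. \<forall>z\<in>L2_on T. z \<bullet> y = 0}. {x. x \<bullet> y = 0})"
    using L2_on_bipolar[of _ T] by blast
  show ?thesis
    by (subst *) (auto simp: subspace_def inner_simps)
qed

lemma integral_in_L2_on:
  assumes "\<And>\<omega>. \<omega> \<in> space M \<Longrightarrow> h \<omega> \<in> L2_on T"
  shows "(\<integral>\<omega>. h \<omega> \<partial>M) \<in> L2_on T"
proof (cases "integrable M h")
  case True
  show ?thesis
  proof (subst L2_on_bipolar, intro allI impI)
    fix y assume y: "\<forall>z\<in>L2_on T. z \<bullet> y = 0"
    have "(\<integral>\<omega>. h \<omega> \<partial>M) \<bullet> y = (\<integral>\<omega>. h \<omega> \<bullet> y \<partial>M)"
      by (rule integral_inner_left[symmetric]) (use True in auto)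
    also have "\<dots> = (\<integral>\<omega>. 0 \<partial>M)"
      by (rule Bochner_Integration.integral_cong) (use assms y in auto)
    finally show "(\<integral>\<omega>. h \<omega> \<partial>M) \<bullet> y = 0" by simp
  qed
qed (simp add: not_integrable_integral_eq subspace_0[OF subspace_L2_on])

section \<open>Covariance operators\<close>

lemma second_order_measurable: "second_order M T X \<Longrightarrow> X \<in> borel_measurable M"
  by (simp add: second_order_def)

lemma second_order_diff:
  assumes X: "second_order M T X" and Y: "second_order M T Y"
  shows "second_order M T (\<lambda>\<omega>. X \<omega> - Y \<omega>)"
proof -
  have [measurable]: "X \<in> borel_measurable M" "Y \<in> borel_measurable M"
    using X Y by (auto simp: second_order_def)
  have "integrable M (\<lambda>\<omega>. (norm (X \<omega> - Y \<omega>))\<^sup>2)"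
  proof (rule Bochner_Integration.integrable_bound)
    show "integrable M (\<lambda>\<omega>. 2 * (norm (X \<omega>))\<^sup>2 + 2 * (norm (Y \<omega>))\<^sup>2)"
      using X Y by (auto simp: second_order_def)
    have "(norm (x - y))\<^sup>2 \<le> 2 * (norm x)\<^sup>2 + 2 * (norm y)\<^sup>2" for x y :: L2
      using zero_le_power2[of "norm (x + y)"] by (simp add: power2_norm_eq_inner inner_simps inner_commute)
    then show "AE \<omega> in M. norm ((norm (X \<omega> - Y \<omega>))\<^sup>2) \<le> norm (2 * (norm (X \<omega>))\<^sup>2 + 2 * (norm (Y \<omega>))\<^sup>2)"
      by (intro AE_I2) simp
  qed measurable
  then show ?thesis
    using X Y by (auto simp: second_order_def subspace_diff[OF subspace_L2_on])
qed

lemma norm_inner_scaleR_le: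
  fixes a x :: "'a::real_inner" and b :: "'b::real_normed_vector"
  shows "norm ((a \<bullet> x) *\<^sub>R b) \<le> norm x * (norm a * norm b)"
proof -
  have "\<bar>a \<bullet> x\<bar> * norm b \<le> (norm a * norm x) * norm b"
    by (intro mult_right_mono Cauchy_Schwarz_ineq2) simp
  then show ?thesis by (simp only: norm_scaleR ac_simps)
qed

lemma integrable_norm_mult:
  assumes X: "second_order M T X" and Y: "second_order M T Y"
  shows "integrable M (\<lambda>\<omega>. norm (X \<omega>) * norm (Y \<omega>))"
proof (rule Bochner_Integration.integrable_bound)
  have [measurable]: "X \<in> borel_measurable M" "Y \<in> borel_measurable M"
    using X Y by (auto simp: second_order_def)
  show "(\<lambda>\<omega>. norm (X \<omega>) * norm (Y \<omega>)) \<in> borel_measurable M" by measurable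
  show "integrable M (\<lambda>\<omega>. (norm (X \<omega>))\<^sup>2 + (norm (Y \<omega>))\<^sup>2)"
    using X Y by (auto simp: second_order_def)
  have "a * b \<le> a\<^sup>2 + b\<^sup>2" if "0 \<le> a" "0 \<le> b" for a b :: real
    using sum_squares_bound[of a b] mult_nonneg_nonneg[OF that] by linarith
  then show "AE \<omega> in M. norm (norm (X \<omega>) * norm (Y \<omega>)) \<le> norm ((norm (X \<omega>))\<^sup>2 + (norm (Y \<omega>))\<^sup>2)"
    by (intro AE_I2) simp
qed

lemma integrable_inner_mult:
  assumes X: "second_order M T X" and Y: "second_order M T Y"
  shows "integrable M (\<lambda>\<omega>. (X \<omega> \<bullet> x) * (Y \<omega> \<bullet> y))"
proof (rule Bochner_Integration.integrable_bound)
  have [measurable]: "X \<in> borel_measurable M" "Y \<in> borel_measurable M"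
    using X Y by (auto simp: second_order_def)
  show "(\<lambda>\<omega>. (X \<omega> \<bullet> x) * (Y \<omega> \<bullet> y)) \<in> borel_measurable M" by measurable
  show "integrable M (\<lambda>\<omega>. norm x * norm y * (norm (X \<omega>) * norm (Y \<omega>)))"
    by (intro integrable_mult_right integrable_norm_mult[OF X Y])
  have "\<bar>(a \<bullet> x) * (b \<bullet> y)\<bar> \<le> norm x * norm y * (norm a * norm b)" for a b
  proof -
    have "\<bar>(a \<bullet> x) * (b \<bullet> y)\<bar> \<le> (norm a * norm x) * (norm b * norm y)"
      unfolding abs_mult by (intro mult_mono Cauchy_Schwarz_ineq2) auto
    then show ?thesis by (simp only: ac_simps)
  qed
  then show "AE \<omega> in M. norm ((X \<omega> \<bullet> x) * (Y \<omega> \<bullet> y)) \<le> norm (norm x * norm y * (norm (X \<omega>) * norm (Y \<omega>)))"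
    by (intro AE_I2) simp
qed

lemma integrable_inner_scaleR:
  assumes X: "second_order M T X" and Y: "second_order M T Y"
  shows "integrable M (\<lambda>\<omega>. (X \<omega> \<bullet> x) *\<^sub>R Y \<omega>)"
proof (rule Bochner_Integration.integrable_bound)
  have [measurable]: "X \<in> borel_measurable M" "Y \<in> borel_measurable M"
    using X Y by (auto simp: second_order_def)
  show "(\<lambda>\<omega>. (X \<omega> \<bullet> x) *\<^sub>R Y \<omega>) \<in> borel_measurable M" by measurable
  show "integrable M (\<lambda>\<omega>. norm x * (norm (X \<omega>) * norm (Y \<omega>)))"
    by (intro integrable_mult_right integrable_norm_mult[OF X Y])
  show "AE \<omega> in M. norm ((X \<omega> \<bullet> x) *\<^sub>R Y \<omega>) \<le> norm (norm x * (norm (X \<omega>) * norm (Y \<omega>)))"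
    using norm_inner_scaleR_le[of "X _" x "Y _"] by (intro AE_I2) (simp del: norm_scaleR)
qed

lemma cross_cov_inner:
  assumes X: "second_order M T X" and Y: "second_order M T Y"
  shows "cross_cov M X Y x \<bullet> y = (\<integral>\<omega>. (X \<omega> \<bullet> x) * (Y \<omega> \<bullet> y) \<partial>M)"
proof -
  have "cross_cov M X Y x \<bullet> y = (\<integral>\<omega>. ((X \<omega> \<bullet> x) *\<^sub>R Y \<omega>) \<bullet> y \<partial>M)"
    unfolding cross_cov_def
    by (rule integral_inner_left[symmetric]) (use integrable_inner_scaleR[OF X Y] in auto)
  then show ?thesis by simp
qed

lemma cross_cov_symmetric:
  assumes X: "second_order M T X" and Y: "second_order M T Y"
  shows "cross_cov M X Y x \<bullet> y = x \<bullet> cross_cov M Y X y"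
  by (simp add: cross_cov_inner[OF X Y] inner_commute[of x] cross_cov_inner[OF Y X] mult.commute)

lemma linear_cross_cov:
  assumes X: "second_order M T X" and Y: "second_order M T Y"
  shows "linear (cross_cov M X Y)"
proof
  fix x y :: L2 and c :: real
  have "cross_cov M X Y (x + y) = (\<integral>\<omega>. (X \<omega> \<bullet> x) *\<^sub>R Y \<omega> + (X \<omega> \<bullet> y) *\<^sub>R Y \<omega> \<partial>M)"
    by (simp add: cross_cov_def inner_add_right scaleR_add_left)
  then show "cross_cov M X Y (x + y) = cross_cov M X Y x + cross_cov M X Y y"
    using integrable_inner_scaleR[OF X Y] by (simp add: cross_cov_def)
  have "cross_cov M X Y (c *\<^sub>R x) = (\<integral>\<omega>. c *\<^sub>R ((X \<omega> \<bullet> x) *\<^sub>R Y \<omega>) \<partial>M)"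
    by (simp add: cross_cov_def)
  then show "cross_cov M X Y (c *\<^sub>R x) = c *\<^sub>R cross_cov M X Y x"
    unfolding cross_cov_def by (simp only: integral_scaleR_right)
qed

lemma norm_cross_cov_le:
  assumes X: "second_order M T X" and Y: "second_order M T Y"
  shows "norm (cross_cov M X Y x) \<le> norm x * (\<integral>\<omega>. norm (X \<omega>) * norm (Y \<omega>) \<partial>M)"
proof -
  have "norm (cross_cov M X Y x) \<le> (\<integral>\<omega>. norm ((X \<omega> \<bullet> x) *\<^sub>R Y \<omega>) \<partial>M)"
    unfolding cross_cov_def by (rule integral_norm_bound)
  also have "\<dots> \<le> (\<integral>\<omega>. norm x * (norm (X \<omega>) * norm (Y \<omega>)) \<partial>M)"
  proof (rule integral_mono)
    show "integrable M (\<lambda>\<omega>. norm ((X \<omega> \<bullet> x) *\<^sub>R Y \<omega>))"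
      by (intro integrable_norm integrable_inner_scaleR[OF X Y])
    show "integrable M (\<lambda>\<omega>. norm x * (norm (X \<omega>) * norm (Y \<omega>)))"
      by (intro integrable_mult_right integrable_norm_mult[OF X Y])
    show "norm ((X \<omega> \<bullet> x) *\<^sub>R Y \<omega>) \<le> norm x * (norm (X \<omega>) * norm (Y \<omega>))" for \<omega>
      by (rule norm_inner_scaleR_le)
  qed
  finally show ?thesis by simp
qed

lemma cross_cov_in_L2_on: "second_order M T Y \<Longrightarrow> cross_cov M X Y x \<in> L2_on T"
  unfolding cross_cov_def
  by (rule integral_in_L2_on) (auto simp: second_order_def intro: subspace_scale[OF subspace_L2_on])

section \<open>Compactness of covariance operators\<close>

lemma compact_box_combinations:
  fixes Y :: "'a::real_normed_vector set"
  assumes "finite Y"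
  shows "\<exists>K. compact K \<and> (\<forall>c. (\<forall>y\<in>Y. \<bar>c y\<bar> \<le> B) \<longrightarrow> (\<Sum>y\<in>Y. c y *\<^sub>R y) \<in> K)"
  using assms
proof induction
  case empty
  show ?case by (rule exI[of _ "{0}"]) simp
next
  case (insert y Y)
  then obtain K where K: "compact K" "\<And>c. \<forall>y\<in>Y. \<bar>c y\<bar> \<le> B \<Longrightarrow> (\<Sum>y\<in>Y. c y *\<^sub>R y) \<in> K" by blast
  let ?f = "\<lambda>p. fst p *\<^sub>R y + snd p"
  have "compact (?f ` ({-B..B} \<times> K))"
    by (intro compact_continuous_image compact_Times K compact_Icc continuous_intros)
  moreover have "(\<Sum>z\<in>insert y Y. c z *\<^sub>R z) \<in> ?f ` ({-B..B} \<times> K)" if "\<forall>z\<in>insert y Y. \<bar>c z\<bar> \<le> B" for c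
    using insert that K(2)[of c] by (intro image_eqI[of _ _ "(c y, \<Sum>z\<in>Y. c z *\<^sub>R z)"]) (auto simp: abs_le_iff)
  ultimately show ?case by blast
qed

lemma convergent_subsequence_if_totally_bounded:
  fixes v :: "nat \<Rightarrow> 'a::banach"
  assumes "\<And>e. 0 < e \<Longrightarrow> \<exists>F. finite F \<and> range v \<subseteq> (\<Union>x\<in>F. ball x e)"
  shows "\<exists>l r. strict_mono (r :: nat \<Rightarrow> nat) \<and> (\<lambda>n. v (r n)) \<longlonglongrightarrow> l"
proof -
  have "compact (closure (range v))"
    unfolding compact_eq_totally_bounded
  proof (intro conjI allI impI)
    show "Topological_Spaces.complete (closure (range v))" by (simp add: complete_eq_closed)
    fix e :: real assume "0 < e"
    then obtain F where F: "finite F" "range v \<subseteq> (\<Union>x\<in>F. ball x (e / 2))"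
      using assms[of "e / 2"] by auto
    have "range v \<subseteq> (\<Union>x\<in>F. cball x (e / 2))" using F(2) ball_subset_cball by blast
    then have "closure (range v) \<subseteq> (\<Union>x\<in>F. cball x (e / 2))"
      by (rule closure_minimal) (use F(1) in auto)
    also have "\<dots> \<subseteq> (\<Union>x\<in>F. ball x e)"
      using \<open>0 < e\<close> by (intro UN_mono) auto
    finally show "\<exists>F. finite F \<and> closure (range v) \<subseteq> (\<Union>x\<in>F. ball x e)"
      using F(1) by (intro exI[of _ F]) simp
  qed
  moreover have "v n \<in> closure (range v)" for n by (rule subsetD[OF closure_subset]) simp
  ultimately obtain l and r :: "nat \<Rightarrow> nat" where "strict_mono r" "(v \<circ> r) \<longlonglongrightarrow> l"
    unfolding compact_def by blast
  then show ?thesis by (auto simp: o_def)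
qed

text \<open>
  Replacing \<open>Y\<close> by a simple random variable \<open>F i\<close> gives an operator of finite rank, which maps bounded
  sets into compact sets.  The error has norm at most \<open>E[\<parallel>X\<parallel> \<parallel>Y - F i\<parallel>]\<close>, which tends to 0 by dominated
  convergence.  So the image of a bounded set is within every \<open>e > 0\<close> of a compact set, and hence totally
  bounded.
\<close>

lemma cross_cov_compact:
  assumes M: "prob_space M" and X: "second_order M T X" and Y: "second_order M T Y"
    and u: "bounded (range u)"
  shows "\<exists>l r. strict_mono (r :: nat \<Rightarrow> nat) \<and> (\<lambda>n. cross_cov M X Y (u (r n))) \<longlonglongrightarrow> l"
proof (rule convergent_subsequence_if_totally_bounded)
  fix e :: real assume e: "0 < e"
  interpret prob_space M by fact
  have [measurable]: "X \<in> borel_measurable M" "Y \<in> borel_measurable M"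
    using X Y by (auto simp: second_order_def)
  obtain b where b: "0 < b" "\<And>n. norm (u n) \<le> b" using u by (auto simp: bounded_pos)
  from borel_measurable_implies_sequence_metric[OF \<open>Y \<in> borel_measurable M\<close>, of 0]
  obtain F where F': "\<forall>i. simple_function M (F i)" "\<forall>\<omega>\<in>space M. (\<lambda>i. F i \<omega>) \<longlonglongrightarrow> Y \<omega>"
    "\<forall>i. \<forall>\<omega>\<in>space M. dist (F i \<omega>) 0 \<le> 2 * dist (Y \<omega>) 0" by blast
  have F: "\<And>i. simple_function M (F i)" "\<And>\<omega>. \<omega> \<in> space M \<Longrightarrow> (\<lambda>i. F i \<omega>) \<longlonglongrightarrow> Y \<omega>"
    "\<And>i \<omega>. \<omega> \<in> space M \<Longrightarrow> dist (F i \<omega>) 0 \<le> 2 * dist (Y \<omega>) 0" using F' by blast+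
  have [measurable]: "F i \<in> borel_measurable M" for i
    using F(1) by (rule borel_measurable_simple_function)
  have dom: "norm (X \<omega>) * norm (Y \<omega> - F i \<omega>) \<le> 3 * (norm (X \<omega>) * norm (Y \<omega>))" if "\<omega> \<in> space M" for i \<omega>
  proof -
    have "norm (Y \<omega> - F i \<omega>) \<le> 3 * norm (Y \<omega>)"
      using F(3)[OF that, of i] norm_triangle_ineq4[of "Y \<omega>" "F i \<omega>"] by simp
    from mult_left_mono[OF this norm_ge_zero[of "X \<omega>"]] show ?thesis by (simp only: ac_simps)
  qed
  have "(\<lambda>i. \<integral>\<omega>. norm (X \<omega>) * norm (Y \<omega> - F i \<omega>) \<partial>M) \<longlonglongrightarrow> (\<integral>\<omega>. 0 \<partial>M)"
  proof (rule integral_dominated_convergence[where w = "\<lambda>\<omega>. 3 * (norm (X \<omega>) * norm (Y \<omega>))"])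
    show "integrable M (\<lambda>\<omega>. 3 * (norm (X \<omega>) * norm (Y \<omega>)))"
      by (intro integrable_mult_right integrable_norm_mult[OF X Y])
    show "AE \<omega> in M. (\<lambda>i. norm (X \<omega>) * norm (Y \<omega> - F i \<omega>)) \<longlonglongrightarrow> 0"
    proof (intro AE_I2)
      fix \<omega> assume "\<omega> \<in> space M"
      from tendsto_mult[OF tendsto_const tendsto_norm[OF tendsto_diff[OF tendsto_const F(2)[OF this]]], of "norm (X \<omega>)" "Y \<omega>"]
      show "(\<lambda>i. norm (X \<omega>) * norm (Y \<omega> - F i \<omega>)) \<longlonglongrightarrow> 0" by simp
    qed
    show "AE \<omega> in M. norm (norm (X \<omega>) * norm (Y \<omega> - F i \<omega>)) \<le> 3 * (norm (X \<omega>) * norm (Y \<omega>))" for i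
      using dom by (intro AE_I2) simp
  qed measurable
  then have "\<forall>\<^sub>F i in sequentially. (\<integral>\<omega>. norm (X \<omega>) * norm (Y \<omega> - F i \<omega>) \<partial>M) < e / (2 * b)"
    using e b(1) by (intro order_tendstoD) auto
  then obtain i where i: "(\<integral>\<omega>. norm (X \<omega>) * norm (Y \<omega> - F i \<omega>) \<partial>M) < e / (2 * b)"
    by (auto simp: eventually_sequentially)
  let ?S = "F i ` space M"
  have fin: "finite ?S" using F(1)[of i] by (simp add: simple_function_def)
  have sets [measurable]: "F i -` {y} \<inter> space M \<in> sets M" for y by measurable
  have intX: "integrable M (\<lambda>\<omega>. norm (X \<omega>))"
  proof (rule Bochner_Integration.integrable_bound)
    show "integrable M (\<lambda>\<omega>. 1 + (norm (X \<omega>))\<^sup>2)" using X by (auto simp: second_order_def)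
    have "a \<le> 1 + a\<^sup>2" for a :: real using zero_le_power2[of "a - 1 / 2"] by (simp add: power2_eq_square algebra_simps)
    then show "AE \<omega> in M. norm (norm (X \<omega>)) \<le> norm (1 + (norm (X \<omega>))\<^sup>2)" by (intro AE_I2) simp
  qed measurable
  define c where "c x y = (\<integral>\<omega>. (X \<omega> \<bullet> x) * indicator (F i -` {y} \<inter> space M) \<omega> \<partial>M)" for x y
  have int_c: "integrable M (\<lambda>\<omega>. (X \<omega> \<bullet> x) * indicator (F i -` {y} \<inter> space M) \<omega>)"
    and c_le: "\<bar>c x y\<bar> \<le> norm x * (\<integral>\<omega>. norm (X \<omega>) \<partial>M)" for x y
  proof -
    have pw: "\<bar>(X \<omega> \<bullet> x) * indicator (F i -` {y} \<inter> space M) \<omega>\<bar> \<le> norm x * norm (X \<omega>)" for \<omega>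
      using Cauchy_Schwarz_ineq2[of "X \<omega>" x] by (auto simp: indicator_def abs_mult mult.commute)
    have int: "integrable M (\<lambda>\<omega>. norm x * norm (X \<omega>))" using intX by simp
    show I: "integrable M (\<lambda>\<omega>. (X \<omega> \<bullet> x) * indicator (F i -` {y} \<inter> space M) \<omega>)"
    proof (rule Bochner_Integration.integrable_bound[OF int])
      show "AE \<omega> in M. norm ((X \<omega> \<bullet> x) * indicator (F i -` {y} \<inter> space M) \<omega>) \<le> norm (norm x * norm (X \<omega>))"
        unfolding real_norm_def by (intro AE_I2 order_trans[OF pw abs_ge_self])
    qed measurable
    have "\<bar>c x y\<bar> \<le> (\<integral>\<omega>. \<bar>(X \<omega> \<bullet> x) * indicator (F i -` {y} \<inter> space M) \<omega>\<bar> \<partial>M)"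
      unfolding c_def by (rule integral_abs_bound)
    also have "\<dots> \<le> (\<integral>\<omega>. norm x * norm (X \<omega>) \<partial>M)"
      by (intro integral_mono integrable_abs I int pw)
    finally show "\<bar>c x y\<bar> \<le> norm x * (\<integral>\<omega>. norm (X \<omega>) \<partial>M)" by simp
  qed
  (* the operator of finite rank that approximates cross_cov M X Y *)
  define A where "A x = (\<Sum>y\<in>?S. c x y *\<^sub>R y)" for x
  have step: "(X \<omega> \<bullet> x) *\<^sub>R F i \<omega> = (\<Sum>y\<in>?S. ((X \<omega> \<bullet> x) * indicator (F i -` {y} \<inter> space M) \<omega>) *\<^sub>R y)"
    if "\<omega> \<in> space M" for \<omega> x
  proof -
    have "(\<Sum>y\<in>?S. ((X \<omega> \<bullet> x) * indicator (F i -` {y} \<inter> space M) \<omega>) *\<^sub>R y)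
        = (\<Sum>y\<in>?S. if y = F i \<omega> then (X \<omega> \<bullet> x) *\<^sub>R F i \<omega> else 0)"
      by (rule sum.cong) (use that in \<open>auto simp: indicator_def\<close>)
    then show ?thesis using fin that by simp
  qed
  have int_F: "integrable M (\<lambda>\<omega>. (X \<omega> \<bullet> x) *\<^sub>R F i \<omega>)" and A_eq: "(\<integral>\<omega>. (X \<omega> \<bullet> x) *\<^sub>R F i \<omega> \<partial>M) = A x" for x
  proof -
    have I: "integrable M (\<lambda>\<omega>. \<Sum>y\<in>?S. ((X \<omega> \<bullet> x) * indicator (F i -` {y} \<inter> space M) \<omega>) *\<^sub>R y)"
      by (intro Bochner_Integration.integrable_sum integrable_scaleR_left int_c)
    show "integrable M (\<lambda>\<omega>. (X \<omega> \<bullet> x) *\<^sub>R F i \<omega>)"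
      using I by (rule Bochner_Integration.integrable_cong[THEN iffD1, rotated -1]) (use step in auto)
    have "(\<integral>\<omega>. (X \<omega> \<bullet> x) *\<^sub>R F i \<omega> \<partial>M) = (\<integral>\<omega>. (\<Sum>y\<in>?S. ((X \<omega> \<bullet> x) * indicator (F i -` {y} \<inter> space M) \<omega>) *\<^sub>R y) \<partial>M)"
      by (rule Bochner_Integration.integral_cong) (use step in auto)
    also have "\<dots> = A x"
      unfolding A_def c_def using int_c
      by (subst Bochner_Integration.integral_sum) (auto intro!: integrable_scaleR_left sum.cong)
    finally show "(\<integral>\<omega>. (X \<omega> \<bullet> x) *\<^sub>R F i \<omega> \<partial>M) = A x" .
  qed
  have close: "norm (cross_cov M X Y (u n) - A (u n)) < e / 2" for n
  proof -
    let ?x = "u n"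
    have "cross_cov M X Y ?x - A ?x = (\<integral>\<omega>. (X \<omega> \<bullet> ?x) *\<^sub>R (Y \<omega> - F i \<omega>) \<partial>M)"
      using integrable_inner_scaleR[OF X Y] int_F
      by (simp add: cross_cov_def A_eq[symmetric] scaleR_diff_right)
    also have "norm \<dots> \<le> (\<integral>\<omega>. norm ((X \<omega> \<bullet> ?x) *\<^sub>R (Y \<omega> - F i \<omega>)) \<partial>M)"
      by (rule integral_norm_bound)
    also have "\<dots> \<le> (\<integral>\<omega>. b * (norm (X \<omega>) * norm (Y \<omega> - F i \<omega>)) \<partial>M)"
    proof (rule integral_mono)
      show "integrable M (\<lambda>\<omega>. norm ((X \<omega> \<bullet> ?x) *\<^sub>R (Y \<omega> - F i \<omega>)))"
        unfolding scaleR_diff_right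
        by (intro integrable_norm Bochner_Integration.integrable_diff integrable_inner_scaleR[OF X Y] int_F)
      show "integrable M (\<lambda>\<omega>. b * (norm (X \<omega>) * norm (Y \<omega> - F i \<omega>)))"
      proof (rule integrable_mult_right, rule Bochner_Integration.integrable_bound)
        show "integrable M (\<lambda>\<omega>. 3 * (norm (X \<omega>) * norm (Y \<omega>)))"
          by (intro integrable_mult_right integrable_norm_mult[OF X Y])
        show "AE \<omega> in M. norm (norm (X \<omega>) * norm (Y \<omega> - F i \<omega>)) \<le> norm (3 * (norm (X \<omega>) * norm (Y \<omega>)))"
          using dom by (intro AE_I2) simp
      qed measurable
      fix \<omega>
      have "\<bar>X \<omega> \<bullet> ?x\<bar> \<le> b * norm (X \<omega>)"
        using Cauchy_Schwarz_ineq2[of "X \<omega>" ?x] mult_left_mono[OF b(2)[of n], of "norm (X \<omega>)"] by (simp add: mult.commute)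
      from mult_right_mono[OF this, of "norm (Y \<omega> - F i \<omega>)"]
      show "norm ((X \<omega> \<bullet> ?x) *\<^sub>R (Y \<omega> - F i \<omega>)) \<le> b * (norm (X \<omega>) * norm (Y \<omega> - F i \<omega>))" by (simp add: ac_simps)
    qed
    also have "\<dots> < b * (e / (2 * b))" unfolding integral_mult_right_zero using i b(1) by (rule mult_strict_left_mono)
    also have "\<dots> = e / 2" using b(1) by simp
    finally show ?thesis .
  qed
  obtain K where K: "compact K" "\<And>c. (\<forall>y\<in>?S. \<bar>c y\<bar> \<le> b * (\<integral>\<omega>. norm (X \<omega>) \<partial>M)) \<Longrightarrow> (\<Sum>y\<in>?S. c y *\<^sub>R y) \<in> K"
    using compact_box_combinations[OF fin] by blast
  have AK: "A (u n) \<in> K" for n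
    unfolding A_def
  proof (intro K(2) ballI)
    fix y
    have "norm (u n) * (\<integral>\<omega>. norm (X \<omega>) \<partial>M) \<le> b * (\<integral>\<omega>. norm (X \<omega>) \<partial>M)"
      by (intro mult_right_mono b) simp
    then show "\<bar>c (u n) y\<bar> \<le> b * (\<integral>\<omega>. norm (X \<omega>) \<partial>M)" using c_le[of "u n" y] by linarith
  qed
  have "\<exists>k. finite k \<and> K \<subseteq> (\<Union>x\<in>k. ball x (e / 2))"
    using K(1) e unfolding compact_eq_totally_bounded by simp
  then obtain k where k: "finite k" "K \<subseteq> (\<Union>x\<in>k. ball x (e / 2))" by blast
  have "cross_cov M X Y (u n) \<in> (\<Union>x\<in>k. ball x e)" for n
  proof -
    obtain x where x: "x \<in> k" "dist x (A (u n)) < e / 2" using AK[of n] k(2) by auto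
    have "dist (A (u n)) (cross_cov M X Y (u n)) < e / 2" using close[of n] by (simp add: dist_norm norm_minus_commute)
    then have "dist x (cross_cov M X Y (u n)) < e" using x(2) dist_triangle[of x "cross_cov M X Y (u n)" "A (u n)"] by linarith
    then show ?thesis using x(1) by auto
  qed
  then show "\<exists>F. finite F \<and> range (\<lambda>n. cross_cov M X Y (u n)) \<subseteq> (\<Union>x\<in>F. ball x e)"
    using k(1) by blast
qed

section \<open>The mean squared error of reduced-rank predictors\<close>

text \<open>
  The normalisation makes the random variables \<open>b i \<bullet> X\<close> orthonormal in the space of square-integrable
  random variables, so the quadratic term reduces to \<open>\<Sum>i. \<parallel>a i\<parallel>\<^sup>2\<close>; then the square is completed.
\<close>

lemma rr_mse_orthonormal:
  assumes X: "second_order M T X" and Y: "second_order M T Y"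
    and b: "orthonormal_wrt (cross_cov M X X) n b"
  shows "rr_mse M X Y n a b = (\<integral>\<omega>. (norm (Y \<omega>))\<^sup>2 \<partial>M) +
    ((\<Sum>i=1..n. (norm (a i - cross_cov M X Y (b i)))\<^sup>2) - (\<Sum>i=1..n. (norm (cross_cov M X Y (b i)))\<^sup>2))"
proof -
  let ?c = "\<lambda>i \<omega>. X \<omega> \<bullet> b i"
  have pw: "(norm (Y \<omega> - (\<Sum>i=1..n. (b i \<bullet> X \<omega>) *\<^sub>R a i)))\<^sup>2 = (norm (Y \<omega>))\<^sup>2
      - 2 * (\<Sum>i=1..n. ?c i \<omega> * (Y \<omega> \<bullet> a i)) + (\<Sum>i=1..n. \<Sum>j=1..n. (?c i \<omega> * ?c j \<omega>) * (a i \<bullet> a j))" for \<omega>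
  proof -
    let ?p = "\<Sum>i=1..n. (b i \<bullet> X \<omega>) *\<^sub>R a i"
    have "(norm (Y \<omega> - ?p))\<^sup>2 = (norm (Y \<omega>))\<^sup>2 - 2 * (Y \<omega> \<bullet> ?p) + ?p \<bullet> ?p"
      by (simp add: power2_norm_eq_inner inner_diff_left inner_diff_right inner_commute)
    moreover have "Y \<omega> \<bullet> ?p = (\<Sum>i=1..n. ?c i \<omega> * (Y \<omega> \<bullet> a i))"
      by (simp add: inner_sum_right inner_commute[of "b _"])
    moreover have "?p \<bullet> ?p = (\<Sum>i=1..n. \<Sum>j=1..n. (?c i \<omega> * ?c j \<omega>) * (a i \<bullet> a j))"
      unfolding inner_sum_left unfolding inner_sum_right by (simp add: inner_commute[of "b _"] mult.assoc mult.left_commute)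
    ultimately show ?thesis by simp
  qed
  have intY: "integrable M (\<lambda>\<omega>. (norm (Y \<omega>))\<^sup>2)" using Y by (simp add: second_order_def)
  have XX: "(\<integral>\<omega>. ?c i \<omega> * ?c j \<omega> \<partial>M) = (if i = j then 1 else 0)" if "i \<in> {1..n}" "j \<in> {1..n}" for i j
    using b that cross_cov_inner[OF X X, of "b j" "b i"] unfolding orthonormal_wrt_def
    by (simp add: inner_commute[of _ "b i"] mult.commute)
  have "rr_mse M X Y n a b = (\<integral>\<omega>. (norm (Y \<omega>))\<^sup>2 \<partial>M)
      - 2 * (\<Sum>i=1..n. \<integral>\<omega>. ?c i \<omega> * (Y \<omega> \<bullet> a i) \<partial>M)
      + (\<Sum>i=1..n. \<Sum>j=1..n. (\<integral>\<omega>. ?c i \<omega> * ?c j \<omega> \<partial>M) * (a i \<bullet> a j))"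
    unfolding rr_mse_def pw
    by (simp add: intY integrable_inner_mult[OF X Y] integrable_inner_mult[OF X X])
  also have "(\<Sum>i=1..n. \<Sum>j=1..n. (\<integral>\<omega>. ?c i \<omega> * ?c j \<omega> \<partial>M) * (a i \<bullet> a j)) = (\<Sum>i=1..n. a i \<bullet> a i)"
  proof (rule sum.cong[OF refl])
    fix i assume i: "i \<in> {1..n}"
    have "(\<Sum>j=1..n. (\<integral>\<omega>. ?c i \<omega> * ?c j \<omega> \<partial>M) * (a i \<bullet> a j)) = (\<Sum>j=1..n. if j = i then a i \<bullet> a i else 0)"
      by (rule sum.cong[OF refl]) (simp add: XX[OF i])
    also have "\<dots> = a i \<bullet> a i" using i by simp
    finally show "(\<Sum>j=1..n. (\<integral>\<omega>. ?c i \<omega> * ?c j \<omega> \<partial>M) * (a i \<bullet> a j)) = a i \<bullet> a i" .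
  qed
  also have "(\<Sum>i=1..n. \<integral>\<omega>. ?c i \<omega> * (Y \<omega> \<bullet> a i) \<partial>M) = (\<Sum>i=1..n. cross_cov M X Y (b i) \<bullet> a i)"
    by (simp only: cross_cov_inner[OF X Y])
  also have "(\<Sum>i=1..n. a i \<bullet> a i) = 2 * (\<Sum>i=1..n. cross_cov M X Y (b i) \<bullet> a i)
      + ((\<Sum>i=1..n. (norm (a i - cross_cov M X Y (b i)))\<^sup>2) - (\<Sum>i=1..n. (norm (cross_cov M X Y (b i)))\<^sup>2))"
    by (simp add: power2_norm_eq_inner inner_diff_left inner_diff_right inner_commute sum_distrib_left
        flip: sum.distrib sum_subtractf)
  finally show ?thesis by simp
qed

section \<open>Hilbert-Schmidt integral operators\<close>

definition zero_extension :: "real \<Rightarrow> (real \<Rightarrow> real \<Rightarrow> real) \<Rightarrow> real \<times> real \<Rightarrow> real" where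
  "zero_extension T \<kappa> = (\<lambda>(s, u). indicator {0..T} s * indicator {0..T} u * \<kappa> s u)"

lemma zero_extension_square_integrable:
  assumes "hilbert_schmidt_kernel T \<kappa>"
  shows "zero_extension T \<kappa> \<in> borel_measurable (lborel \<Otimes>\<^sub>M lborel)"
    and "integrable (lborel \<Otimes>\<^sub>M lborel) (\<lambda>p. (zero_extension T \<kappa> p)\<^sup>2)"
proof -
  have "(\<lambda>p. indicator ({0..T} \<times> {0..T}) p *\<^sub>R (case p of (s, u) \<Rightarrow> \<kappa> s u)) = zero_extension T \<kappa>"
    by (auto simp: zero_extension_def indicator_def fun_eq_iff)
  then show "zero_extension T \<kappa> \<in> borel_measurable (lborel \<Otimes>\<^sub>M lborel)"
    using assms by (simp add: hilbert_schmidt_kernel_def set_borel_measurable_def)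
  have "(\<lambda>p. indicator ({0..T} \<times> {0..T}) p *\<^sub>R (case p of (s, u) \<Rightarrow> (\<kappa> s u)\<^sup>2)) = (\<lambda>p. (zero_extension T \<kappa> p)\<^sup>2)"
    by (auto simp: zero_extension_def indicator_def fun_eq_iff)
  then show "integrable (lborel \<Otimes>\<^sub>M lborel) (\<lambda>p. (zero_extension T \<kappa> p)\<^sup>2)"
    using assms by (simp add: hilbert_schmidt_kernel_def set_integrable_def)
qed

lemma hilbert_schmidt_kernel_transpose:
  assumes "hilbert_schmidt_kernel T \<kappa>"
  shows "hilbert_schmidt_kernel T (\<lambda>s u. \<kappa> u s)"
proof -
  let ?K = "zero_extension T \<kappa>"
  have swap: "(\<lambda>p. indicator ({0..T} \<times> {0..T}) p *\<^sub>R (case p of (s, u) \<Rightarrow> \<kappa> u s)) = (\<lambda>(s, u). ?K (u, s))"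
    by (auto simp: zero_extension_def indicator_def fun_eq_iff)
  have swap2: "(\<lambda>p. indicator ({0..T} \<times> {0..T}) p *\<^sub>R (case p of (s, u) \<Rightarrow> (\<kappa> u s)\<^sup>2)) = (\<lambda>(s, u). (?K (u, s))\<^sup>2)"
    by (auto simp: zero_extension_def indicator_def fun_eq_iff)
  show ?thesis
    unfolding hilbert_schmidt_kernel_def set_borel_measurable_def set_integrable_def swap swap2
    using measurable_pair_swap[OF zero_extension_square_integrable(1)[OF assms]]
      lborel_pair.integrable_product_swap[OF zero_extension_square_integrable(2)[OF assms]]
    by simp
qed

lemma integral_operator_eq:
  "integral_operator T \<kappa> x = abs_L2 (\<lambda>s. \<integral>u. zero_extension T \<kappa> (s, u) * rep_L2 x u \<partial>lborel)"
  by (simp add: integral_operator_def set_lebesgue_integral_def zero_extension_def ac_simps flip: integral_mult_right_zero)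

text \<open>
  For almost every \<open>s\<close> the section of the kernel at \<open>s\<close> is square-integrable.  There the integral is an
  inner product in \<open>L2\<close> and the Cauchy-Schwarz inequality bounds it.  At the remaining points the integral
  has a default value, which is immaterial.
\<close>

lemma sq_integrable_integral_operator:
  assumes \<kappa>: "hilbert_schmidt_kernel T \<kappa>"
  shows "sq_integrable (\<lambda>s. \<integral>u. zero_extension T \<kappa> (s, u) * rep_L2 x u \<partial>lborel)"
proof -
  let ?K = "zero_extension T \<kappa>"
  let ?\<phi> = "\<lambda>s. \<integral>u. ?K (s, u) * rep_L2 x u \<partial>lborel"
  note K = zero_extension_square_integrable[OF \<kappa>]
  note [measurable] = K(1)
  have meas: "?\<phi> \<in> borel_measurable lborel" by measurable
  have "integrable lborel (\<lambda>s. (?\<phi> s)\<^sup>2)"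
  proof (rule Bochner_Integration.integrable_bound)
    show "integrable lborel (\<lambda>s. (\<integral>u. (?K (s, u))\<^sup>2 \<partial>lborel) * (norm x)\<^sup>2)"
      by (intro integrable_mult_left lborel_pair.integrable_fst' K(2))
    show "AE s in lborel. norm ((?\<phi> s)\<^sup>2) \<le> norm ((\<integral>u. (?K (s, u))\<^sup>2 \<partial>lborel) * (norm x)\<^sup>2)"
      using lborel_pair.AE_integrable_fst'[OF K(2)]
    proof eventually_elim
      fix s assume "integrable lborel (\<lambda>u. (?K (s, u))\<^sup>2)"
      then have sq: "sq_integrable (\<lambda>u. ?K (s, u))" by (simp add: sq_integrable_def)
      have "?\<phi> s = abs_L2 (\<lambda>u. ?K (s, u)) \<bullet> x"
        using inner_abs_L2[OF sq sq_integrable_rep[of x]] by (simp add: abs_rep_L2)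
      then have "(?\<phi> s)\<^sup>2 \<le> (norm (abs_L2 (\<lambda>u. ?K (s, u))))\<^sup>2 * (norm x)\<^sup>2"
        using Cauchy_Schwarz_ineq[of "abs_L2 (\<lambda>u. ?K (s, u))" x] by (simp add: power2_norm_eq_inner)
      then show "norm ((?\<phi> s)\<^sup>2) \<le> norm ((\<integral>u. (?K (s, u))\<^sup>2 \<partial>lborel) * (norm x)\<^sup>2)"
        by (simp add: norm_abs_L2_sq[OF sq])
    qed
  qed (use meas in measurable)
  with meas show ?thesis by (simp add: sq_integrable_def)
qed

lemma integral_operator_in_L2_on:
  assumes "hilbert_schmidt_kernel T \<kappa>"
  shows "integral_operator T \<kappa> x \<in> L2_on T"
proof -
  have "AE s in lborel. rep_L2 (integral_operator T \<kappa> x) s = (\<integral>u. zero_extension T \<kappa> (s, u) * rep_L2 x u \<partial>lborel)"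
    unfolding integral_operator_eq
    by (rule rep_abs_L2[OF sq_integrable_integral_operator[OF assms]])
  then show ?thesis
    unfolding L2_on_def by (auto elim!: eventually_mono simp: zero_extension_def)
qed

text \<open>
  This is Fubini's theorem; the integrand is dominated by the sum of the squared kernel and the square
  of the tensor product of \<open>x\<close> and \<open>y\<close>.
\<close>

lemma integral_operator_adjoint:
  assumes \<kappa>: "hilbert_schmidt_kernel T \<kappa>"
  shows "integral_operator T \<kappa> x \<bullet> y = x \<bullet> integral_operator T (\<lambda>s u. \<kappa> u s) y"
proof -
  let ?K = "zero_extension T \<kappa>" and ?f = "rep_L2 x" and ?g = "rep_L2 y"
  note K = zero_extension_square_integrable[OF \<kappa>]
  note [measurable] = K(1)
  have "integrable (lborel \<Otimes>\<^sub>M lborel) (\<lambda>(s, u). ?K (s, u) * ?f u * ?g s)"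
  proof (rule Bochner_Integration.integrable_bound)
    have "integrable (lborel \<Otimes>\<^sub>M lborel) (\<lambda>(s, u). (?g s)\<^sup>2 * (?f u)\<^sup>2)"
    proof (rule lborel_pair.Fubini_integrable)
      have I: "integrable lborel (\<lambda>s. (rep_L2 z s)\<^sup>2)" for z
        using sq_integrable_rep[of z] by (simp add: sq_integrable_def)
      show "integrable lborel (\<lambda>s. \<integral>u. norm (case (s, u) of (s, u) \<Rightarrow> (?g s)\<^sup>2 * (?f u)\<^sup>2) \<partial>lborel)"
        using I by (simp add: abs_mult)
      show "AE s in lborel. integrable lborel (\<lambda>u. case (s, u) of (s, u) \<Rightarrow> (?g s)\<^sup>2 * (?f u)\<^sup>2)"
        using I by simp
    qed measurable
    then show "integrable (lborel \<Otimes>\<^sub>M lborel) (\<lambda>p. (?K p)\<^sup>2 + (case p of (s, u) \<Rightarrow> (?g s)\<^sup>2 * (?f u)\<^sup>2))"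
      using K(2) by (rule Bochner_Integration.integrable_add[rotated])
    (* for a value a of the kernel and values c, d of the two functions *)
    have "\<bar>a * c * d\<bar> \<le> a\<^sup>2 + d\<^sup>2 * c\<^sup>2" for a c d :: real
    proof -
      have "2 * \<bar>a\<bar> * \<bar>c * d\<bar> \<le> \<bar>a\<bar>\<^sup>2 + \<bar>c * d\<bar>\<^sup>2" by (rule sum_squares_bound)
      moreover have "0 \<le> \<bar>a\<bar> * \<bar>c * d\<bar>" by simp
      moreover have "\<bar>a * c * d\<bar> = \<bar>a\<bar> * \<bar>c * d\<bar>" by (simp add: abs_mult)
      moreover have "\<bar>c * d\<bar>\<^sup>2 = d\<^sup>2 * c\<^sup>2" by (simp add: power_mult_distrib)
      ultimately show ?thesis by simp
    qed
    then show "AE p in lborel \<Otimes>\<^sub>M lborel. norm (case p of (s, u) \<Rightarrow> ?K (s, u) * ?f u * ?g s)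
        \<le> norm ((?K p)\<^sup>2 + (case p of (s, u) \<Rightarrow> (?g s)\<^sup>2 * (?f u)\<^sup>2))"
      by (intro AE_I2) (auto simp: split_beta)
  qed measurable
  from lborel_pair.Fubini_integral[OF this]
  have fubini: "(\<integral>u. \<integral>s. ?K (s, u) * ?f u * ?g s \<partial>lborel \<partial>lborel) = (\<integral>s. \<integral>u. ?K (s, u) * ?f u * ?g s \<partial>lborel \<partial>lborel)" .
  have tr: "zero_extension T (\<lambda>s u. \<kappa> u s) (u, s) = ?K (s, u)" for s u
    by (simp add: zero_extension_def)
  have "integral_operator T \<kappa> x \<bullet> y = (\<integral>s. (\<integral>u. ?K (s, u) * ?f u \<partial>lborel) * ?g s \<partial>lborel)"
    using inner_abs_L2[OF sq_integrable_integral_operator[OF \<kappa>, of x] sq_integrable_rep[of y]]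
    by (simp add: abs_rep_L2 integral_operator_eq)
  also have "\<dots> = (\<integral>u. \<integral>s. ?K (s, u) * ?f u * ?g s \<partial>lborel \<partial>lborel)"
    unfolding fubini by simp
  also have "\<dots> = (\<integral>u. ?f u * (\<integral>s. ?K (s, u) * ?g s \<partial>lborel) \<partial>lborel)"
    by (simp add: mult.commute[of "?K _"] mult.assoc)
  also have "\<dots> = x \<bullet> integral_operator T (\<lambda>s u. \<kappa> u s) y"
    using inner_abs_L2[OF sq_integrable_rep[of x] sq_integrable_integral_operator[OF hilbert_schmidt_kernel_transpose[OF \<kappa>], of y]]
    by (simp add: abs_rep_L2 integral_operator_eq tr)
  finally show ?thesis .
qed

section \<open>Prediction of a functional autoregression\<close>

text \<open>
  The role of \<open>\<rho>X\<close> is played by \<open>Z = Y - \<epsilon>\<close>, which is visibly a second-order random variable and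
  equals \<open>\<rho>X\<close> almost surely.  Since the noise is uncorrelated with \<open>X\<close>, the operator \<open>C\<close> is also the
  cross-covariance of \<open>X\<close> and \<open>Z\<close>.  The identity \<open>Z \<bullet> y = X \<bullet> R y\<close>, with the integral operator \<open>R\<close> of the
  transposed kernel, then yields \<open>C' = QR\<close>, and it identifies \<open>CR\<close> as the covariance operator of \<open>Z\<close>.
\<close>

lemma AR1_reduced_rank_prediction:
  assumes M: "prob_space M" and AR: "functional_AR1 M T \<delta> \<rho> f \<epsilon>" and t: "t \<in> time_grid \<delta>"
  shows "reduced_rank_prediction (L2_on T) (cross_cov M (f t) (f t)) (cross_cov M (f t) (f (t + \<delta>)))
    (adjoint (cross_cov M (f t) (f (t + \<delta>)))) (integral_operator T (\<lambda>s u. \<rho> u s)) M (f t) (f (t + \<delta>))"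
proof -
  define X where "X = f t"
  define Y where "Y = f (t + \<delta>)"
  define Z where "Z = (\<lambda>\<omega>. Y \<omega> - \<epsilon> t \<omega>)"
  let ?Q = "cross_cov M X X" and ?C = "cross_cov M X Y" and ?R = "integral_operator T (\<lambda>s u. \<rho> u s)"
  obtain n where n: "t = of_int n * \<delta>" using t by (auto simp: time_grid_def)
  have t': "t + \<delta> \<in> time_grid \<delta>"
    unfolding time_grid_def n by (rule image_eqI[of _ _ "n + 1"]) (simp_all add: algebra_simps)
  have \<rho>: "hilbert_schmidt_kernel T \<rho>" and \<rho>': "hilbert_schmidt_kernel T (\<lambda>s u. \<rho> u s)"
    using AR hilbert_schmidt_kernel_transpose by (auto simp: functional_AR1_def)
  have X: "second_order M T X" and Y: "second_order M T Y" and noise: "second_order M T (\<epsilon> t)"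
    using AR t t' by (auto simp: functional_AR1_def centred_weakly_stationary_def strong_white_noise_def X_def Y_def)
  have Z: "second_order M T Z" unfolding Z_def by (rule second_order_diff[OF Y noise])
  have [measurable]: "X \<in> borel_measurable M" "Z \<in> borel_measurable M"
    using X Z by (auto dest: second_order_measurable)
  have uncorrelated: "cross_cov M X (\<epsilon> t) x = 0" for x
    using AR t by (simp add: functional_AR1_def X_def)
  have C_Z: "?C = cross_cov M X Z"
  proof
    fix x
    have "cross_cov M X Z x = ?C x - cross_cov M X (\<epsilon> t) x"
      using integrable_inner_scaleR[OF X Y] integrable_inner_scaleR[OF X noise]
      by (simp add: cross_cov_def Z_def scaleR_diff_right)
    then show "?C x = cross_cov M X Z x" by (simp add: uncorrelated)
  qed
  have Z_R: "AE \<omega> in M. Z \<omega> \<bullet> y = X \<omega> \<bullet> ?R y" for y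
  proof -
    have "AE \<omega> in M. Y \<omega> = integral_operator T \<rho> (X \<omega>) + \<epsilon> t \<omega>"
      using AR t by (simp add: functional_AR1_def X_def Y_def)
    then show ?thesis
      by eventually_elim (simp add: Z_def integral_operator_adjoint[OF \<rho>])
  qed
  have Z_cov: "cross_cov M Z V y = cross_cov M X V (?R y)" if V: "second_order M T V" for V y
  proof -
    have [measurable]: "V \<in> borel_measurable M" using V by (rule second_order_measurable)
    show ?thesis
      unfolding cross_cov_def
    proof (rule integral_cong_AE)
      show "AE \<omega> in M. (Z \<omega> \<bullet> y) *\<^sub>R V \<omega> = (X \<omega> \<bullet> ?R y) *\<^sub>R V \<omega>"
        using Z_R[of y] by eventually_elim simp
    qed measurable
  qed
  have adj: "adjoint ?C = cross_cov M Z X"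
    unfolding C_Z by (rule adjoint_unique) (simp add: cross_cov_symmetric[OF X Z])
  have CR: "(\<lambda>x. ?C (?R x)) = cross_cov M Z Z"
    by (rule ext) (simp only: C_Z Z_cov[OF Z])
  have "factored_pencil (L2_on T) ?Q ?C (adjoint ?C) ?R"
  proof (rule factored_pencil.intro)
    show "subspace (L2_on T)" by (rule subspace_L2_on)
    show "linear ?Q" "linear ?C" by (rule linear_cross_cov[OF X X], rule linear_cross_cov[OF X Y])
    show "x \<bullet> ?Q y = y \<bullet> ?Q x" for x y
      using cross_cov_symmetric[OF X X, of y x] by (simp add: inner_commute)
    show "0 \<le> x \<bullet> ?Q x" for x
      by (simp add: inner_commute[of x] cross_cov_inner[OF X X])
    show "?C x \<bullet> y = x \<bullet> adjoint ?C y" for x y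
      unfolding adj unfolding C_Z by (rule cross_cov_symmetric[OF X Z])
    show "adjoint ?C y = ?Q (?R y)" for y unfolding adj by (rule Z_cov[OF X])
    show "?R y \<in> L2_on T" for y by (rule integral_operator_in_L2_on[OF \<rho>'])
    show "bounded_linear (\<lambda>x. ?C (?R x))"
      unfolding CR bounded_linear_def bounded_linear_axioms_def
      using linear_cross_cov[OF Z Z] norm_cross_cov_le[OF Z Z] by blast
    show "\<exists>l r. strict_mono r \<and> (\<lambda>n. ?C (?R (u (r n)))) \<longlonglongrightarrow> l" if "bounded (range u)" for u :: "nat \<Rightarrow> L2"
      using cross_cov_compact[OF M Z Z that] unfolding CR[THEN fun_cong, symmetric] .
  qed
  then have "reduced_rank_prediction (L2_on T) ?Q ?C (adjoint ?C) ?R M X Y"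
    by (rule reduced_rank_prediction.intro, unfold_locales)
      (auto simp: cross_cov_in_L2_on[OF Y] rr_mse_orthonormal[OF X Y])
  then show ?thesis by (simp only: X_def Y_def)
qed

theorem theorem2:
  fixes T \<delta> t :: real
    and M :: "'w measure"
    and \<rho> :: "real \<Rightarrow> real \<Rightarrow> real"
    and f \<epsilon> :: "real \<Rightarrow> 'w \<Rightarrow> L2"
    and k :: nat
    and H :: "L2 set"
    and \<Gamma>\<^sub>1\<^sub>1 \<Gamma>\<^sub>1\<^sub>2 \<Gamma>\<^sub>2\<^sub>1 :: "L2 \<Rightarrow> L2"
  assumes "T > 0" and "\<delta> > 0" and "k \<ge> 1"
    and "prob_space M"
    and "functional_AR1 M T \<delta> \<rho> f \<epsilon>"
    and "t \<in> time_grid \<delta>"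
    and "H = L2_on T"
    and "\<Gamma>\<^sub>1\<^sub>1 = cross_cov M (f t) (f t)"
    and "\<Gamma>\<^sub>1\<^sub>2 = cross_cov M (f t) (f (t + \<delta>))"
    and "\<Gamma>\<^sub>2\<^sub>1 = adjoint \<Gamma>\<^sub>1\<^sub>2"
    and "\<exists>a b. rr_feasible M H (f t) k a b"
  shows "\<exists>lam. leading_eigenvalues H (\<Gamma>\<^sub>2\<^sub>1 \<circ> \<Gamma>\<^sub>1\<^sub>2) \<Gamma>\<^sub>1\<^sub>1 k lam \<and>
    \<comment> \<open>(i)\<close>
    (\<exists>a b. rr_solution M H (f t) (f (t + \<delta>)) k a b) \<and>
    (\<forall>b. (\<exists>a. rr_solution M H (f t) (f (t + \<delta>)) k a b) \<longleftrightarrow>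
       (\<forall>i\<in>{1..k}. pencil_eigenvector H (\<Gamma>\<^sub>2\<^sub>1 \<circ> \<Gamma>\<^sub>1\<^sub>2) \<Gamma>\<^sub>1\<^sub>1 (lam i) (b i)) \<and> orthonormal_wrt \<Gamma>\<^sub>1\<^sub>1 k b) \<and>
    \<comment> \<open>(ii)\<close>
    (\<forall>a b. rr_solution M H (f t) (f (t + \<delta>)) k a b \<longrightarrow> (\<forall>i\<in>{1..k}. a i = \<Gamma>\<^sub>1\<^sub>2 (b i))) \<and>
    \<comment> \<open>(iii)\<close>
    (\<forall>b. (\<exists>a. rr_solution M H (f t) (f (t + \<delta>)) k a b) \<longleftrightarrow>
       (\<forall>i\<in>{1..k}. recursive_maximizer H (\<Gamma>\<^sub>2\<^sub>1 \<circ> \<Gamma>\<^sub>1\<^sub>2) \<Gamma>\<^sub>1\<^sub>1 b i (b i))) \<and>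
    \<comment> \<open>(iv)\<close>
    (\<forall>i\<in>{1..k}.
       (\<forall>b. (\<forall>j\<in>{1..<i}. recursive_maximizer H (\<Gamma>\<^sub>2\<^sub>1 \<circ> \<Gamma>\<^sub>1\<^sub>2) \<Gamma>\<^sub>1\<^sub>1 b j (b j)) \<longrightarrow>
          (\<exists>x. recursive_maximizer H (\<Gamma>\<^sub>2\<^sub>1 \<circ> \<Gamma>\<^sub>1\<^sub>2) \<Gamma>\<^sub>1\<^sub>1 b i x) \<and>
          (\<forall>x. recursive_maximizer H (\<Gamma>\<^sub>2\<^sub>1 \<circ> \<Gamma>\<^sub>1\<^sub>2) \<Gamma>\<^sub>1\<^sub>1 b i x \<longrightarrow> x \<bullet> \<Gamma>\<^sub>2\<^sub>1 (\<Gamma>\<^sub>1\<^sub>2 x) = lam i)) \<and>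
       lam i = rr_min M H (f t) (f (t + \<delta>)) (i - 1) - rr_min M H (f t) (f (t + \<delta>)) i) \<and>
    \<comment> \<open>(v)\<close>
    (inj_on lam {1..k} \<and>
     (\<forall>i\<in>{1..k}. 0 < lam i \<and> pencil_multiplicity H (\<Gamma>\<^sub>2\<^sub>1 \<circ> \<Gamma>\<^sub>1\<^sub>2) \<Gamma>\<^sub>1\<^sub>1 (lam i) = 1) \<and>
     (\<forall>x\<in>H. x \<noteq> 0 \<longrightarrow> 0 < x \<bullet> \<Gamma>\<^sub>1\<^sub>1 x) \<longrightarrow>
     (\<forall>a b a' b'. rr_solution M H (f t) (f (t + \<delta>)) k a b \<longrightarrow>
        (rr_solution M H (f t) (f (t + \<delta>)) k a' b' \<longleftrightarrow>
         (\<exists>\<sigma> :: nat \<Rightarrow> real. \<forall>i\<in>{1..k}. (\<sigma> i = 1 \<or> \<sigma> i = - 1) \<and>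
            a' i = \<sigma> i *\<^sub>R a i \<and> b' i = \<sigma> i *\<^sub>R b i))))"
proof -
  interpret reduced_rank_prediction H \<Gamma>\<^sub>1\<^sub>1 \<Gamma>\<^sub>1\<^sub>2 \<Gamma>\<^sub>2\<^sub>1 "integral_operator T (\<lambda>s u. \<rho> u s)" M "f t" "f (t + \<delta>)"
    using AR1_reduced_rank_prediction[OF assms(4-6)] assms(7-10) by simp
  let ?P = "\<Gamma>\<^sub>2\<^sub>1 \<circ> \<Gamma>\<^sub>1\<^sub>2" and ?sol = "rr_solution M H (f t) (f (t + \<delta>)) k"
  obtain a0 b0 where feas: "rr_feasible M H (f t) k a0 b0" using assms(11) by blast
  have "orthonormal_wrt \<Gamma>\<^sub>1\<^sub>1 k b0" "\<And>i. i \<in> {1..k} \<Longrightarrow> b0 i \<in> H"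
    using feas by (auto simp: rr_feasible_def Q_cov)
  from leading_eigensystem_exists[OF this] obtain lam e where e: "leading_eigensystem k lam e" by blast
  have es: "eigensystem k lam e" using e by (simp add: leading_eigensystem_def)
  note sol = rr_solution_iff[OF e]
  have ex_sol: "(\<exists>a. ?sol a b) \<longleftrightarrow> eigensystem k lam b" for b
    unfolding sol by (auto intro: exI[of _ "\<lambda>i. \<Gamma>\<^sub>1\<^sub>2 (b i)"])
  have i: "\<exists>a b. ?sol a b" "\<forall>b. (\<exists>a. ?sol a b) \<longleftrightarrow>
      (\<forall>i\<in>{1..k}. pencil_eigenvector H ?P \<Gamma>\<^sub>1\<^sub>1 (lam i) (b i)) \<and> orthonormal_wrt \<Gamma>\<^sub>1\<^sub>1 k b"
    using ex_sol es unfolding eigensystem_def by blast+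
  have iii: "\<forall>b. (\<exists>a. ?sol a b) \<longleftrightarrow> (\<forall>i\<in>{1..k}. recursive_maximizer H ?P \<Gamma>\<^sub>1\<^sub>1 b i (b i))"
    unfolding ex_sol using recursive_maximizers_iff_eigensystem[OF e order_refl] by blast
  have iv: "(\<forall>b. (\<forall>j\<in>{1..<i}. recursive_maximizer H ?P \<Gamma>\<^sub>1\<^sub>1 b j (b j)) \<longrightarrow>
          (\<exists>x. recursive_maximizer H ?P \<Gamma>\<^sub>1\<^sub>1 b i x) \<and>
          (\<forall>x. recursive_maximizer H ?P \<Gamma>\<^sub>1\<^sub>1 b i x \<longrightarrow> x \<bullet> \<Gamma>\<^sub>2\<^sub>1 (\<Gamma>\<^sub>1\<^sub>2 x) = lam i)) \<and>
       lam i = rr_min M H (f t) (f (t + \<delta>)) (i - 1) - rr_min M H (f t) (f (t + \<delta>)) i"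
    if ik: "i \<in> {1..k}" for i
  proof -
    obtain m where m: "i = Suc m" using ik by (cases i) auto
    have mk: "Suc m \<le> k" using ik m by simp
    have "(\<exists>x. recursive_maximizer H ?P \<Gamma>\<^sub>1\<^sub>1 b (Suc m) x) \<and>
          (\<forall>x. recursive_maximizer H ?P \<Gamma>\<^sub>1\<^sub>1 b (Suc m) x \<longrightarrow> x \<bullet> \<Gamma>\<^sub>2\<^sub>1 (\<Gamma>\<^sub>1\<^sub>2 x) = lam (Suc m))"
      if "\<forall>j\<in>{1..<Suc m}. recursive_maximizer H ?P \<Gamma>\<^sub>1\<^sub>1 b j (b j)" for b
    proof -
      have b: "eigensystem m lam b"
        using recursive_maximizers_iff_eigensystem[OF e, of m b] mk that
        unfolding atLeastLessThanSuc_atLeastAtMost by simp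
      show ?thesis
        unfolding recursive_maximizer_iff[OF e mk b] inner_C_eq[symmetric] power2_norm_eq_inner[symmetric]
        using eigensystem_max_attained[OF e mk b] by blast
    qed
    moreover have "lam (Suc m) = rr_min M H (f t) (f (t + \<delta>)) m - rr_min M H (f t) (f (t + \<delta>)) (Suc m)"
      using rr_min_eq[OF leading_mono[OF e mk]] rr_min_eq[OF leading_mono[OF e, of m]] mk by simp
    ultimately show ?thesis unfolding m by simp
  qed
  have v: "?sol a' b' \<longleftrightarrow> (\<exists>\<sigma> :: nat \<Rightarrow> real. \<forall>i\<in>{1..k}. (\<sigma> i = 1 \<or> \<sigma> i = - 1) \<and>
        a' i = \<sigma> i *\<^sub>R a i \<and> b' i = \<sigma> i *\<^sub>R b i)"
    if simple: "\<forall>i\<in>{1..k}. 0 < lam i \<and> pencil_multiplicity H ?P \<Gamma>\<^sub>1\<^sub>1 (lam i) = 1"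
      and definite: "\<forall>x\<in>H. x \<noteq> 0 \<longrightarrow> 0 < x \<bullet> \<Gamma>\<^sub>1\<^sub>1 x" and s: "?sol a b" for a b a' b'
  proof -
    have ab: "\<forall>i\<in>{1..k}. a i = \<Gamma>\<^sub>1\<^sub>2 (b i)" "eigensystem k lam b" using s unfolding sol by auto
    show ?thesis
    proof
      assume "?sol a' b'"
      then have ab': "\<forall>i\<in>{1..k}. a' i = \<Gamma>\<^sub>1\<^sub>2 (b' i)" "eigensystem k lam b'" unfolding sol by auto
      define \<sigma> :: "nat \<Rightarrow> real" where "\<sigma> i = (if b' i = b i then 1 else - 1)" for i
      have b'_eq: "b' i = \<sigma> i *\<^sub>R b i" if i: "i \<in> {1..k}" for i
      proof -
        have "b' i = b i \<or> b' i = - b i"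
        proof (rule simple_eigenvectors_unique)
          show "pencil_multiplicity H ?P \<Gamma>\<^sub>1\<^sub>1 (lam i) = 1" using simple i by blast
          show "0 < x \<bullet> \<Gamma>\<^sub>1\<^sub>1 x" if "x \<in> H" "x \<noteq> 0" for x using definite that by blast
        qed (use ab(2) ab'(2) i in \<open>auto simp: eigensystem_def orthonormal_wrt_q\<close>)
        then show ?thesis by (auto simp: \<sigma>_def)
      qed
      moreover have "a' i = \<sigma> i *\<^sub>R a i" if i: "i \<in> {1..k}" for i
        using ab(1) ab'(1) i by (simp only: b'_eq[OF i] linear_cmul[OF linear_C])
      moreover have "\<sigma> i = 1 \<or> \<sigma> i = - 1" for i by (simp add: \<sigma>_def)
      ultimately show "\<exists>\<sigma> :: nat \<Rightarrow> real. \<forall>i\<in>{1..k}. (\<sigma> i = 1 \<or> \<sigma> i = - 1) \<and> a' i = \<sigma> i *\<^sub>R a i \<and> b' i = \<sigma> i *\<^sub>R b i"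
        by blast
    next
      assume "\<exists>\<sigma> :: nat \<Rightarrow> real. \<forall>i\<in>{1..k}. (\<sigma> i = 1 \<or> \<sigma> i = - 1) \<and> a' i = \<sigma> i *\<^sub>R a i \<and> b' i = \<sigma> i *\<^sub>R b i"
      then obtain \<sigma> :: "nat \<Rightarrow> real" where \<sigma>: "\<And>i. i \<in> {1..k} \<Longrightarrow> \<sigma> i = 1 \<or> \<sigma> i = - 1"
        and a': "\<And>i. i \<in> {1..k} \<Longrightarrow> a' i = \<sigma> i *\<^sub>R a i" and b': "\<And>i. i \<in> {1..k} \<Longrightarrow> b' i = \<sigma> i *\<^sub>R b i" by blast
      have "\<sigma> i * \<sigma> i = 1" if "i \<in> {1..k}" for i using \<sigma>[OF that] by auto
      then have "orthonormal_wrt \<Gamma>\<^sub>1\<^sub>1 k b'"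
        using ab(2) unfolding eigensystem_iff orthonormal_wrt_q by (simp add: b' q_simps)
      moreover have "b' i \<in> H \<and> \<Gamma>\<^sub>2\<^sub>1 (\<Gamma>\<^sub>1\<^sub>2 (b' i)) = lam i *\<^sub>R \<Gamma>\<^sub>1\<^sub>1 (b' i)" if i: "i \<in> {1..k}" for i
      proof -
        have "b i \<in> H" "\<Gamma>\<^sub>2\<^sub>1 (\<Gamma>\<^sub>1\<^sub>2 (b i)) = lam i *\<^sub>R \<Gamma>\<^sub>1\<^sub>1 (b i)"
          using ab(2) i unfolding eigensystem_iff by auto
        (* homogeneity is tested against inner products, via the adjoint relation *)
        moreover have "\<Gamma>\<^sub>2\<^sub>1 (c *\<^sub>R y) = c *\<^sub>R \<Gamma>\<^sub>2\<^sub>1 y" for c y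
          by (rule vector_eq_rdot[THEN iffD1]) (simp add: C_adjoint[symmetric] inner_commute[of _ "_ :: L2"])
        ultimately show ?thesis
          by (simp add: b'[OF i] linear_cmul[OF linear_C] linear_cmul[OF linear_Q] subspace_scale[OF subspace_H])
      qed
      ultimately have "eigensystem k lam b'" unfolding eigensystem_iff by blast
      moreover have "\<forall>i\<in>{1..k}. a' i = \<Gamma>\<^sub>1\<^sub>2 (b' i)"
        using ab(1) by (simp add: a' b' linear_cmul[OF linear_C])
      ultimately show "?sol a' b'" unfolding sol by blast
    qed
  qed
  show ?thesis
  proof (intro exI[of _ lam] conjI)
    show "leading_eigenvalues H ?P \<Gamma>\<^sub>1\<^sub>1 k lam" by (rule leading_eigenvalues_if_leading_eigensystem[OF e])
    show "\<forall>a b. ?sol a b \<longrightarrow> (\<forall>i\<in>{1..k}. a i = \<Gamma>\<^sub>1\<^sub>2 (b i))" unfolding sol by blast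
  qed (fact i iii | rule ballI, rule iv, assumption | intro impI allI, elim conjE, rule v, assumption+)+
qed

end
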